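(* Let $a,b,c$ be distinct primes with $a<b$ and $N(a,b,c)>1$, and suppose $(a,b,c)\notin\{(2,3,5),(2,3,11),(2,5,3),(2,7,3),(3,5,2),(3,13,2)\}$. Then $c\equiv 5\pmod{12}$, and the equation $a^x+b^y=c^z$ has exactly two solutions $(x_1,y_1,z_1)$ and $(x_2,y_2,z_2)$ in positive integers, which (after suitable labeling) satisfy $2\mid x_1$, $2\mid y_1$, $z_1=1$, and $2\nmid y_2$.
   Context: $N(a,b,c)$ denotes the number of triples $(x,y,z)$ of positive integers with $a^x+b^y=c^z$. *)

theory Defs
  imports "HOL-Computational_Algebra.Primes"
begin

definition sols :: "nat \<Rightarrow> nat \<Rightarrow> nat \<Rightarrow> (nat \<times> nat \<times> nat) set" where
  "sols a b c = {(x, y, z). x > 0 \<and> y > 0 \<and> z > 0 \<and> a ^ x + b ^ y = c ^ z}"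

text \<open>N(a,b,c): number of positive-integer solutions (x,y,z) of a^x + b^y = c^z.
  Note: card of an infinite set is 0 in Isabelle; for distinct primes the set is finite.\<close>
definition N :: "nat \<Rightarrow> nat \<Rightarrow> nat \<Rightarrow> nat" where
  "N a b c = card (sols a b c)"

end

theory Submission
  imports Defs "HOL-Number_Theory.Number_Theory" Complex_Main
begin

text \<open>
  Exactly one of the three primes is 2, so \<open>c = 2\<close> or \<open>a = 2\<close>.

  The key fact is that, for fixed parities of \<open>x\<close> and \<open>y\<close>, there is at most one solution (with the
  known exceptions for \<open>c = 2\<close>). Write \<open>a\<^sup>x = D\<^sub>1 U\<^sup>2\<close> and \<open>b\<^sup>y = D\<^sub>2 V\<^sup>2\<close> with \<open>D\<^sub>1 \<in> {a, a\<^sup>2}\<close> and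
  \<open>D\<^sub>2 \<in> {b, b\<^sup>2}\<close>. Since \<open>c\<close> is prime, all primitive elements \<open>u \<surd>D\<^sub>1 + v \<surd>-D\<^sub>2\<close> whose norm is a
  power of \<open>c\<close> are, up to sign and conjugation, odd powers of one of minimal norm. If
  \<open>U \<surd>D\<^sub>1 + V \<surd>-D\<^sub>2\<close> were a \<open>p\<close>-th power for an odd prime \<open>p\<close>, then the binomial expansion modulo
  \<open>a\<close>, \<open>b\<close> and \<open>p\<^sup>2\<close> would bound \<open>U\<close> and \<open>V\<close> in terms of the coordinates of the \<open>p\<close>-th root by a
  factor \<open>p\<close>, which is incompatible with the growth of the norm.

  For \<open>c = 2\<close>, two solutions of different parity types force \<open>a \<equiv> \<plusminus>1\<close> modulo the smaller of the
  two powers of 2, which exceeds \<open>a + 1\<close>. For \<open>a = 2\<close> and \<open>b, c \<noteq> 3\<close>, congruences modulo 3 leave only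
  the type (even, even) and one type with \<open>y\<close> odd; in type (even, even) a Gaussian integer argument
  gives \<open>z = 1\<close>. The cases \<open>b = 3\<close> and \<open>c = 3\<close> are settled by congruences and by the
  equation \<open>m\<^sup>2 + 2 = 3\<^sup>n\<close>.
\<close>

subsection \<open>Odd powers of a binomial\<close>

text \<open>The orders that contain the elements u sqrt(D1) + v sqrt(-D2) lack unique factorization.
  Its substitute is a fact about integers: as c is prime, a power of c dividing x^2 - y^2, with x
  prime to c, falls essentially into one of x - y and x + y, and this tells which of two conjugates
  to divide by. Even exponents are given D = a^2 rather than D = 1, so that no element has norm 1
  and only sign and conjugation stay ambiguous. The minimal norm in a given form need not be c
  itself; hence uniqueness says nothing about z, and z = 1 needs the Gaussian integers.

  The exceptions come from the identities 3 + 5 = 2^3, 3^3 + 5 = 2^5, 3 + 5^3 = 2^7; 3 + 13 = 2^4,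
  3^5 + 13 = 2^8; 2 + 5^2 = 3^3; 2^5 + 7^2 = 3^4; 2^4 + 3^2 = 5^2; 2 + 3^2 = 2^3 + 3 = 11. The
  identity 2^2 + 11^2 = 5^3 also turns up and has to be disposed of, although (2, 11, 5) is no
  exception. The modulus 65520 is the largest m such that t^12 is 1 modulo m for all t prime to
  m.\<close>

definition odd_part :: "nat \<Rightarrow> 'a::comm_ring_1 \<Rightarrow> 'a \<Rightarrow> 'a" where
  "odd_part k X Y = (\<Sum>m\<le>k. of_nat ((2 * k + 1) choose (2 * m + 1)) * X ^ m * Y ^ (k - m))"

lemma sum_lessThan_double:
  fixes f :: "nat \<Rightarrow> 'a::comm_monoid_add"
  shows "(\<Sum>j<2 * n. f j) = (\<Sum>m<n. f (2 * m) + f (2 * m + 1))"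
  by (induction n) (auto simp: ac_simps)

text \<open>In (x + y)^(2 k + 1) a term of odd degree in x has even degree in y and vice versa, so
  each half is x or y times a polynomial in x^2 and y^2. That polynomial is \<open>odd_part\<close>;
  written in the squares it stays an integer when x and y are square roots of integers.\<close>

lemma odd_power_add:
  fixes x y :: "'a::comm_ring_1"
  shows "(x + y) ^ (2 * k + 1) = x * odd_part k (x\<^sup>2) (y\<^sup>2) + y * odd_part k (y\<^sup>2) (x\<^sup>2)"
proof -
  define f where "f j = of_nat ((2 * k + 1) choose j) * x ^ j * y ^ (2 * k + 1 - j)" for j
  have "(x + y) ^ (2 * k + 1) = (\<Sum>j\<le>2 * k + 1. f j)"
    unfolding f_def by (rule binomial_ring)
  also have "\<dots> = (\<Sum>j<2 * Suc k. f j)"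
    by (simp add: lessThan_Suc_atMost)
  also have "\<dots> = (\<Sum>m<Suc k. f (2 * m) + f (2 * m + 1))"
    by (rule sum_lessThan_double)
  also have "\<dots> = (\<Sum>m\<le>k. f (2 * m + 1)) + (\<Sum>m\<le>k. f (2 * m))"
    by (simp add: sum.distrib lessThan_Suc_atMost add.commute)
  also have "(\<Sum>m\<le>k. f (2 * m + 1)) = x * odd_part k (x\<^sup>2) (y\<^sup>2)"
    unfolding odd_part_def sum_distrib_left
  proof (rule sum.cong[OF refl])
    fix m assume "m \<in> {..k}"
    then have "2 * k + 1 - (2 * m + 1) = 2 * (k - m)" by auto
    then show "f (2 * m + 1) = x * (of_nat ((2 * k + 1) choose (2 * m + 1)) * x\<^sup>2 ^ m * y\<^sup>2 ^ (k - m))"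
      unfolding f_def by (simp add: power_mult[symmetric] algebra_simps)
  qed
  \<comment> \<open>Reversing the summation turns even powers of x into odd powers of y, so the same
    \<open>odd_part\<close> appears with its arguments exchanged.\<close>
  also have "(\<Sum>m\<le>k. f (2 * m)) = (\<Sum>m\<le>k. f (2 * (k - m)))"
    by (rule sum.nat_diff_reindex[of "\<lambda>m. f (2 * m)" "Suc k", simplified lessThan_Suc_atMost, simplified, symmetric])
  also have "\<dots> = y * odd_part k (y\<^sup>2) (x\<^sup>2)"
    unfolding odd_part_def sum_distrib_left
  proof (rule sum.cong[OF refl])
    fix m assume m: "m \<in> {..k}"
    then have e: "2 * k + 1 - (2 * (k - m)) = 2 * m + 1" by auto
    have "(2 * k + 1) choose (2 * (k - m)) = (2 * k + 1) choose (2 * m + 1)"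
      using binomial_symmetric[of "2 * (k - m)" "2 * k + 1"] e by simp
    then show "f (2 * (k - m)) = y * (of_nat ((2 * k + 1) choose (2 * m + 1)) * y\<^sup>2 ^ m * x\<^sup>2 ^ (k - m))"
      unfolding f_def e by (simp add: power_mult[symmetric] algebra_simps)
  qed
  finally show ?thesis .
qed

lemma of_int_odd_part: "of_int (odd_part k X Y) = odd_part k (of_int X) (of_int Y)"
  by (simp add: odd_part_def)

lemma odd_part_scale: "odd_part k (t * X) (t * Y) = t ^ k * odd_part k X Y"
proof -
  have "of_nat ((2 * k + 1) choose (2 * m + 1)) * (t * X) ^ m * (t * Y) ^ (k - m)
      = t ^ k * (of_nat ((2 * k + 1) choose (2 * m + 1)) * X ^ m * Y ^ (k - m))" if "m \<le> k" for m
  proof -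
    have "t ^ k = t ^ m * t ^ (k - m)" using that by (simp flip: power_add)
    then show ?thesis by (simp add: power_mult_distrib algebra_simps)
  qed
  then show ?thesis by (simp add: odd_part_def sum_distrib_left)
qed

lemma odd_part_rec: 
  "odd_part k X Y = of_nat (2 * k + 1) * Y ^ k
     + (\<Sum>m\<in>{1..k}. of_nat ((2 * k + 1) choose (2 * m + 1)) * X ^ m * Y ^ (k - m))"
proof -
  have "{..k} = insert 0 {1..k}" by auto
  then show ?thesis by (simp add: odd_part_def)
qed

text \<open>Every term except the one for m = 0 contains a factor X.\<close>

lemma dvd_odd_part_diff:
  fixes a X Y :: int
  assumes "a dvd X"
  shows "a dvd odd_part k X Y - of_nat (2 * k + 1) * Y ^ k"
proof -
  have "a dvd of_nat ((2 * k + 1) choose (2 * m + 1)) * X ^ m * Y ^ (k - m)" if "m \<in> {1..k}" for m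
  proof -
    have "a dvd X ^ m" using that by (intro dvd_trans[OF assms dvd_power]) auto
    then show ?thesis by simp
  qed
  then show ?thesis unfolding odd_part_rec add_diff_cancel_left' by (intro dvd_sum)
qed

text \<open>With p = 2 k + 1, a middle term has one factor p from the binomial coefficient and one
  from X^m. The last term has coefficient 1, so X^k alone must supply p^2; this can fail only for p
  = 3, which is why that prime gets separate treatment.\<close>

lemma prime_sq_dvd_odd_part_diff:
  fixes X Y :: int
  assumes p: "prime (2 * k + 1)" and X: "int (2 * k + 1) dvd X"
    and k: "k \<ge> 2 \<or> (int (2 * k + 1))\<^sup>2 dvd X"
  shows "(int (2 * k + 1))\<^sup>2 dvd odd_part k X Y - of_nat (2 * k + 1) * Y ^ k"
proof -
  define p where "p = 2 * k + 1"
  have "(int p)\<^sup>2 dvd of_nat (p choose (2 * m + 1)) * X ^ m * Y ^ (k - m)" if m: "m \<in> {1..k}" for m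
  proof (cases "m < k")
    case True
    then have "p dvd (p choose (2 * m + 1))"
      using p m unfolding p_def by (intro dvd_choose_prime) auto
    then have "int p dvd int (p choose (2 * m + 1))" by (simp only: int_dvd_int_iff)
    moreover have "int p dvd X ^ m" using X m unfolding p_def by (intro dvd_trans[OF X dvd_power]) auto
    ultimately show ?thesis by (auto simp: power2_eq_square intro: mult_dvd_mono dvd_mult2)
  next
    case False
    then have "m = k" using m by auto
    have "(int p)\<^sup>2 dvd X ^ k"
      using k
    proof
      assume "k \<ge> 2"
      then show ?thesis using X unfolding p_def by (meson dvd_power_le)
    next
      assume "(int (2 * k + 1))\<^sup>2 dvd X"
      then show ?thesis using m \<open>m = k\<close> unfolding p_def by (metis atLeastAtMost_iff dvd_power dvd_trans less_eq_Suc_le One_nat_def)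
    qed
    then show ?thesis using \<open>m = k\<close> by simp
  qed
  then show ?thesis unfolding odd_part_rec p_def add_diff_cancel_left' by (intro dvd_sum)
qed

lemma odd_part_1: "odd_part 1 X Y = 3 * Y + X"
  by (simp add: odd_part_def atMost_Suc binomial_eq_0)

section \<open>Excluding p-th powers whose coordinates are powers of a and b\<close>

lemma prime_power_eq_prime:
  fixes b q :: nat
  assumes "prime b" "prime q" "b ^ f = q"
  shows "b = q"
  using assms by (metis prime_power_eq_one_iff prime_nat_iff dvd_power not_prime_1 gr0I power_0)

text \<open>Modulo a only p (-Y)^k with p = 2 k + 1 survives, and Y is prime to a. So a gain in the
  a-part of a coordinate forces a = p.\<close>

lemma prime_eq_if_dvd_odd_part:
  fixes a :: nat and X Y :: int
  assumes "prime a" "prime (2 * k + 1)" "int a dvd X" "\<not> int a dvd Y"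
    and "int a dvd odd_part k X (- Y)"
  shows "a = 2 * k + 1"
proof -
  have "int a dvd of_nat (2 * k + 1) * (- Y) ^ k"
    using dvd_odd_part_diff[OF assms(3), of k "- Y"] assms(5)
    by (metis dvd_diff_right_iff)
  then have "int a dvd int (2 * k + 1) \<or> int a dvd (- Y) ^ k"
    using assms(1) by (metis prime_dvd_mult_iff prime_nat_int_transfer of_nat_id of_nat_eq_iff)
  moreover have "\<not> int a dvd (- Y) ^ k"
    using assms(1,4) by (metis dvd_minus_iff prime_dvd_power prime_nat_int_transfer)
  ultimately have "a dvd 2 * k + 1" using int_dvd_int_iff by blast
  then show ?thesis using assms(1,2) by (metis primes_dvd_imp_eq)
qed

text \<open>The element (sqrt(a^e) + sqrt(-b^f)) / s of norm N is raised to the power p = 2 k + 1;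
  by \<open>R\<close> and \<open>S\<close> this multiplies the first coordinate by a^r and the
  second by 1, up to sign. Then a = p, and modulo a^2 the gain is r = 1 unless p = 3 and e = 1. So
  the norm grows at most by the factor a^2, whereas it must grow by N^(p - 1); only small cases
  survive. For s = 2 some of them are genuine, hence the excluded pairs.\<close>

lemma no_prime_step_aux:
  fixes a b s N :: nat
  assumes ab: "prime a" "prime b" "a \<noteq> b" and ef: "e \<ge> 1" "f \<ge> 1"
    and k: "k \<ge> 1" "prime (2 * k + 1)"
    and s: "s = 1 \<or> s = 2 \<and> odd a \<and> odd b \<and> {a, b} \<noteq> {3, 5} \<and> {a, b} \<noteq> {3, 13}"
    and R: "\<bar>odd_part k (int (a ^ e)) (- int (b ^ f))\<bar> = int (s ^ (2 * k) * a ^ r)" and r: "r \<ge> 1"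
    and S: "\<bar>odd_part k (int (b ^ f)) (- int (a ^ e))\<bar> = int (s ^ (2 * k))"
    and N: "a ^ e + b ^ f = s\<^sup>2 * N" "a ^ e * a ^ (2 * r) + b ^ f = s\<^sup>2 * N ^ (2 * k + 1)"
  shows False
proof -
  have aX: "int a dvd int (a ^ e)" using ef by (simp add: dvd_power)
  have aY: "\<not> int a dvd int (b ^ f)"
    using ab by (metis int_dvd_int_iff prime_dvd_power primes_dvd_imp_eq)
  have "int a dvd int (s ^ (2 * k) * a ^ r)"
    using r unfolding int_dvd_int_iff by (simp add: dvd_power)
  then have "int a dvd odd_part k (int (a ^ e)) (- int (b ^ f))"
    unfolding R[symmetric] by simp
  then have a: "a = 2 * k + 1"
    by (rule prime_eq_if_dvd_odd_part[OF ab(1) k(2) aX aY])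
  have N0: "N > 0" using N(1) ab by (metis add_is_0 gr0I mult_0_right not_prime_0 power_not_zero)
  show False
  proof (cases "k \<ge> 2 \<or> e \<ge> 2")
    case True
    \<comment> \<open>Otherwise a^2 divides the factor and hence, modulo a^2, the number a (-b^f)^k,
      although b is prime to a.\<close>
    have "r = 1"
    proof (rule ccontr)
      assume "r \<noteq> 1"
      then have "r \<ge> 2" using r by auto
      then have "int (a\<^sup>2) dvd int (s ^ (2 * k) * a ^ r)"
        unfolding int_dvd_int_iff by (simp add: le_imp_power_dvd)
      then have 1: "(int a)\<^sup>2 dvd odd_part k (int (a ^ e)) (- int (b ^ f))"
        unfolding R[symmetric] by simp
      have "(int a)\<^sup>2 dvd int (a ^ e)" if "e \<ge> 2"
        using that by (simp add: le_imp_power_dvd)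
      then have "(int a)\<^sup>2 dvd odd_part k (int (a ^ e)) (- int (b ^ f)) - of_nat (2 * k + 1) * (- int (b ^ f)) ^ k"
        using prime_sq_dvd_odd_part_diff[OF k(2), of "int (a ^ e)" "- int (b ^ f)"] aX True a by metis
      then have "(int a)\<^sup>2 dvd int a * (- int (b ^ f)) ^ k"
        using 1 a by (metis dvd_diff_right_iff)
      then have "int a dvd (- int (b ^ f)) ^ k"
        using prime_gt_0_nat[OF ab(1)] by (simp add: power2_eq_square)
      then show False using aY ab(1)
        by (metis dvd_minus_iff prime_dvd_power prime_nat_int_transfer)
    qed
    then have "s\<^sup>2 * N ^ (2 * k + 1) = a\<^sup>2 * a ^ e + b ^ f"
      using N(2) by (simp add: mult.commute)
    moreover have "b ^ f \<le> a\<^sup>2 * b ^ f" using prime_gt_0_nat[OF ab(1)] by simp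
    ultimately have "s\<^sup>2 * N ^ (2 * k + 1) \<le> a\<^sup>2 * (a ^ e + b ^ f)"
      unfolding distrib_left by linarith
    then have "s\<^sup>2 * N * N ^ (2 * k) \<le> s\<^sup>2 * N * a\<^sup>2"
      unfolding N(1) by (simp add: algebra_simps)
    then have le: "N ^ (2 * k) \<le> a\<^sup>2"
      using N0 s by auto
    have ae: "a ^ e \<ge> a" using ef prime_ge_1_nat[OF ab(1)] by (metis power_increasing power_one_right)
    from s show False
    proof
      assume "s = 1"
      then have "N = a ^ e + b ^ f" using N(1) by simp
      moreover have "b ^ f > 0" using prime_gt_0_nat[OF ab(2)] by simp
      ultimately have "N > a" using ae by linarith
      then have "N\<^sup>2 > a\<^sup>2" by (simp add: power_strict_mono)
      moreover have "N\<^sup>2 \<le> N ^ (2 * k)" using k(1) N0 by (intro power_increasing) auto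
      ultimately show False using le by linarith
    next
      assume s2: "s = 2 \<and> odd a \<and> odd b \<and> {a, b} \<noteq> {3, 5} \<and> {a, b} \<noteq> {3, 13}"
      then have ob: "odd b" by simp
      then have b3: "b \<ge> 3" using prime_ge_2_nat[OF ab(2)] by presburger
      have bf: "b ^ f \<ge> b" using ef prime_ge_1_nat[OF ab(2)] by (metis power_increasing power_one_right)
      have N4: "a ^ e + b ^ f = 4 * N" using N(1) s2 by simp
      show False
      proof (cases "k \<ge> 2")
        \<comment> \<open>N^4 is at most a^2 and a + 3 is at most 4 N. This allows only a < 10 and N
          < 3, hence a = 5 and b = 3.\<close>
        case True
        have "(N\<^sup>2)\<^sup>2 \<le> N ^ (2 * k)" using True N0 by (simp flip: power_mult add: power_increasing)
        then have "(N\<^sup>2)\<^sup>2 \<le> a\<^sup>2" using le by linarith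
        then have Na: "N\<^sup>2 \<le> a" by (rule power2_le_imp_le) simp
        have "a + 3 \<le> 4 * N" using N4 ae bf b3 by linarith
        then have "(a + 3)\<^sup>2 \<le> (4 * N)\<^sup>2" by (rule power_mono) simp
        then have "(a + 3)\<^sup>2 \<le> 16 * a" using Na by (simp add: power_mult_distrib)
        then have sq: "a * a + 6 * a + 9 \<le> 16 * a" by (simp add: power2_eq_square algebra_simps)
        have "a < 10"
        proof (rule ccontr)
          assume "\<not> a < 10"
          then have "10 * a \<le> a * a" by simp
          then show False using sq by linarith
        qed
        have "N < 3" 
        proof (rule ccontr)
          assume "\<not> N < 3"
          then have "3\<^sup>2 \<le> N\<^sup>2" by (intro power_mono) auto
          then have "a = 9" using Na \<open>a < 10\<close> by simp
          then show False using ab(1) by simp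
        qed
        then have "a ^ e + b ^ f \<le> 8" using N4 by linarith
        then have "a + b \<le> 8" using ae bf by linarith
        moreover have "a \<ge> 5" using a True by simp
        ultimately have "b = 3" "a = 5" using b3 by auto
        then show False using s2 by auto
      next
        case False
        then have k1: "k = 1" using k(1) by auto
        then have a3: "a = 3" using a by simp
        have "e \<ge> 2" using \<open>k \<ge> 2 \<or> e \<ge> 2\<close> False by auto
        then have "a ^ e \<ge> 9" using a3 power_increasing[of 2 e "3::nat"] by simp
        moreover have "b \<noteq> 3" using ab(3) a3 by simp
        then have "b \<ge> 5" using b3 ob by presburger
        moreover have "N\<^sup>2 \<le> 3\<^sup>2" using le k1 a3 by simp
        then have "N \<le> 3" by (rule power2_le_imp_le) simp
        ultimately show False using N4 bf by linarith
      qed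
    qed
  next
    case False
    then have k1: "k = 1" and e1: "e = 1" using k(1) ef(1) by auto
    then have a3: "a = 3" using a by simp
    \<comment> \<open>For p = 3 and a^e = 3 the second coordinate gets the factor b^f - 9, whose
      absolute value has to be s^2.\<close>
    have "\<bar>odd_part 1 (int (b ^ f)) (- 3)\<bar> = int (s\<^sup>2)" using S k1 e1 a3 by simp
    then have Y: "\<bar>int (b ^ f) - 9\<bar> = int (s\<^sup>2)" unfolding odd_part_1 by simp
    from s show False
    proof
      assume s1: "s = 1"
      then have "\<bar>int (b ^ f) - 9\<bar> = 1" using Y by simp
      then have "int (b ^ f) = int 10 \<or> int (b ^ f) = int 8" by auto
      then have "b ^ f = 10 \<or> b ^ f = 8" unfolding of_nat_eq_iff .
      then show False
      proof
        assume *: "b ^ f = 10"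
        then have "2 dvd b ^ f" "5 dvd b ^ f" by auto
        then have "2 dvd b" "5 dvd b" using prime_dvd_power[of 2 b f] prime_dvd_power[of 5 b f] by simp_all
        then have "2 = b" "5 = b"
          using primes_dvd_imp_eq[of 2 b] primes_dvd_imp_eq[of 5 b] ab(2) by simp_all
        then show False by simp
      next
        \<comment> \<open>Here the second coordinate is as required, but the first one gets the
          factor 3 - 24 = -21, which is no power of 3 up to sign.\<close>
        assume *: "b ^ f = 8"
        have "\<bar>odd_part 1 3 (- 8)\<bar> = int (3 ^ r)" using R k1 e1 a3 s1 * by simp
        then have "int 21 = int (3 ^ r)" unfolding odd_part_1 by simp
        then have "(3::nat) ^ r = 7 * 3" unfolding of_nat_eq_iff by simp
        then have "7 dvd (3::nat) ^ r" by simp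
        then have "7 dvd (3::nat)" by (intro prime_dvd_power[of 7 3 r]) auto
        then show False by simp
      qed
    next
      assume s2: "s = 2 \<and> odd a \<and> odd b \<and> {a, b} \<noteq> {3, 5} \<and> {a, b} \<noteq> {3, 13}"
      then have "\<bar>int (b ^ f) - 9\<bar> = 4" using Y by simp
      then have "int (b ^ f) = int 13 \<or> int (b ^ f) = int 5" by auto
      then have "b ^ f = 13 \<or> b ^ f = 5" unfolding of_nat_eq_iff .
      then have "b = 13 \<or> b = 5"
        using prime_power_eq_prime[OF ab(2), of 13] prime_power_eq_prime[OF ab(2), of 5] by auto
      then show False using s2 a3 by auto
    qed
  qed
qed

text \<open>If r = q = 0, the norm does not change, so N = 1, which is too small. If r and q are
  both positive, then a = p = b. If just one of them vanishes, \<open>no_prime_step_aux\<close>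
  applies, possibly with a and b exchanged.\<close>

lemma no_prime_step:
  fixes a b s N :: nat
  assumes ab: "prime a" "prime b" "a \<noteq> b" and ef: "e \<ge> 1" "f \<ge> 1"
    and k: "k \<ge> 1" "prime (2 * k + 1)"
    and s: "s = 1 \<or> s = 2 \<and> odd a \<and> odd b \<and> {a, b} \<noteq> {3, 5} \<and> {a, b} \<noteq> {3, 13}"
    and R: "\<bar>odd_part k (int (a ^ e)) (- int (b ^ f))\<bar> = int (s ^ (2 * k) * a ^ r)"
    and S: "\<bar>odd_part k (int (b ^ f)) (- int (a ^ e))\<bar> = int (s ^ (2 * k) * b ^ q)"
    and N: "a ^ e + b ^ f = s\<^sup>2 * N" "a ^ e * a ^ (2 * r) + b ^ f * b ^ (2 * q) = s\<^sup>2 * N ^ (2 * k + 1)"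
  shows False
proof (cases "r = 0")
  case r0: True
  show False
  proof (cases "q = 0")
    case True
    have N0: "N > 0" using N(1) ab by (metis add_is_0 gr0I mult_0_right not_prime_0 power_not_zero)
    have "s\<^sup>2 > 0" using s by auto
    moreover have "a ^ e * a ^ (2 * r) + b ^ f * b ^ (2 * q) = a ^ e + b ^ f" using True r0 by simp
    then have "s\<^sup>2 * N ^ (2 * k + 1) = s\<^sup>2 * N" using N by metis
    ultimately have "N ^ (2 * k) = 1" using N0 by simp
    then have "N = 1" using k(1) by (simp add: nat_power_eq_Suc_0_iff)
    then have sum: "a ^ e + b ^ f = s\<^sup>2" using N(1) by simp
    have ae: "a ^ e \<ge> a" using ef prime_ge_1_nat[OF ab(1)] by (metis power_increasing power_one_right)
    have bf: "b ^ f \<ge> b" using ef prime_ge_1_nat[OF ab(2)] by (metis power_increasing power_one_right)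
    show False using s
    proof
      assume "s = 1"
      then show False using sum ae bf prime_ge_2_nat[OF ab(1)] prime_ge_2_nat[OF ab(2)] by simp
    next
      assume s2: "s = 2 \<and> odd a \<and> odd b \<and> {a, b} \<noteq> {3, 5} \<and> {a, b} \<noteq> {3, 13}"
      then have "a \<noteq> 2" by auto
      then show False using s2 sum ae bf prime_ge_2_nat[OF ab(1)] prime_ge_2_nat[OF ab(2)] by simp
    qed
  next
    case False
    have s': "s = 1 \<or> s = 2 \<and> odd b \<and> odd a \<and> {b, a} \<noteq> {3, 5} \<and> {b, a} \<noteq> {3, 13}"
      unfolding insert_commute[of b a] using s by argo
    show False
      by (rule no_prime_step_aux[OF ab(2,1) ab(3)[symmetric] ef(2,1) k s' S, of N])
        (use False R N r0 in \<open>simp_all add: add.commute\<close>)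
  qed
next
  case r: False
  show False
  proof (cases "q = 0")
    case True
    show False
      by (rule no_prime_step_aux[OF ab ef k s R, of N]) (use True r S N in simp_all)
  next
    case False
    have 1: "\<not> int a dvd int (b ^ f)" "\<not> int b dvd int (a ^ e)"
      using ab by (metis int_dvd_int_iff prime_dvd_power primes_dvd_imp_eq)+
    have "int a dvd int (s ^ (2 * k) * a ^ r)" "int b dvd int (s ^ (2 * k) * b ^ q)"
      using r False unfolding int_dvd_int_iff by (simp_all add: dvd_power)
    then have "int a dvd odd_part k (int (a ^ e)) (- int (b ^ f))"
      "int b dvd odd_part k (int (b ^ f)) (- int (a ^ e))"
      unfolding R[symmetric] S[symmetric] by simp_all
    moreover have "int a dvd int (a ^ e)" "int b dvd int (b ^ f)"
      using ef by (simp_all add: dvd_power)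
    ultimately have "a = 2 * k + 1" "b = 2 * k + 1"
      using prime_eq_if_dvd_odd_part[OF ab(1) k(2) _ 1(1)] prime_eq_if_dvd_odd_part[OF ab(2) k(2) _ 1(2)]
      by blast+
    then show False using ab(3) by simp
  qed
qed

subsection \<open>Powers of a prime represented by a binary form\<close>

text \<open>The denominator \<open>s = 2\<close> occurs only for \<open>c = 2\<close>, where the elements are half-integral.\<close>

locale norm_form =
  fixes D1 D2 c s :: nat
  assumes prime_c: "prime c"
    and D1: "D1 \<ge> 2" "coprime D1 c" and D2: "D2 \<ge> 2" "coprime D2 c"
    and s_cases: "s = 1 \<and> odd c \<or> s = 2 \<and> c = 2"
begin

definition represents :: "nat \<Rightarrow> int \<Rightarrow> int \<Rightarrow> bool" where
  "represents n u v \<longleftrightarrow> int D1 * u\<^sup>2 + int D2 * v\<^sup>2 = int s ^ 2 * int c ^ n"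

text \<open>The numbers (u sqrt(D1) + v sqrt(-D2)) / s are not closed under multiplication: a
  product of two is a combination of 1 and sqrt(-D1 D2), and only a product of three has the old
  shape again. Hence elements are multiplied by squares and only odd powers occur.\<close>

definition el :: "int \<Rightarrow> int \<Rightarrow> complex" where
  "el u v = Complex (of_int u * sqrt D1 / s) (of_int v * sqrt D2 / s)"

lemma s_pos: "s > 0" using s_cases by auto

lemma s_square_cancel: "int s ^ 2 * x = int s ^ 2 * y \<Longrightarrow> x = y"
  using s_pos by simp

lemma c_ge: "c \<ge> 2" using prime_c by (rule prime_ge_2_nat)

lemma prime_int_c: "prime (int c)" using prime_c by simp

lemma D_not_dvd: "\<not> int c dvd int D1" "\<not> int c dvd int D2"
  using D1(2) D2(2) prime_c by (metis coprime_absorb_right int_dvd_int_iff not_prime_unit)+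

lemma odd_D: "s = 2 \<Longrightarrow> odd (int D1) \<and> odd (int D2)"
  using D_not_dvd s_cases by auto

lemma D_ge_3: "s = 2 \<Longrightarrow> D1 \<ge> 3 \<and> D2 \<ge> 3"
  using odd_D D1(1) D2(1) by presburger

lemma el_eq_iff: "el u v = el u' v' \<longleftrightarrow> u = u' \<and> v = v'"
  using D1(1) D2(1) s_pos by (auto simp: el_def)

lemma el_uminus: "- el u v = el (- u) (- v)"
  by (simp add: el_def complex_eq_iff)

lemma el_cnj: "cnj (el u v) = el u (- v)"
  by (simp add: el_def complex_eq_iff)

lemma el_mult_int: "of_int k * el u v = el (k * u) (k * v)"
  by (simp add: el_def complex_eq_iff)

lemma norm_el:
  assumes "represents n u v"
  shows "(cmod (el u v))\<^sup>2 = real c ^ n"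
proof -
  have "real_of_int (int D1 * u\<^sup>2 + int D2 * v\<^sup>2) = real_of_int (int s ^ 2 * int c ^ n)"
    using assms unfolding represents_def by simp
  then have "D1 * (real_of_int u)\<^sup>2 + D2 * (real_of_int v)\<^sup>2 = real s ^ 2 * real c ^ n"
    by simp
  moreover have "(cmod (el u v))\<^sup>2 = (D1 * (real_of_int u)\<^sup>2 + D2 * (real_of_int v)\<^sup>2) / real s ^ 2"
    by (simp add: el_def cmod_power2 power_divide power_mult_distrib add_divide_distrib mult.commute)
  ultimately show ?thesis using s_pos by simp
qed

lemma el_mult_cnj:
  assumes "represents n u v"
  shows "el u v * el u (- v) = of_int (int c ^ n)"
proof -
  have "el u v * el u (- v) = complex_of_real ((cmod (el u v))\<^sup>2)"
    using complex_norm_square[of "el u v"] by (simp add: el_cnj)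
  then show ?thesis unfolding norm_el[OF assms] by simp
qed

text \<open>P and Q are the coordinates of the square: (el a b)^2 = (P + Q sqrt(-D1 D2)) /
  s.\<close>

lemma el_mult_square:
  assumes "int s * P = int D1 * a\<^sup>2 - int D2 * b\<^sup>2" "int s * Q = 2 * a * b"
    and "int s * u' = u * P - int D2 * v * Q" "int s * v' = v * P + int D1 * u * Q"
  shows "el u' v' = el u v * (el a b)\<^sup>2"
proof -
  define S where "S = real s"
  have S: "S \<noteq> 0" using s_pos by (simp add: S_def)
  define e f where "e = sqrt D1" and "f = sqrt D2"
  have ef: "real D1 = e\<^sup>2" "real D2 = f\<^sup>2" by (simp_all add: e_def f_def)
  have "real_of_int (int s * P) = real_of_int (int D1 * a\<^sup>2 - int D2 * b\<^sup>2)"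
    "real_of_int (int s * Q) = real_of_int (2 * a * b)"
    "real_of_int (int s * u') = real_of_int (u * P - int D2 * v * Q)"
    "real_of_int (int s * v') = real_of_int (v * P + int D1 * u * Q)"
    using assms by simp_all
  then have *: "of_int P = (e\<^sup>2 * (of_int a)\<^sup>2 - f\<^sup>2 * (of_int b)\<^sup>2) / S" "of_int Q = 2 * of_int a * of_int b / S"
    "of_int u' = (of_int u * of_int P - f\<^sup>2 * of_int v * of_int Q) / S"
    "of_int v' = (of_int v * of_int P + e\<^sup>2 * of_int u * of_int Q) / S"
    using S by (simp_all add: field_simps S_def flip: ef)
  show ?thesis
    unfolding el_def S_def[symmetric] e_def[symmetric] f_def[symmetric] *(3,4)
    unfolding *(1,2)
    using S by (simp add: complex_eq_iff power2_eq_square field_simps)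
qed

lemma represents_parity:
  assumes "represents n u v" "s = 2"
  shows "even u = even v"
proof -
  have "even (int D1 * u\<^sup>2 + int D2 * v\<^sup>2)" using assms unfolding represents_def by simp
  then show ?thesis using odd_D[OF assms(2)] by simp
qed

text \<open>For s = 2 the division by s is exact because the norm equation turns D1 a^2 - D2 b^2
  into 2 (D1 a^2 - 2 2^h). The same substitution shows that modulo c the number P is 2 D1 a^2 for s
  = 1 and D1 a^2 for s = 2, so that primitivity passes to the square.\<close>

lemma ex_square_coords:
  assumes "represents h a b"
  obtains P Q where "int s * P = int D1 * a\<^sup>2 - int D2 * b\<^sup>2" "int s * Q = 2 * a * b"
    "P\<^sup>2 + int D1 * int D2 * Q\<^sup>2 = int s ^ 2 * int c ^ (2 * h)"
    "s = 2 \<Longrightarrow> even P = even Q"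
    "h \<ge> 1 \<Longrightarrow> \<not> int c dvd a \<Longrightarrow> \<not> int c dvd P"
proof -
  have "\<exists>P Q. int s * P = int D1 * a\<^sup>2 - int D2 * b\<^sup>2 \<and> int s * Q = 2 * a * b
      \<and> (s = 2 \<longrightarrow> even P = even Q) \<and> (h \<ge> 1 \<longrightarrow> \<not> int c dvd a \<longrightarrow> \<not> int c dvd P)"
    using s_cases
  proof
    assume s: "s = 1 \<and> odd c"
    have eq: "int D1 * a\<^sup>2 - int D2 * b\<^sup>2 = 2 * int D1 * a\<^sup>2 - int c ^ h"
      using assms s unfolding represents_def by simp
    have "\<not> int c dvd int D1 * a\<^sup>2 - int D2 * b\<^sup>2" if "h \<ge> 1" "\<not> int c dvd a"
    proof
      assume "int c dvd int D1 * a\<^sup>2 - int D2 * b\<^sup>2"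
      moreover have "int c dvd int c ^ h" using that(1) by (simp add: dvd_power)
      ultimately have "int c dvd 2 * (int D1 * a\<^sup>2)" unfolding eq by (simp add: dvd_diff_left_iff mult.assoc)
      moreover have "\<not> int c dvd 2"
        using s prime_c c_ge by (metis int_dvd_int_iff of_nat_numeral primes_dvd_imp_eq two_is_prime_nat even_numeral)
      ultimately show False
        using D_not_dvd(1) that(2) prime_int_c by (meson prime_dvd_mult_iff prime_dvd_power)
    qed
    then show ?thesis using s
      by (intro exI[of _ "int D1 * a\<^sup>2 - int D2 * b\<^sup>2"] exI[of _ "2 * a * b"]) simp
  next
    assume s: "s = 2 \<and> c = 2"
    have eq: "int D1 * a\<^sup>2 - int D2 * b\<^sup>2 = 2 * (int D1 * a\<^sup>2 - 2 * 2 ^ h)"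
      using assms s unfolding represents_def by simp
    have od: "odd (int D1)" and par: "even a = even b"
      using odd_D represents_parity[OF assms] s by blast+
    have "even (int D1 * a\<^sup>2 - 2 * 2 ^ h) = even a" "even (a * b) = even a"
      using od par by simp_all
    then have "even (int D1 * a\<^sup>2 - 2 * 2 ^ h) = even (a * b)"
      "\<not> int c dvd a \<longrightarrow> \<not> int c dvd int D1 * a\<^sup>2 - 2 * 2 ^ h"
      using s od by simp_all
    moreover have "int s * (int D1 * a\<^sup>2 - 2 * 2 ^ h) = int D1 * a\<^sup>2 - int D2 * b\<^sup>2"
      "int s * (a * b) = 2 * a * b"
      using s eq by simp_all
    ultimately show ?thesis by metis
  qed
  then obtain P Q where PQ: "int s * P = int D1 * a\<^sup>2 - int D2 * b\<^sup>2" "int s * Q = 2 * a * b"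
      "s = 2 \<longrightarrow> even P = even Q" "h \<ge> 1 \<longrightarrow> \<not> int c dvd a \<longrightarrow> \<not> int c dvd P" by blast
  have "int s ^ 2 * (P\<^sup>2 + int D1 * int D2 * Q\<^sup>2) = (int s * P)\<^sup>2 + int D1 * int D2 * (int s * Q)\<^sup>2"
    by (simp add: power_mult_distrib algebra_simps)
  also have "\<dots> = (int D1 * a\<^sup>2 + int D2 * b\<^sup>2)\<^sup>2"
    unfolding PQ by (simp add: power2_eq_square algebra_simps)
  also have "\<dots> = int s ^ 2 * (int s ^ 2 * int c ^ (2 * h))"
    using assms unfolding represents_def by (simp add: power_mult_distrib power2_eq_square mult_2 power_add)
  finally have "P\<^sup>2 + int D1 * int D2 * Q\<^sup>2 = int s ^ 2 * int c ^ (2 * h)"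
    by (rule s_square_cancel)
  with PQ show ?thesis by (intro that[of P Q]) simp_all
qed

text \<open>No element has norm 1. For s = 1 both D are at least 2; for s = 2 they are odd and at
  least 3, so neither D = 4 nor D1 + D2 = 4 can occur.\<close>

lemma not_represents_0: "\<not> represents 0 u v"
proof
  assume "represents 0 u v"
  then have eq: "int D1 * u\<^sup>2 + int D2 * v\<^sup>2 = int s ^ 2" unfolding represents_def by simp
  have D: "int D1 \<ge> 2" "int D2 \<ge> 2" using D1 D2 by auto
  have sq: "x = 0 \<or> x\<^sup>2 = 1 \<or> x\<^sup>2 \<ge> 4" for x :: int
  proof -
    have "x = 0 \<or> \<bar>x\<bar> = 1 \<or> \<bar>x\<bar> \<ge> 2" by linarith
    then show ?thesis
      using power_mono[of 2 "\<bar>x\<bar>" 2] by (auto simp: power2_eq_1_iff)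
  qed
  have le: "x \<ge> 4 \<Longrightarrow> D \<ge> 2 \<Longrightarrow> D * x \<ge> 8" for D x :: int
    using mult_mono[of 2 D 4 x] by simp
  from s_cases show False
  proof
    assume "s = 1 \<and> odd c"
    then have "int D1 * u\<^sup>2 + int D2 * v\<^sup>2 = 1" using eq by simp
    then show False
      using sq[of u] sq[of v] le[of "u\<^sup>2" "int D1"] le[of "v\<^sup>2" "int D2"] D
        mult_nonneg_nonneg[of "int D1" "u\<^sup>2"] mult_nonneg_nonneg[of "int D2" "v\<^sup>2"] by auto
  next
    assume s: "s = 2 \<and> c = 2"
    then have "int D1 * u\<^sup>2 + int D2 * v\<^sup>2 = 4" using eq by simp
    moreover have "int D1 \<ge> 3" "int D2 \<ge> 3" using D_ge_3 s by auto
    moreover have "int D1 \<noteq> 4" "int D2 \<noteq> 4" using odd_D s by auto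
    ultimately show False
      using sq[of u] sq[of v] le[of "u\<^sup>2" "int D1"] le[of "v\<^sup>2" "int D2"] D
        mult_nonneg_nonneg[of "int D1" "u\<^sup>2"] mult_nonneg_nonneg[of "int D2" "v\<^sup>2"] by auto
  qed
qed

section \<open>Divisibility by c and descent to an element of minimal norm\<close>

lemma c_dvd_snd:
  assumes "represents n u v" "n \<ge> 1" "int c dvd u"
  shows "int c dvd v"
proof -
  have "int c dvd int D1 * u\<^sup>2 + int D2 * v\<^sup>2"
    using assms(1,2) unfolding represents_def by (simp add: dvd_power)
  moreover have "int c dvd int D1 * u\<^sup>2" using assms(3) by (simp add: power2_eq_square)
  ultimately have "int c dvd int D2 * v\<^sup>2" by (simp add: dvd_add_right_iff)
  then show ?thesis using D_not_dvd(2) prime_int_c by (meson prime_dvd_mult_iff prime_dvd_power)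
qed

lemma c_dvd_fst:
  assumes "represents n u v" "n \<ge> 1" "int c dvd v"
  shows "int c dvd u"
proof -
  have "int c dvd int D1 * u\<^sup>2 + int D2 * v\<^sup>2"
    using assms(1,2) unfolding represents_def by (simp add: dvd_power)
  moreover have "int c dvd int D2 * v\<^sup>2" using assms(3) by (simp add: power2_eq_square)
  ultimately have "int c dvd int D1 * u\<^sup>2" by (simp add: dvd_add_left_iff)
  then show ?thesis using D_not_dvd(1) prime_int_c by (meson prime_dvd_mult_iff prime_dvd_power)
qed

text \<open>An odd c dividing both factors of x^2 - y^2 would divide 2 x. For c = 2 both factors are
  even, but their halves have the odd sum x, so at most one half is even. Either way one factor
  takes the whole remaining power of c; in the descent this decides which conjugate to divide
  by.\<close>

lemma dvd_diff_squares:
  assumes "\<not> int c dvd x" and dvd: "int s ^ 2 * int c ^ m dvd x\<^sup>2 - y\<^sup>2"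
  shows "int s * int c ^ m dvd x - y \<or> int s * int c ^ m dvd x + y"
proof -
  have f: "x\<^sup>2 - y\<^sup>2 = (x - y) * (x + y)" by (simp add: power2_eq_square algebra_simps)
  from s_cases show ?thesis
  proof
    assume s: "s = 1 \<and> odd c"
    have "\<not> (int c dvd x - y \<and> int c dvd x + y)"
    proof
      assume "int c dvd x - y \<and> int c dvd x + y"
      then have "int c dvd (x - y) + (x + y)" using dvd_add by blast
      then have "int c dvd 2 * x" by simp
      moreover have "\<not> int c dvd 2"
        using s prime_c by (metis int_dvd_int_iff of_nat_numeral primes_dvd_imp_eq two_is_prime_nat even_numeral)
      ultimately show False using assms(1) prime_int_c by (meson prime_dvd_mult_iff)
    qed
    then have "coprime (int c ^ m) (x - y) \<or> coprime (int c ^ m) (x + y)"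
      using prime_imp_coprime[OF prime_int_c] by auto
    then show ?thesis
      using dvd s unfolding f
      by (auto simp: coprime_dvd_mult_right_iff coprime_dvd_mult_left_iff)
  next
    assume s: "s = 2 \<and> c = 2"
    then have ox: "odd x" using assms(1) by simp
    have dvd4: "4 * 2 ^ m dvd x\<^sup>2 - y\<^sup>2" using dvd s by simp
    then have "even (x\<^sup>2 - y\<^sup>2)" by (meson dvd_mult_left dvd_trans even_numeral)
    then have oy: "odd y" using ox by simp
    obtain p q where p: "x - y = 2 * p" and q: "x + y = 2 * q" using ox oy
      by (metis dvdE even_add even_diff)
    then have "x = p + q" by linarith
    then have "odd p \<or> odd q" using ox by auto
    moreover have "2 ^ m dvd p * q" using dvd4 unfolding f p q by simp
    ultimately have "2 ^ m dvd p \<or> 2 ^ m dvd q"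
      by (metis coprime_dvd_mult_left_iff coprime_dvd_mult_right_iff coprime_left_2_iff_odd coprime_power_left_iff)
    then show ?thesis using s p q by auto
  qed
qed

text \<open>For s = 2 the numbers u and v, and likewise P and Q, have equal parity and D1, D2 are
  odd, which makes the division by s exact.\<close>

lemma represents_mult_square:
  assumes uv: "represents n u v" and ab: "represents h a b"
  obtains u' v' where "represents (n + 2 * h) u' v'" "el u' v' = el u v * (el a b)\<^sup>2"
proof -
  obtain P Q where PQ: "int s * P = int D1 * a\<^sup>2 - int D2 * b\<^sup>2" "int s * Q = 2 * a * b"
    "P\<^sup>2 + int D1 * int D2 * Q\<^sup>2 = int s ^ 2 * int c ^ (2 * h)" "s = 2 \<Longrightarrow> even P = even Q"
    using ex_square_coords[OF ab] by metis
  have "int s dvd u * P - int D2 * v * Q \<and> int s dvd v * P + int D1 * u * Q"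
    using s_cases
  proof
    assume "s = 2 \<and> c = 2"
    then show ?thesis using PQ(4) represents_parity[OF uv] odd_D by auto
  qed simp
  then obtain u' v' where eq: "int s * u' = u * P - int D2 * v * Q" "int s * v' = v * P + int D1 * u * Q"
    by (metis dvdE)
  have "int s ^ 2 * (int D1 * u'\<^sup>2 + int D2 * v'\<^sup>2) = int D1 * (int s * u')\<^sup>2 + int D2 * (int s * v')\<^sup>2"
    by (simp add: power_mult_distrib algebra_simps)
  also have "\<dots> = (int D1 * u\<^sup>2 + int D2 * v\<^sup>2) * (P\<^sup>2 + int D1 * int D2 * Q\<^sup>2)"
    unfolding eq by (simp add: power2_eq_square algebra_simps)
  also have "\<dots> = int s ^ 2 * (int s ^ 2 * int c ^ (n + 2 * h))"
    using uv unfolding represents_def PQ(3) by (simp add: power_add)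
  finally have "represents (n + 2 * h) u' v'"
    unfolding represents_def by (rule s_square_cancel)
  then show ?thesis using that el_mult_square[OF PQ(1,2) eq] by blast
qed

lemma represents_mult_even_power:
  assumes uv: "represents n u v" and ab: "represents h a b"
  shows "\<exists>u' v'. represents (n + 2 * h * j) u' v' \<and> el u' v' = el u v * (el a b) ^ (2 * j)"
proof (induction j)
  case 0
  then show ?case using uv by auto
next
  case (Suc j)
  then obtain u' v' where *: "represents (n + 2 * h * j) u' v'" "el u' v' = el u v * (el a b) ^ (2 * j)" by blast
  obtain u2 v2 where "represents (n + 2 * h * j + 2 * h) u2 v2" "el u2 v2 = el u' v' * (el a b)\<^sup>2"
    using represents_mult_square[OF *(1) ab] by blast
  then show ?case using *(2)
    by (intro exI[of _ u2] exI[of _ v2]) (simp add: algebra_simps power2_eq_square)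
qed

lemma represents_odd_power:
  assumes ab: "represents h a b" and "odd t"
  shows "\<exists>u v. represents (h * t) u v \<and> el u v = (el a b) ^ t"
proof -
  obtain j where "t = 2 * j + 1" using assms(2) by (metis oddE)
  then show ?thesis using represents_mult_even_power[OF ab ab, of j] by (simp add: algebra_simps)
qed

text \<open>By \<open>dvd_diff_squares\<close> one of u b - v a and u b + v a is divisible by s c^h.
  If it were nonzero, then D1 D2 times its square would be at least D1 D2 s^2 c^(2 h), while
  multiplicativity of the norm bounds it by s^4 c^(2 h). Since D1 D2 > s^2 it vanishes, and the two
  elements are proportional up to conjugation.\<close>

lemma represents_same_exponent:
  assumes ab: "represents h a b" and uv: "represents h u v" and h: "h \<ge> 1" and prim: "\<not> int c dvd a" "\<not> int c dvd u"
  shows "u\<^sup>2 = a\<^sup>2 \<and> v\<^sup>2 = b\<^sup>2"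
proof -
  have eq: "int D1 * a\<^sup>2 = int s ^ 2 * int c ^ h - int D2 * b\<^sup>2" "int D1 * u\<^sup>2 = int s ^ 2 * int c ^ h - int D2 * v\<^sup>2"
    using ab uv unfolding represents_def by simp_all
  have "int D1 * ((u * b)\<^sup>2 - (v * a)\<^sup>2) = b\<^sup>2 * (int D1 * u\<^sup>2) - v\<^sup>2 * (int D1 * a\<^sup>2)"
    by (simp add: power2_eq_square algebra_simps)
  also have "\<dots> = int s ^ 2 * int c ^ h * (b\<^sup>2 - v\<^sup>2)"
    unfolding eq by (simp add: algebra_simps)
  finally have key: "int D1 * ((u * b)\<^sup>2 - (v * a)\<^sup>2) = int s ^ 2 * int c ^ h * (b\<^sup>2 - v\<^sup>2)" .
  have cop: "coprime (int s ^ 2 * int c ^ h) (int D1)"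
    using s_cases D1(2) by (auto simp: coprime_commute)
  have "int s ^ 2 * int c ^ h dvd (u * b)\<^sup>2 - (v * a)\<^sup>2"
    using cop key by (metis coprime_dvd_mult_right_iff dvd_triv_left)
  moreover have "\<not> int c dvd u * b"
    using prim(2) c_dvd_fst[OF ab h] prim(1) prime_int_c by (meson prime_dvd_mult_iff)
  ultimately have dvd: "int s * int c ^ h dvd u * b - v * a \<or> int s * int c ^ h dvd u * b + v * a"
    by (rule dvd_diff_squares[rotated])
  have small: "w = 0" if w: "int s * int c ^ h dvd w" and id: "int D1 * int D2 * w\<^sup>2 + r\<^sup>2 = int s ^ 2 * (int s ^ 2 * int c ^ h * int c ^ h)" for w r
  proof (rule ccontr)
    assume "w \<noteq> 0"
    then have "int s * int c ^ h \<le> \<bar>w\<bar>" using w by (metis dvd_imp_le_int abs_of_nonneg of_nat_0_le_iff zero_le_mult_iff zero_le_power)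
    then have "(int s * int c ^ h)\<^sup>2 \<le> \<bar>w\<bar>\<^sup>2" by (intro power_mono) auto
    then have w2: "int s ^ 2 * int c ^ h * int c ^ h \<le> w\<^sup>2" by (simp add: power2_eq_square mult.assoc mult.left_commute)
    have "int s ^ 2 < int D1 * int D2"
      using s_cases
    proof
      assume "s = 1 \<and> odd c"
      then show ?thesis using mult_mono[of 2 "int D1" 2 "int D2"] D1 D2 by simp
    next
      assume "s = 2 \<and> c = 2"
      then show ?thesis using mult_mono[of 3 "int D1" 3 "int D2"] D_ge_3 by simp
    qed
    moreover have "int s ^ 2 * int c ^ h * int c ^ h > 0" using s_pos c_ge by simp
    ultimately have "int s ^ 2 * (int s ^ 2 * int c ^ h * int c ^ h) < int D1 * int D2 * (int s ^ 2 * int c ^ h * int c ^ h)"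
      by (rule mult_strict_right_mono)
    also have "\<dots> \<le> int D1 * int D2 * w\<^sup>2" using w2 by (simp add: mult_left_mono)
    finally show False using id zero_le_power2[of r] by linarith
  qed
  have id: "int D1 * int D2 * (u * b - v * a)\<^sup>2 + (int D1 * u * a + int D2 * v * b)\<^sup>2 = int s ^ 2 * (int s ^ 2 * int c ^ h * int c ^ h)"
    "int D1 * int D2 * (u * b + v * a)\<^sup>2 + (int D1 * u * a - int D2 * v * b)\<^sup>2 = int s ^ 2 * (int s ^ 2 * int c ^ h * int c ^ h)"
  proof -
    have e: "(int D1 * u\<^sup>2 + int D2 * v\<^sup>2) * (int D1 * a\<^sup>2 + int D2 * b\<^sup>2) = int s ^ 2 * (int s ^ 2 * int c ^ h * int c ^ h)"
      using ab uv unfolding represents_def by simp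
    show "int D1 * int D2 * (u * b - v * a)\<^sup>2 + (int D1 * u * a + int D2 * v * b)\<^sup>2 = int s ^ 2 * (int s ^ 2 * int c ^ h * int c ^ h)"
      unfolding e[symmetric] by (simp add: power2_eq_square algebra_simps)
    show "int D1 * int D2 * (u * b + v * a)\<^sup>2 + (int D1 * u * a - int D2 * v * b)\<^sup>2 = int s ^ 2 * (int s ^ 2 * int c ^ h * int c ^ h)"
      unfolding e[symmetric] by (simp add: power2_eq_square algebra_simps)
  qed
  have "u * b - v * a = 0 \<or> u * b + v * a = 0"
    using dvd small[OF _ id(1)] small[OF _ id(2)] by blast
  then have "(u * b)\<^sup>2 = (v * a)\<^sup>2" by (auto simp: power2_eq_iff)
  then have "int s ^ 2 * int c ^ h * (b\<^sup>2 - v\<^sup>2) = 0" using key by simp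
  then have "b\<^sup>2 = v\<^sup>2" using s_pos c_ge by simp
  moreover from this have "int D1 * a\<^sup>2 = int D1 * u\<^sup>2" using eq by simp
  then have "a\<^sup>2 = u\<^sup>2" using D1 by simp
  ultimately show ?thesis by simp
qed

text \<open>Multiply \<open>el u v\<close> by (el a b)^2 or its conjugate, whichever makes the
  result divisible by c^m with m = min (2 h) n. Division by c^m leaves norm exponent |n - 2 h|,
  which cannot be 0. For n > 2 h this amounts to exact division by a square; for n < 2 h only the
  existence of an element of that norm matters, to be compared with the minimal one.\<close>

lemma represents_descent:
  assumes ab: "represents h a b" "h \<ge> 1" "\<not> int c dvd a"
    and uv: "represents n u v" "n \<ge> 1" "\<not> int c dvd u"
  obtains (large) x y b' where "n > 2 * h" "represents (n - 2 * h) x y" "\<not> int c dvd x" "b' = b \<or> b' = - b"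
      "el u v = el x y * (el a b')\<^sup>2"
  | (small) x y where "n < 2 * h" "represents (2 * h - n) x y" "\<not> int c dvd x"
proof -
  define m where "m = min (2 * h) n"
  define d where "d = n + 2 * h - 2 * m"
  obtain P Q where PQ: "int s * P = int D1 * a\<^sup>2 - int D2 * b\<^sup>2" "int s * Q = 2 * a * b"
    "P\<^sup>2 + int D1 * int D2 * Q\<^sup>2 = int s ^ 2 * int c ^ (2 * h)" "s = 2 \<Longrightarrow> even P = even Q"
    "\<not> int c dvd P"
    using ex_square_coords[OF ab(1)] ab(2,3) by metis
  have N: "int D1 * u\<^sup>2 + int D2 * v\<^sup>2 = int s ^ 2 * int c ^ n" using uv unfolding represents_def by simp
  have cv: "\<not> int c dvd v" using c_dvd_fst uv by blast
  have "(v * P)\<^sup>2 - (int D1 * u * Q)\<^sup>2 = v\<^sup>2 * (P\<^sup>2 + int D1 * int D2 * Q\<^sup>2) - int D1 * Q\<^sup>2 * (int D1 * u\<^sup>2 + int D2 * v\<^sup>2)"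
    by (simp add: power2_eq_square algebra_simps)
  also have "\<dots> = int s ^ 2 * (v\<^sup>2 * int c ^ (2 * h) - int D1 * Q\<^sup>2 * int c ^ n)"
    unfolding PQ(3) N by (simp add: algebra_simps)
  also have "int s ^ 2 * int c ^ m dvd \<dots>"
    by (intro mult_dvd_mono dvd_diff dvd_mult le_imp_power_dvd) (auto simp: m_def)
  finally have "int s ^ 2 * int c ^ m dvd (v * P)\<^sup>2 - (int D1 * u * Q)\<^sup>2" .
  moreover have "\<not> int c dvd v * P" using cv PQ(5) prime_int_c by (meson prime_dvd_mult_iff)
  ultimately have "int s * int c ^ m dvd v * P - int D1 * u * Q \<or> int s * int c ^ m dvd v * P + int D1 * u * Q"
    by (rule dvd_diff_squares[rotated])
  \<comment> \<open>The sign selects (el a b)^2 or its conjugate, which have the coordinates P, Q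
    and P, -Q.\<close>
  then obtain \<sigma> :: int where \<sigma>: "\<sigma> = 1 \<or> \<sigma> = - 1" "int s * int c ^ m dvd v * P + \<sigma> * (int D1 * u * Q)"
  proof
    assume "int s * int c ^ m dvd v * P - int D1 * u * Q"
    then show ?thesis by (intro that[of "-1"]) auto
  next
    assume "int s * int c ^ m dvd v * P + int D1 * u * Q"
    then show ?thesis by (intro that[of 1]) auto
  qed
  define Q' where "Q' = \<sigma> * Q"
  define w where "w = int s * int c ^ m"
  have w0: "w \<noteq> 0" using s_pos c_ge by (simp add: w_def)
  obtain y where y: "v * P + int D1 * u * Q' = w * y"
    using \<sigma>(2) by (auto simp: w_def Q'_def dvd_def algebra_simps)
  have PQ': "P\<^sup>2 + int D1 * int D2 * Q'\<^sup>2 = int s ^ 2 * int c ^ (2 * h)"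
    using PQ(3) \<sigma>(1) by (auto simp: Q'_def)
  have nrm: "int D1 * (u * P - int D2 * v * Q')\<^sup>2 + int D2 * (v * P + int D1 * u * Q')\<^sup>2 = int s ^ 2 * int c ^ n * (int s ^ 2 * int c ^ (2 * h))"
    unfolding N[symmetric] PQ'[symmetric] by (simp add: power2_eq_square algebra_simps)
  have dm: "n + 2 * h = 2 * m + d" by (auto simp: d_def m_def)
  have "int s ^ 2 * int c ^ n * (int s ^ 2 * int c ^ (2 * h)) = int s ^ 2 * int s ^ 2 * int c ^ (n + 2 * h)"
    by (simp add: power_add)
  also have "\<dots> = w\<^sup>2 * (int s ^ 2 * int c ^ d)"
    unfolding dm by (simp add: power_add w_def power_mult_distrib power_even_eq)
  finally have rhs: "int s ^ 2 * int c ^ n * (int s ^ 2 * int c ^ (2 * h)) = w\<^sup>2 * (int s ^ 2 * int c ^ d)" .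
  \<comment> \<open>As D1 is prime to w, divisibility of the first coordinate follows from that of
    the second through the norm.\<close>
  have "int D1 * (u * P - int D2 * v * Q')\<^sup>2 = w\<^sup>2 * (int s ^ 2 * int c ^ d - int D2 * y\<^sup>2)"
    using nrm unfolding rhs y by (simp add: power_mult_distrib algebra_simps)
  moreover have "coprime (w\<^sup>2) (int D1)"
    using s_cases D1(2) by (auto simp: coprime_commute w_def)
  ultimately have "w\<^sup>2 dvd (u * P - int D2 * v * Q')\<^sup>2"
    by (metis coprime_dvd_mult_right_iff dvd_triv_left)
  then have "w dvd u * P - int D2 * v * Q'" by simp
  then obtain x where x: "u * P - int D2 * v * Q' = w * x" by (auto simp: dvd_def)
  have "w\<^sup>2 * (int D1 * x\<^sup>2 + int D2 * y\<^sup>2) = w\<^sup>2 * (int s ^ 2 * int c ^ d)"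
    using nrm unfolding rhs y x by (simp add: power_mult_distrib algebra_simps)
  then have rep: "represents d x y" unfolding represents_def using w0 by simp
  then have d1: "d \<ge> 1" using not_represents_0 by (cases d) auto
  \<comment> \<open>Multiplying back by the conjugate recovers u, v and P from x and y. So a factor
    c of x would reappear in u or in P, against primitivity.\<close>
  have inv_u: "w * (P * x + int D2 * Q' * y) = u * (int s ^ 2 * int c ^ (2 * h))"
    using arg_cong[OF x, of "\<lambda>z. P * z"] arg_cong[OF y, of "\<lambda>z. int D2 * Q' * z"] unfolding PQ'[symmetric]
    by (simp add: power2_eq_square algebra_simps)
  have inv_v: "w * (P * y - int D1 * Q' * x) = v * (int s ^ 2 * int c ^ (2 * h))"
    using arg_cong[OF y, of "\<lambda>z. P * z"] arg_cong[OF x, of "\<lambda>z. int D1 * Q' * z"] unfolding PQ'[symmetric]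
    by (simp add: power2_eq_square algebra_simps)
  have inv_P: "w * (int D1 * u * x + int D2 * v * y) = P * (int s ^ 2 * int c ^ n)"
    using arg_cong[OF x, of "\<lambda>z. int D1 * u * z"] arg_cong[OF y, of "\<lambda>z. int D2 * v * z"] unfolding N[symmetric]
    by (simp add: power2_eq_square algebra_simps)
  \<comment> \<open>For s = 2 the division by s could absorb the factor c = 2. But x / 2 and y / 2
    have equal parity because d is positive, and so have A and B; the factor 2 survives in
    C.\<close>
  have prim: "int c dvd C"
    if cx: "int c dvd x" and eq: "A * x + B * y = int s * C" and par: "s = 2 \<Longrightarrow> even A = even B" for A B C
  proof -
    have cy: "int c dvd y" using c_dvd_snd[OF rep d1 cx] .
    from s_cases show ?thesis
    proof
      assume "s = 1 \<and> odd c"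
      then have "C = A * x + B * y" using eq by simp
      then show ?thesis using cx cy by simp
    next
      assume s: "s = 2 \<and> c = 2"
      then obtain x' y' where x': "x = 2 * x'" and y': "y = 2 * y'" using cx cy by (auto elim!: dvdE)
      have "4 * (int D1 * x'\<^sup>2 + int D2 * y'\<^sup>2) = 4 * 2 ^ d"
        using rep s unfolding represents_def x' y' by (simp add: power_mult_distrib)
      then have "int D1 * x'\<^sup>2 + int D2 * y'\<^sup>2 = 2 ^ d" by simp
      moreover have "even ((2::int) ^ d)" using d1 by simp
      ultimately have "even (int D1 * x'\<^sup>2 + int D2 * y'\<^sup>2)" by simp
      then have "even x' = even y'" using odd_D s by simp
      moreover have "C = A * x' + B * y'" using eq s unfolding x' y' by simp
      ultimately have "even C" using par s by auto
      then show ?thesis using s by simp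
    qed
  qed
  consider "n > 2 * h" | "n = 2 * h" | "n < 2 * h" by linarith
  then show ?thesis
  proof cases
    case 1
    then have w: "w = int s * int c ^ (2 * h)" and d: "d = n - 2 * h" by (auto simp: w_def d_def m_def)
    have "(int s * int c ^ (2 * h)) * (P * x + int D2 * Q' * y) = (int s * int c ^ (2 * h)) * (int s * u)"
      "(int s * int c ^ (2 * h)) * (P * y - int D1 * Q' * x) = (int s * int c ^ (2 * h)) * (int s * v)"
      using inv_u inv_v unfolding w by (simp_all add: power2_eq_square algebra_simps)
    then have su: "P * x + int D2 * Q' * y = int s * u" and sv: "P * y - int D1 * Q' * x = int s * v"
      using w0 unfolding w mult_cancel_left by auto
    have "\<not> int c dvd x"
    proof
      assume "int c dvd x"
      moreover have "even P = even (int D2 * Q')" if "s = 2"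
        using PQ(4)[OF that] odd_D[OF that] \<sigma>(1) by (auto simp: Q'_def)
      ultimately have "int c dvd u" using prim su by blast
      then show False using uv(3) by blast
    qed
    moreover have "el u v = el x y * (el a (- \<sigma> * b))\<^sup>2"
    proof (rule el_mult_square)
      show "int s * P = int D1 * a\<^sup>2 - int D2 * (- \<sigma> * b)\<^sup>2"
        using PQ(1) \<sigma>(1) by auto
      show "int s * (- Q') = 2 * a * (- \<sigma> * b)" using PQ(2) by (simp add: Q'_def)
      show "int s * u = x * P - int D2 * y * (- Q')" using su by (simp add: algebra_simps)
      show "int s * v = y * P + int D1 * x * (- Q')" using sv by (simp add: algebra_simps)
    qed
    ultimately show ?thesis using large[of x y "- \<sigma> * b"] 1 rep \<sigma>(1) unfolding d by auto
  next
    case 2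
    then show ?thesis using d1 by (simp add: d_def m_def)
  next
    case 3
    then have w: "w = int s * int c ^ n" and d: "d = 2 * h - n" by (auto simp: w_def d_def m_def)
    have "(int s * int c ^ n) * (int D1 * u * x + int D2 * v * y) = (int s * int c ^ n) * (int s * P)"
      using inv_P unfolding w by (simp add: power2_eq_square algebra_simps)
    then have sP: "int D1 * u * x + int D2 * v * y = int s * P"
      using w0 unfolding w mult_cancel_left by auto
    have "\<not> int c dvd x"
    proof
      assume "int c dvd x"
      moreover have "even (int D1 * u) = even (int D2 * v)" if "s = 2"
        using represents_parity[OF uv(1) that] odd_D[OF that] by simp
      ultimately have "int c dvd P" using prim sP by blast
      then show False using PQ(5) by blast
    qed
    then show ?thesis using small 3 rep unfolding d by blast
  qed
qed

text \<open>Serves to refute mixed products: a conjugate pair inside a product yields a rational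
  factor c, and such an element is not primitive.\<close>

lemma c_dvd_of_scaled_even_power:
  assumes uv: "represents n u v" and ab: "represents h a b"
    and eq: "el U V = \<epsilon> * (of_int (int c) * el u v * (el a b) ^ (2 * j))" and \<epsilon>: "\<epsilon> = 1 \<or> \<epsilon> = - 1"
  shows "int c dvd U"
proof -
  obtain x y where "el x y = el u v * (el a b) ^ (2 * j)"
    using represents_mult_even_power[OF uv ab] by blast
  then have "of_int (int c) * el u v * (el a b) ^ (2 * j) = el (int c * x) (int c * y)"
    unfolding el_mult_int[symmetric] by simp
  then have "el U V = \<epsilon> * el (int c * x) (int c * y)" using eq by simp
  then have "el U V = el (int c * x) (int c * y) \<or> el U V = el (- (int c * x)) (- (int c * y))"
    using \<epsilon> by (auto simp: el_uminus)
  then show ?thesis unfolding el_eq_iff by auto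
qed

lemma represents_scale_power:
  assumes "represents n u v"
  shows "represents (n + 2 * k) (int c ^ k * u) (int c ^ k * v)"
proof -
  have "int D1 * (int c ^ k * u)\<^sup>2 + int D2 * (int c ^ k * v)\<^sup>2 = int c ^ k * int c ^ k * (int D1 * u\<^sup>2 + int D2 * v\<^sup>2)"
    by (simp add: power2_eq_square algebra_simps)
  then show ?thesis using assms unfolding represents_def by (simp add: power_add mult_2)
qed

text \<open>Strong induction on the norm. If the square that is split off belongs to the same
  conjugate as the power from the induction hypothesis, the exponents add up; otherwise a conjugate
  pair multiplies to c^h and primitivity is lost. If n < 2 h, minimality gives both 2 h - n and n at
  least h, so n = h and \<open>represents_same_exponent\<close> applies.\<close>

lemma represents_is_power:
  assumes ab: "represents h a b" "h \<ge> 1" "\<not> int c dvd a"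
    and min: "\<And>n u v. n \<ge> 1 \<Longrightarrow> represents n u v \<Longrightarrow> \<not> int c dvd u \<Longrightarrow> h \<le> n"
    and uv: "represents n u v" "n \<ge> 1" "\<not> int c dvd u"
  shows "\<exists>t b' \<epsilon>. odd t \<and> (b' = b \<or> b' = - b) \<and> (\<epsilon> = 1 \<or> \<epsilon> = - 1) \<and> el u v = \<epsilon> * (el a b') ^ t"
  using uv
proof (induction n arbitrary: u v rule: less_induct)
  case (less n)
  note uv = less.prems
  have rep': "represents h a b'" if "b' = b \<or> b' = - b" for b'
    using ab(1) that unfolding represents_def by auto
  show ?case
    using ab uv
  proof (cases rule: represents_descent)
    case (large x y b2)
    have "n - 2 * h \<ge> 1" "n - 2 * h < n" using large(1) ab(2) by auto
    then obtain t b' \<epsilon> where t: "odd t" "b' = b \<or> b' = - b" "\<epsilon> = 1 \<or> \<epsilon> = - 1" "el x y = \<epsilon> * (el a b') ^ t"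
      using less.IH large(2,3) by blast
    show ?thesis
    proof (cases "b2 = b'")
      case True
      then have "el u v = \<epsilon> * (el a b') ^ (t + 2)" using large(5) t(4) True by (simp add: power_add power2_eq_square)
      then show ?thesis using t by (metis even_add even_numeral)
    next
      case False
      then have b2: "b2 = - b'" using t(2) large(4) by auto
      obtain j where j: "t = 2 * j + 1" using t(1) by (metis oddE)
      obtain h' where h': "h = Suc h'" using ab(2) by (cases h) auto
      have "el u v = \<epsilon> * ((el a b' * el a (- b')) * el a (- b') * (el a b') ^ (2 * j))"
        unfolding large(5) t(4) b2 j by (simp add: power2_eq_square algebra_simps)
      also have "el a b' * el a (- b') = of_int (int c ^ h)"
        by (rule el_mult_cnj[OF rep'[OF t(2)]])
      also have "of_int (int c ^ h) * el a (- b') = of_int (int c) * el (int c ^ h' * a) (int c ^ h' * (- b'))"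
        unfolding h' el_mult_int[symmetric] by simp
      finally have "int c dvd u"
        using t(2,3) rep' rep'[of "- b'"]
        by (intro c_dvd_of_scaled_even_power[OF represents_scale_power[of h a "- b'" h']]) auto
      then show ?thesis using uv(3) by blast
    qed
  next
    case (small x y)
    have "h \<le> 2 * h - n" using min[OF _ small(2,3)] small(1) by auto
    moreover have "h \<le> n" using min[OF uv(2,1,3)] .
    ultimately have "n = h" using small(1) by linarith
    then have "u\<^sup>2 = a\<^sup>2 \<and> v\<^sup>2 = b\<^sup>2"
      using represents_same_exponent[OF ab(1) _ ab(2,3) uv(3)] uv(1) by blast
    then have "(u = a \<or> u = - a) \<and> (v = b \<or> v = - b)" by (simp add: power2_eq_iff)
    then obtain b' \<epsilon> where "b' = b \<or> b' = - b" "\<epsilon> = 1 \<or> \<epsilon> = - 1" "el u v = \<epsilon> * el a b'"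
    proof -
      assume *: "(u = a \<or> u = - a) \<and> (v = b \<or> v = - b)"
      then consider "u = a" "v = b \<or> v = - b" | "u = - a" "v = b \<or> v = - b" by blast
      then show thesis
      proof cases
        case 1
        then show thesis by (intro that[of v 1]) auto
      next
        case 2
        then show thesis by (intro that[of "- v" "-1"]) (auto simp: el_uminus)
      qed
    qed
    then show ?thesis by (intro exI[of _ 1] exI[of _ b'] exI[of _ \<epsilon>]) simp
  qed
qed

section \<open>Powers whose coordinates are prime powers\<close>

lemma el_odd_power:
  "of_int (int s ^ (2 * k)) * (el u v) ^ (2 * k + 1)
    = el (u * odd_part k (int D1 * u\<^sup>2) (- (int D2 * v\<^sup>2))) (v * odd_part k (- (int D2 * v\<^sup>2)) (int D1 * u\<^sup>2))"
proof -
  define S where "S = complex_of_nat s"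
  have S: "S \<noteq> 0" using s_pos by (simp add: S_def)
  define x y where "x = complex_of_real (of_int u * sqrt D1 / s)" and "y = \<i> * complex_of_real (of_int v * sqrt D2 / s)"
  define X Y where "X = int D1 * u\<^sup>2" and "Y = - (int D2 * v\<^sup>2)"
  have el: "el u' v' = of_int u' * complex_of_real (sqrt D1 / s) + of_int v' * (\<i> * complex_of_real (sqrt D2 / s))" for u' v'
    by (simp add: el_def complex_eq_iff)
  have xy: "x = of_int u * complex_of_real (sqrt D1 / s)" "y = of_int v * (\<i> * complex_of_real (sqrt D2 / s))"
    by (simp_all add: x_def y_def)
  have "(of_int u * sqrt D1 / s)\<^sup>2 = of_int X / (real s)\<^sup>2" "- (of_int v * sqrt D2 / s)\<^sup>2 = of_int Y / (real s)\<^sup>2"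
    by (simp_all add: X_def Y_def power_mult_distrib power_divide mult.commute)
  moreover have "x\<^sup>2 = complex_of_real ((of_int u * sqrt D1 / s)\<^sup>2)" "y\<^sup>2 = complex_of_real (- (of_int v * sqrt D2 / s)\<^sup>2)"
    unfolding x_def y_def of_real_minus of_real_power power_mult_distrib i_squared by simp_all
  ultimately have "x\<^sup>2 = complex_of_real (of_int X / (real s)\<^sup>2)" "y\<^sup>2 = complex_of_real (of_int Y / (real s)\<^sup>2)"
    by metis+
  then have x2: "x\<^sup>2 = inverse (S\<^sup>2) * of_int X" and y2: "y\<^sup>2 = inverse (S\<^sup>2) * of_int Y"
    by (simp_all add: S_def divide_inverse mult.commute)
  have "(el u v) ^ (2 * k + 1) = (x + y) ^ (2 * k + 1)" by (simp add: el xy)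
  also have "\<dots> = x * odd_part k (x\<^sup>2) (y\<^sup>2) + y * odd_part k (y\<^sup>2) (x\<^sup>2)"
    by (rule odd_power_add)
  also have "\<dots> = inverse (S ^ (2 * k)) * (x * of_int (odd_part k X Y) + y * of_int (odd_part k Y X))"
    unfolding x2 y2 odd_part_scale of_int_odd_part by (simp add: power_inverse algebra_simps flip: power_mult)
  finally have "S ^ (2 * k) * (el u v) ^ (2 * k + 1) = x * of_int (odd_part k X Y) + y * of_int (odd_part k Y X)"
    using S by simp
  also have "\<dots> = el (u * odd_part k X Y) (v * odd_part k Y X)"
    unfolding el xy by (simp add: algebra_simps)
  finally show ?thesis by (simp add: S_def X_def Y_def)
qed

text \<open>Only n = 1 needs an argument: c X = s^2 is impossible for s = 1, and for s = 2 it gives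
  X = 2, whereas nonzero values of the form are at least 3.\<close>

lemma represents_cancel_c:
  assumes "represents n (int c * u) (int c * v)"
  shows "\<exists>m. represents m u v"
proof -
  define X where "X = int D1 * u\<^sup>2 + int D2 * v\<^sup>2"
  have eq: "int c ^ 2 * X = int s ^ 2 * int c ^ n"
    using assms unfolding represents_def X_def by (simp add: power_mult_distrib algebra_simps)
  show ?thesis
  proof (cases "n \<ge> 2")
    case True
    then have "int c ^ n = int c ^ 2 * int c ^ (n - 2)" by (metis le_add_diff_inverse power_add)
    then have "int c ^ 2 * X = int c ^ 2 * (int s ^ 2 * int c ^ (n - 2))" using eq by simp
    then have "X = int s ^ 2 * int c ^ (n - 2)" using c_ge by simp
    then show ?thesis unfolding represents_def X_def by blast
  next
    case False
    moreover have "n \<noteq> 0" using assms not_represents_0 by metis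
    ultimately have "n = 1" by simp
    then have cX: "int c * X = int s ^ 2" using eq c_ge by (simp add: power2_eq_square)
    from s_cases show ?thesis
    proof
      assume "s = 1 \<and> odd c"
      then have "int c dvd 1" using cX by (metis dvd_triv_left of_nat_1 one_power2)
      then show ?thesis using prime_int_c not_prime_unit by blast
    next
      assume s: "s = 2 \<and> c = 2"
      then have "X = 2" using cX by simp
      moreover have "X \<ge> 3" if "u \<noteq> 0 \<or> v \<noteq> 0"
      proof -
        have "int D1 \<ge> 3" "int D2 \<ge> 3" using D_ge_3 s by auto
        moreover have "u\<^sup>2 \<ge> 1 \<or> v\<^sup>2 \<ge> 1" using that by (simp add: int_one_le_iff_zero_less)
        ultimately have "3 \<le> int D1 * u\<^sup>2 \<or> 3 \<le> int D2 * v\<^sup>2"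
          using mult_mono[of 3 "int D1" 1 "u\<^sup>2"] mult_mono[of 3 "int D2" 1 "v\<^sup>2"] by auto
        moreover have "0 \<le> int D1 * u\<^sup>2" "0 \<le> int D2 * v\<^sup>2" by simp_all
        ultimately show ?thesis unfolding X_def by linarith
      qed
      ultimately have "u = 0 \<and> v = 0" by force
      then show ?thesis using \<open>X = 2\<close> by (simp add: X_def)
    qed
  qed
qed

text \<open>For a prime p dividing t, let \<open>el u v\<close> be the power of
  \<open>el a b\<close> with exponent t / p; its p-th power is \<open>el U V\<close> up to sign. The
  expansion gives u F = s^(2 k) U and v G = s^(2 k) V up to sign. Hence u and v are, up to sign,
  powers of A and B, and F and G have exactly the shape excluded by \<open>no_prime_step\<close>,
  with the exponents e + 2 i' and f + 2 j'.\<close>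

lemma exponent_one:
  assumes AB: "prime A" "prime B" "A \<noteq> B" "D1 = A ^ e" "D2 = B ^ f" "e \<ge> 1" "f \<ge> 1"
    and exc: "s = 2 \<Longrightarrow> {A, B} \<noteq> {3, 5} \<and> {A, B} \<noteq> {3, 13}"
    and ab: "represents h a b" "h \<ge> 1"
    and UV: "represents n U V" "\<not> int c dvd U" "\<bar>U\<bar> = int (A ^ i)" "\<bar>V\<bar> = int (B ^ j)"
    and t: "odd t" and \<epsilon>: "\<epsilon> = 1 \<or> \<epsilon> = - 1" and eq: "el U V = \<epsilon> * (el a b) ^ t"
  shows "t = 1"
proof (rule ccontr)
  assume "t \<noteq> 1"
  then obtain p where p: "prime p" "p dvd t" using prime_factor_nat by blast
  then have "odd p" using t by (meson dvd_trans)
  then obtain k where k: "p = 2 * k + 1" by (metis oddE)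
  have k1: "k \<ge> 1" using k p(1) by (cases k) auto
  obtain w where w: "t = p * w" using p(2) by (auto elim!: dvdE)
  then have ow: "odd w" using t by simp
  obtain u v where uv: "represents (h * w) u v" "el u v = (el a b) ^ w"
    using represents_odd_power[OF ab(1) ow] by blast
  have hw: "h * w \<ge> 1" using ab(2) ow by (cases w) auto
  \<comment> \<open>Otherwise c can be taken out of \<open>el u v\<close>, and since t - w is even
    it survives as a factor of U.\<close>
  have cu: "\<not> int c dvd u"
  proof
    assume "int c dvd u"
    moreover from this have "int c dvd v" using c_dvd_snd[OF uv(1) hw] by blast
    ultimately obtain u1 v1 where u1: "u = int c * u1" "v = int c * v1" by (auto elim!: dvdE)
    then obtain m where m: "represents m u1 v1" using uv(1) represents_cancel_c by blast
    have "even (t - w)" using t ow by simp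
    then obtain l where l: "t - w = 2 * l" by (rule evenE)
    have "w \<le> t" using w k by simp
    then have "t = w + 2 * l" using l by linarith
    then have "el U V = \<epsilon> * (of_int (int c) * el u1 v1 * (el a b) ^ (2 * l))"
      using eq uv(2) unfolding u1 el_mult_int[symmetric] by (simp add: power_add)
    then have "int c dvd U" by (rule c_dvd_of_scaled_even_power[OF m ab(1) _ \<epsilon>])
    then show False using UV(2) by blast
  qed
  then have cv: "\<not> int c dvd v" using c_dvd_fst[OF uv(1) hw] by blast
  define F G where "F = odd_part k (int D1 * u\<^sup>2) (- (int D2 * v\<^sup>2))" and "G = odd_part k (- (int D2 * v\<^sup>2)) (int D1 * u\<^sup>2)"
  have pw: "(el u v) ^ (2 * k + 1) = \<epsilon> * el U V"
    unfolding uv(2) eq using \<epsilon> w k by (auto simp flip: power_mult simp: mult.commute power_add)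
  have "el (u * F) (v * G) = \<epsilon> * el (int s ^ (2 * k) * U) (int s ^ (2 * k) * V)"
    using el_odd_power[of k u v] unfolding pw F_def G_def by (simp add: mult.left_commute flip: el_mult_int)
  then have "u * F = int s ^ (2 * k) * U \<and> v * G = int s ^ (2 * k) * V \<or> u * F = - (int s ^ (2 * k) * U) \<and> v * G = - (int s ^ (2 * k) * V)"
    using \<epsilon> by (auto simp: el_uminus el_eq_iff)
  then have "\<bar>u * F\<bar> = \<bar>int s ^ (2 * k) * U\<bar> \<and> \<bar>v * G\<bar> = \<bar>int s ^ (2 * k) * V\<bar>" by auto
  then have uF: "\<bar>u\<bar> * \<bar>F\<bar> = int (s ^ (2 * k) * A ^ i)" and vG: "\<bar>v\<bar> * \<bar>G\<bar> = int (s ^ (2 * k) * B ^ j)"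
    unfolding abs_mult UV(3,4) by simp_all
  have pp: "\<exists>r i'. \<bar>w\<bar> = int (q ^ i') \<and> \<bar>H\<bar> = int (s ^ (2 * k) * q ^ r)"
    if pq: "prime q" "\<not> int c dvd w" "\<bar>w\<bar> * \<bar>H\<bar> = int (s ^ (2 * k) * q ^ i)" for w H i and q :: nat
  proof -
    have nat_eq: "nat \<bar>w\<bar> * nat \<bar>H\<bar> = s ^ (2 * k) * q ^ i"
      using pq(3) by (metis nat_int nat_mult_distrib abs_ge_zero)
    \<comment> \<open>For s = 2 the number w is odd because c = 2 does not divide it, so all factors
      s go into H.\<close>
    have "coprime (nat \<bar>w\<bar>) (s ^ (2 * k))"
      using s_cases
    proof
      assume "s = 2 \<and> c = 2"
      then show ?thesis using pq(2) by (simp add: even_nat_iff)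
    qed simp
    then have "nat \<bar>w\<bar> dvd q ^ i"
      using nat_eq by (metis coprime_dvd_mult_right_iff dvd_triv_left)
    then obtain i' where i': "i' \<le> i" "nat \<bar>w\<bar> = q ^ i'" using divides_primepow_nat[OF pq(1)] by blast
    have "q ^ i' * nat \<bar>H\<bar> = q ^ i' * (s ^ (2 * k) * q ^ (i - i'))"
      using nat_eq i' by (simp add: power_add[symmetric] mult.left_commute)
    then have "nat \<bar>H\<bar> = s ^ (2 * k) * q ^ (i - i')" using pq(1) prime_gt_0_nat by simp
    then show ?thesis using i' by (metis nat_0_le abs_ge_zero)
  qed
  obtain r i' where r: "\<bar>u\<bar> = int (A ^ i')" "\<bar>F\<bar> = int (s ^ (2 * k) * A ^ r)" using pp[OF AB(1) cu uF] by blast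
  obtain q j' where q: "\<bar>v\<bar> = int (B ^ j')" "\<bar>G\<bar> = int (s ^ (2 * k) * B ^ q)" using pp[OF AB(2) cv vG] by blast
  have X: "int D1 * u\<^sup>2 = int (A ^ (e + 2 * i'))" and Y: "int D2 * v\<^sup>2 = int (B ^ (f + 2 * j'))"
    using arg_cong[OF r(1), of "\<lambda>x. x\<^sup>2"] arg_cong[OF q(1), of "\<lambda>x. x\<^sup>2"] AB(4,5)
    by (simp_all add: power_add power_mult mult.commute[of 2] del: abs_eq_iff)
  have XU: "int D1 * U\<^sup>2 = int (A ^ (e + 2 * i))" and YV: "int D2 * V\<^sup>2 = int (B ^ (f + 2 * j))"
    using arg_cong[OF UV(3), of "\<lambda>x. x\<^sup>2"] arg_cong[OF UV(4), of "\<lambda>x. x\<^sup>2"] AB(4,5)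
    by (simp_all add: power_add power_mult mult.commute[of 2] del: abs_eq_iff)
  have "A ^ i' * A ^ r = A ^ i" "B ^ j' * B ^ q = B ^ j"
  proof -
    have "int (A ^ i' * (s ^ (2 * k) * A ^ r)) = int (s ^ (2 * k) * A ^ i)" "int (B ^ j' * (s ^ (2 * k) * B ^ q)) = int (s ^ (2 * k) * B ^ j)"
      using uF vG unfolding r q by (simp_all only: of_nat_mult)
    then show "A ^ i' * A ^ r = A ^ i" "B ^ j' * B ^ q = B ^ j"
      unfolding of_nat_eq_iff using s_pos by (simp_all add: mult.left_commute)
  qed
  then have ir: "A ^ (2 * i) = A ^ (2 * i') * A ^ (2 * r)" "B ^ (2 * j) = B ^ (2 * j') * B ^ (2 * q)"
    by (metis power_mult_distrib power_even_eq)+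
  have N1: "A ^ (e + 2 * i') + B ^ (f + 2 * j') = s\<^sup>2 * c ^ (h * w)"
  proof -
    have "int (A ^ (e + 2 * i') + B ^ (f + 2 * j')) = int (s\<^sup>2 * c ^ (h * w))"
      using uv(1) unfolding represents_def X Y by simp
    then show ?thesis unfolding of_nat_eq_iff .
  qed
  have "real c ^ n = (cmod (el U V))\<^sup>2" using norm_el[OF UV(1)] by simp
  also have "\<dots> = (cmod (\<epsilon> * el U V))\<^sup>2" using \<epsilon> by (auto simp: norm_mult)
  also have "\<dots> = ((cmod (el u v))\<^sup>2) ^ (2 * k + 1)" unfolding pw[symmetric] by (simp add: norm_power norm_mult power_mult_distrib flip: power_mult)
  also have "\<dots> = (real c ^ (h * w)) ^ (2 * k + 1)" using norm_el[OF uv(1)] by simp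
  finally have "real (c ^ n) = real ((c ^ (h * w)) ^ (2 * k + 1))" by simp
  then have cn: "c ^ n = (c ^ (h * w)) ^ (2 * k + 1)" unfolding of_nat_eq_iff .
  have "int (A ^ (e + 2 * i) + B ^ (f + 2 * j)) = int (s\<^sup>2 * c ^ n)"
    using UV(1) unfolding represents_def XU YV by simp
  then have "A ^ (e + 2 * i) + B ^ (f + 2 * j) = s\<^sup>2 * c ^ n" unfolding of_nat_eq_iff .
  then have N2: "A ^ (e + 2 * i') * A ^ (2 * r) + B ^ (f + 2 * j') * B ^ (2 * q) = s\<^sup>2 * (c ^ (h * w)) ^ (2 * k + 1)"
    unfolding cn power_add ir by (simp add: mult.assoc)
  have "odd A" "odd B" if "s = 2"
    using odd_D[OF that] AB by auto
  then have sc: "s = 1 \<or> s = 2 \<and> odd A \<and> odd B \<and> {A, B} \<noteq> {3, 5} \<and> {A, B} \<noteq> {3, 13}"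
    using s_cases exc by blast
  have "\<bar>odd_part k Y' (- X')\<bar> = \<bar>odd_part k (- Y') X'\<bar>" for X' Y' :: int
    using odd_part_scale[of k "-1" "- Y'" X'] by (simp add: abs_mult power_abs)
  then have G: "\<bar>odd_part k (int (B ^ (f + 2 * j'))) (- int (A ^ (e + 2 * i')))\<bar> = int (s ^ (2 * k) * B ^ q)"
    using q(2) unfolding G_def X Y by simp
  have F: "\<bar>odd_part k (int (A ^ (e + 2 * i'))) (- int (B ^ (f + 2 * j')))\<bar> = int (s ^ (2 * k) * A ^ r)"
    using r(2) unfolding F_def X Y by simp
  show False
    using no_prime_step[OF AB(1-3) _ _ k1 _ sc F G N1 N2] AB(6,7) p(1) k by simp
qed

text \<open>Both elements are, up to sign and conjugation, powers of one element of minimal norm,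
  and \<open>exponent_one\<close> makes both exponents 1.\<close>

lemma represents_unique:
  assumes AB: "prime A" "prime B" "A \<noteq> B" "D1 = A ^ e" "D2 = B ^ f" "e \<ge> 1" "f \<ge> 1"
    and exc: "s = 2 \<Longrightarrow> {A, B} \<noteq> {3, 5} \<and> {A, B} \<noteq> {3, 13}"
    and UV1: "represents n1 (int (A ^ i1)) (int (B ^ j1))" "n1 \<ge> 1"
    and UV2: "represents n2 (int (A ^ i2)) (int (B ^ j2))" "n2 \<ge> 1"
  shows "A ^ i1 = A ^ i2 \<and> B ^ j1 = B ^ j2"
proof -
  have "\<not> c dvd A"
    using D1(2) AB(4,6) prime_c by (metis coprime_absorb_right coprime_power_left_iff not_prime_unit not_one_le_zero gr0I)
  then have cA: "\<not> int c dvd int (A ^ i)" for i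
    using prime_c by (metis int_dvd_int_iff prime_dvd_power)
  define Q where "Q n \<longleftrightarrow> n \<ge> 1 \<and> (\<exists>u v. represents n u v \<and> \<not> int c dvd u)" for n
  have "Q n1" using UV1 cA unfolding Q_def by blast
  define h where "h = (LEAST n. Q n)"
  have "Q h" unfolding h_def using \<open>Q n1\<close> by (rule LeastI)
  then obtain a b where ab: "represents h a b" "h \<ge> 1" "\<not> int c dvd a" unfolding Q_def by blast
  have min: "h \<le> n" if "n \<ge> 1" "represents n u v" "\<not> int c dvd u" for n u v
    unfolding h_def using that by (intro Least_le) (auto simp: Q_def)
  have *: "(int (A ^ i))\<^sup>2 = a\<^sup>2 \<and> (int (B ^ j))\<^sup>2 = b\<^sup>2"
    if UV: "represents n (int (A ^ i)) (int (B ^ j))" "n \<ge> 1" for n i j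
  proof -
    obtain t b' \<epsilon> where t: "odd t" "b' = b \<or> b' = - b" "\<epsilon> = 1 \<or> \<epsilon> = - 1"
      "el (int (A ^ i)) (int (B ^ j)) = \<epsilon> * (el a b') ^ t"
      using represents_is_power[OF ab _ UV cA] min by blast
    have "represents h a b'" using ab(1) t(2) unfolding represents_def by auto
    then have "t = 1"
      using exponent_one[OF AB exc _ ab(2) UV(1) cA _ _ t(1,3,4), of i j] by simp
    then have "el (int (A ^ i)) (int (B ^ j)) = el a b' \<or> el (int (A ^ i)) (int (B ^ j)) = el (- a) (- b')"
      using t(3,4) by (auto simp: el_uminus)
    then have "(int (A ^ i) = a \<and> int (B ^ j) = b') \<or> (int (A ^ i) = - a \<and> int (B ^ j) = - b')"
      unfolding el_eq_iff .
    then show ?thesis using t(2) by (elim disjE conjE) (simp_all del: of_nat_power)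
  qed
  have "(int (A ^ i1))\<^sup>2 = (int (A ^ i2))\<^sup>2" "(int (B ^ j1))\<^sup>2 = (int (B ^ j2))\<^sup>2"
    using *[OF UV1] *[OF UV2] by metis+
  then show ?thesis by (simp_all only: power2_eq_iff_nonneg of_nat_0_le_iff of_nat_eq_iff)
qed

end

section \<open>At most one solution for each pair of parities\<close>

lemma parity_class_unique:
  fixes a b c :: nat
  assumes pr: "prime a" "prime b" "prime c" "a \<noteq> b" "a \<noteq> c" "b \<noteq> c"
    and exc: "c = 2 \<Longrightarrow> {a, b} \<noteq> {3, 5} \<and> {a, b} \<noteq> {3, 13}"
    and sol1: "x1 > 0" "y1 > 0" "a ^ x1 + b ^ y1 = c ^ z1"
    and sol2: "x2 > 0" "y2 > 0" "a ^ x2 + b ^ y2 = c ^ z2"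
    and par: "even x1 = even x2" "even y1 = even y2"
  shows "x1 = x2 \<and> y1 = y2 \<and> z1 = z2"
proof -
  \<comment> \<open>An even exponent leaves 2 and not 0, so that D1 and D2 are at least 2.\<close>
  define e f s where "e = (if even x1 then 2 else 1 :: nat)" and "f = (if even y1 then 2 else 1 :: nat)"
    and "s = (if c = 2 then 2 else 1 :: nat)"
  have ef: "e \<ge> 1" "f \<ge> 1" by (auto simp: e_def f_def)
  have split: "\<exists>i. x = e' + 2 * i" if "x > 0" "e' = (if even x then 2 else 1)" for x e' :: nat
    using that by (intro exI[of _ "(x - e') div 2"]) (auto elim!: evenE oddE)
  obtain i1 where i1: "x1 = e + 2 * i1" using split[of x1 e] sol1 by (auto simp: e_def)
  obtain i2 where i2: "x2 = e + 2 * i2" using split[of x2 e] sol2 par by (auto simp: e_def)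
  obtain j1 where j1: "y1 = f + 2 * j1" using split[of y1 f] sol1 by (auto simp: f_def)
  obtain j2 where j2: "y2 = f + 2 * j2" using split[of y2 f] sol2 par by (auto simp: f_def)
  have ge: "m ^ n \<ge> m" if "prime m" "n \<ge> 1" for m n :: nat
    using that prime_ge_1_nat by (metis power_increasing power_one_right)
  interpret norm_form "a ^ e" "b ^ f" c s
  proof
    show "a ^ e \<ge> 2" "b ^ f \<ge> 2"
      using ge[OF pr(1) ef(1)] ge[OF pr(2) ef(2)] prime_ge_2_nat pr(1,2) by (meson le_trans)+
    show "coprime (a ^ e) c" "coprime (b ^ f) c"
      using pr by (simp_all add: primes_coprime)
    show "s = 1 \<and> odd c \<or> s = 2 \<and> c = 2"
      using pr(3) primes_dvd_imp_eq[of 2 c] by (auto simp: s_def)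
  qed (rule pr(3))
  have rep: "\<exists>n\<ge>1. represents n (int (a ^ i)) (int (b ^ j))"
    if eq: "a ^ (e + 2 * i) + b ^ (f + 2 * j) = c ^ z" for i j z
  proof -
    have lhs: "int (a ^ e) * (int (a ^ i))\<^sup>2 + int (b ^ f) * (int (b ^ j))\<^sup>2 = int (c ^ z)"
      unfolding eq[symmetric] by (simp add: power_add power_even_eq)
    show ?thesis
    proof (cases "c = 2")
      case False
      have "z \<noteq> 0"
      proof
        assume "z = 0"
        then have "a ^ (e + 2 * i) + b ^ (f + 2 * j) = 1" using eq by simp
        moreover have "a ^ (e + 2 * i) > 0" "b ^ (f + 2 * j) > 0" using prime_gt_0_nat pr(1,2) by simp_all
        ultimately show False by linarith
      qed
      have s1: "s = 1" using False by (simp add: s_def)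
      have "represents z (int (a ^ i)) (int (b ^ j))"
        unfolding represents_def using lhs s1 by simp
      then show ?thesis using \<open>z \<noteq> 0\<close> by (intro exI[of _ z]) (simp del: of_nat_power)
    next
      case True
      have "a \<ge> 3" "b \<ge> 3" using prime_ge_2_nat[OF pr(1)] prime_ge_2_nat[OF pr(2)] pr(5,6) True by auto
      moreover have "a ^ (e + 2 * i) \<ge> a" "b ^ (f + 2 * j) \<ge> b"
        using ge[OF pr(1), of "e + 2 * i"] ge[OF pr(2), of "f + 2 * j"] ef by auto
      ultimately have "(2::nat) ^ z > 2 ^ 2" using eq True by simp
      \<comment> \<open>For c = 2 the factor s^2 = 4 takes 2 from the exponent, and what remains has
        to be positive.\<close>
      then have "z > 2" by (rule power_less_imp_less_exp[rotated]) simp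
      moreover from this have "(2::nat) ^ z = 2\<^sup>2 * 2 ^ (z - 2)" by (metis le_add_diff_inverse less_imp_le power_add)
      moreover have s2: "s = 2" using True by (simp add: s_def)
      ultimately have "represents (z - 2) (int (a ^ i)) (int (b ^ j))"
        unfolding represents_def using lhs True by simp
      then show ?thesis using \<open>z > 2\<close> by (intro exI[of _ "z - 2"]) simp
    qed
  qed
  obtain n1 n2 where n: "n1 \<ge> 1" "represents n1 (int (a ^ i1)) (int (b ^ j1))"
    "n2 \<ge> 1" "represents n2 (int (a ^ i2)) (int (b ^ j2))"
    using rep sol1(3) sol2(3) unfolding i1 i2 j1 j2 by blast
  have "s = 2 \<Longrightarrow> {a, b} \<noteq> {3, 5} \<and> {a, b} \<noteq> {3, 13}" using exc by (auto simp: s_def split: if_splits)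
  then have "a ^ i1 = a ^ i2 \<and> b ^ j1 = b ^ j2"
    using represents_unique[OF pr(1,2,4) refl refl ef _ n(2,1,4,3)] by blast
  then have "i1 = i2" "j1 = j2" using prime_gt_1_nat[OF pr(1)] prime_gt_1_nat[OF pr(2)] by simp_all
  then have "x1 = x2" "y1 = y2" using i1 i2 j1 j2 by simp_all
  moreover from this have "c ^ z1 = c ^ z2" using sol1(3) sol2(3) by metis
  then have "z1 = z2" using prime_gt_1_nat[OF pr(3)] by simp
  ultimately show ?thesis by simp
qed

subsection \<open>Sums equal to a power of two\<close>

lemma sum_power_odd:
  fixes g :: int
  assumes "odd g"
  shows "odd (\<Sum>i<n. g ^ i) = odd n"
  using assms by (induction n) auto

text \<open>Modulo the smaller power M of 2 one can eliminate b: raising a^x1 = -b^y1 to the power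
  y2 and a^x2 = -b^y2 to the power y1 gives a^(x1 y2) = +-a^(x2 y1). These exponents differ by an
  odd d, so g^d = 1 with g = a or g = -a. The cofactor of g - 1 in g^d - 1 is a sum of d odd terms,
  hence odd, and M divides g - 1.\<close>

lemma mixed_parity_base_2:
  fixes a b :: nat
  assumes ab: "odd a" "odd b" "b > 1"
    and sol1: "x1 > 0" "y1 > 0" "a ^ x1 + b ^ y1 = 2 ^ z1"
    and sol2: "x2 > 0" "y2 > 0" "a ^ x2 + b ^ y2 = 2 ^ z2"
    and par: "odd (x1 * y2 + x2 * y1)"
    and a: "a > 1"
  shows False
proof -
  define M :: int where "M = 2 ^ min z1 z2"
  have M_dvd: "M dvd 2 ^ z1" "M dvd 2 ^ z2" unfolding M_def by (simp_all add: le_imp_power_dvd)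
  have big: "int a + 1 < 2 ^ z" if "x > 0" "y > 0" "a ^ x + b ^ y = 2 ^ z" for x y z
  proof -
    have "a ^ x \<ge> a" "b ^ y \<ge> b" using that ab a by (simp_all add: self_le_power)
    then have "a + 1 < 2 ^ z" using that(3) ab(3) by linarith
    then have "int (a + 1) < int (2 ^ z)" by (simp only: of_nat_less_iff)
    then show ?thesis by simp
  qed
  have M: "int a + 1 < M" using big[OF sol1] big[OF sol2] unfolding M_def by (simp add: min_def)
  have copM: "coprime M (int a ^ e)" for e unfolding M_def using ab(1) by simp
  have c: "[int a ^ (x * y') = (- 1) ^ y' * int b ^ (y * y')] (mod M)"
    if "a ^ x + b ^ y = 2 ^ z" "M dvd 2 ^ z" for x y z y'
  proof -
    have "int a ^ x + int b ^ y = 2 ^ z" using arg_cong[OF that(1), of int] by simp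
    then have "[int a ^ x = - (int b ^ y)] (mod M)" using that(2) by (simp add: cong_iff_dvd_diff)
    then have "[(int a ^ x) ^ y' = (- (int b ^ y)) ^ y'] (mod M)" by (rule cong_pow)
    then show ?thesis by (simp add: power_mult power_minus[of "int b ^ y"])
  qed
  define e1 e2 where "e1 = x1 * y2" and "e2 = x2 * y1"
  define \<sigma> :: int where "\<sigma> = (- 1) ^ (y1 + y2)"
  have \<sigma>: "\<sigma> = 1 \<or> \<sigma> = - 1" unfolding \<sigma>_def by (cases "even (y1 + y2)") auto
  have c1: "[int a ^ e1 = (- 1) ^ y2 * int b ^ (y1 * y2)] (mod M)" using c[OF sol1(3) M_dvd(1), of y2] by (simp add: e1_def)
  have c2: "[int a ^ e2 = (- 1) ^ y1 * int b ^ (y1 * y2)] (mod M)" using c[OF sol2(3) M_dvd(2), of y1] by (simp add: e2_def mult.commute)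
  have "[\<sigma> * int a ^ e2 = \<sigma> * ((- 1) ^ y1 * int b ^ (y1 * y2))] (mod M)" using c2 by (rule cong_scalar_left)
  moreover have "\<sigma> * ((- 1) ^ y1 * int b ^ (y1 * y2)) = (- 1) ^ y2 * int b ^ (y1 * y2)"
    unfolding \<sigma>_def power_add by simp
  ultimately have 12: "[int a ^ e1 = \<sigma> * int a ^ e2] (mod M)" using c1 by (metis cong_sym cong_trans)
  then have "[\<sigma> * int a ^ e1 = \<sigma> * (\<sigma> * int a ^ e2)] (mod M)" by (rule cong_scalar_left)
  then have 21: "[int a ^ e2 = \<sigma> * int a ^ e1] (mod M)" using \<sigma> by (auto simp: cong_sym)
  have key: False if c: "[int a ^ f1 = \<sigma> * int a ^ f2] (mod M)" and le: "f2 \<le> f1" and odd: "odd (f1 + f2)" for f1 f2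
  proof -
    define d where "d = f1 - f2"
    have d: "f1 = f2 + d" "odd d" using le odd by (auto simp: d_def)
    have "M dvd int a ^ f2 * (int a ^ d - \<sigma>)"
      using c unfolding d(1) by (simp add: cong_iff_dvd_diff power_add algebra_simps)
    then have "M dvd int a ^ d - \<sigma>" using copM by (simp add: coprime_dvd_mult_right_iff)
    define g where "g = \<sigma> * int a"
    have "g ^ d - 1 = \<sigma> * (int a ^ d - \<sigma>)" using \<sigma> d(2) unfolding g_def by auto
    then have "M dvd g ^ d - 1" using \<open>M dvd int a ^ d - \<sigma>\<close> by simp
    then have "M dvd (g - 1) * (\<Sum>i<d. g ^ i)" by (simp add: power_diff_1_eq)
    moreover have "odd g" using ab(1) \<sigma> by (auto simp: g_def)
    then have "odd (\<Sum>i<d. g ^ i)" using sum_power_odd d(2) by blast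
    then have "coprime M (\<Sum>i<d. g ^ i)" unfolding M_def by simp
    ultimately have "M dvd g - 1" by (simp add: coprime_dvd_mult_left_iff)
    moreover have "g - 1 \<noteq> 0" using \<sigma> a by (auto simp: g_def)
    ultimately have "\<bar>M\<bar> \<le> \<bar>g - 1\<bar>" by (simp add: dvd_imp_le_int)
    moreover have "\<bar>g - 1\<bar> \<le> int a + 1" using \<sigma> a by (auto simp: g_def)
    ultimately show False using M by linarith
  qed
  show False
    using key[OF 12] key[OF 21] par unfolding e1_def e2_def by (metis add.commute nat_le_linear)
qed

lemma odd_power_even_mod_8:
  fixes m :: nat
  assumes "odd m"
  shows "m ^ (2 * i) mod 8 = 1"
proof -
  have "[m\<^sup>2 = 1] (mod 8)" using assms by (subst square_mod_8_eq_1_iff)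
  then have "[(m\<^sup>2) ^ i = 1 ^ i] (mod 8)" by (rule cong_pow)
  then show ?thesis by (simp add: cong_def power_mult)
qed

lemma prime_sum_power_of_two:
  fixes a b :: nat
  assumes ab: "prime a" "prime b" "a < b" "a \<noteq> 2" "b \<noteq> 2"
    and sol1: "x1 > 0" "y1 > 0" "a ^ x1 + b ^ y1 = 2 ^ z1"
    and sol2: "x2 > 0" "y2 > 0" "a ^ x2 + b ^ y2 = 2 ^ z2"
    and ne: "(x1, y1, z1) \<noteq> (x2, y2, z2)"
  shows "(a, b) = (3, 5) \<or> (a, b) = (3, 13)"
proof (rule ccontr)
  assume exc: "\<not> ((a, b) = (3, 5) \<or> (a, b) = (3, 13))"
  have od: "odd a" "odd b" using ab primes_dvd_imp_eq[of 2 a] primes_dvd_imp_eq[of 2 b] by auto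
  have gt: "a > 1" "b > 1" using ab prime_gt_1_nat by auto
  have not_ee: "\<not> (even x \<and> even y)" if "x > 0" "y > 0" "a ^ x + b ^ y = 2 ^ z" for x y z
  proof
    assume "even x \<and> even y"
    then obtain i j where ij: "x = 2 * i" "y = 2 * j" by (auto elim!: evenE)
    have "(a ^ x + b ^ y) mod 4 = 2" using odd_power_even_mod_8[OF od(1), of i] odd_power_even_mod_8[OF od(2), of j] unfolding ij by presburger
    then have m: "(2::nat) ^ z mod 4 = 2" using that(3) by simp
    have "z \<noteq> 0" using m by (cases z) auto
    moreover have "\<not> z \<ge> 2"
    proof
      assume "z \<ge> 2"
      then have "(2::nat)\<^sup>2 dvd 2 ^ z" by (rule le_imp_power_dvd)
      then show False using m by (simp add: dvd_eq_mod_eq_0)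
    qed
    ultimately have "z = 1" by simp
    then have "a ^ x + b ^ y = 2" using that(3) by simp
    moreover have "a ^ x \<ge> a" "b ^ y \<ge> b" using that gt by (simp_all add: self_le_power)
    ultimately show False using gt by linarith
  qed
  show False
  proof (cases "even x1 = even x2 \<and> even y1 = even y2")
    case True
    have "{a, b} \<noteq> {3, 5} \<and> {a, b} \<noteq> {3, 13}" using exc ab(3) by (auto simp: doubleton_eq_iff)
    then show False
      using parity_class_unique[of a b 2, OF ab(1,2) two_is_prime_nat _ ab(4,5) _ sol1 sol2] True ab(3) ne by auto
  next
    case False
    \<comment> \<open>Modulo 2 the vectors (x1, y1) and (x2, y2) are distinct and nonzero, hence
      independent over the field with two elements; the expression is their determinant.\<close>
    then have "odd (x1 * y2 + x2 * y1)" using not_ee[OF sol1] not_ee[OF sol2] by auto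
    then show False using mixed_parity_base_2[OF od gt(2) sol1 sol2 _ gt(1)] by blast
  qed
qed

subsection \<open>Coordinates of powers\<close>

text \<open>The coordinates of \<open>(1 + \<surd>-d)\<^sup>n\<close> with respect to \<open>1\<close> and \<open>\<surd>-d\<close>.\<close>

primrec coords :: "int \<Rightarrow> nat \<Rightarrow> int \<times> int" where
  "coords d 0 = (1, 0)"
| "coords d (Suc n) = (fst (coords d n) - d * snd (coords d n), fst (coords d n) + snd (coords d n))"

lemma coords_add:
  "fst (coords d (m + n)) = fst (coords d m) * fst (coords d n) - d * snd (coords d m) * snd (coords d n)"
  "snd (coords d (m + n)) = fst (coords d m) * snd (coords d n) + snd (coords d m) * fst (coords d n)"
  by (induction m) (simp_all add: algebra_simps)

text \<open>Squaring A + B sqrt(-d) gives the coordinates A^2 - d B^2 and 2 A B. As B has 2-adic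
  valuation s, the condition on d makes d B^2 vanish modulo 2^(s + 2).\<close>

lemma coords_double:
  assumes "d = 2 \<and> s \<ge> 1 \<or> 4 dvd d"
    and "[fst (coords d n) = 1] (mod 2 ^ (s + 1))" "[snd (coords d n) = 2 ^ s] (mod 2 ^ (s + 1))"
  shows "[fst (coords d (2 * n)) = 1] (mod 2 ^ (s + 2))" "[snd (coords d (2 * n)) = 2 ^ (s + 1)] (mod 2 ^ (s + 2))"
proof -
  obtain \<alpha> where "fst (coords d n) - 1 = 2 ^ (s + 1) * \<alpha>"
    using assms(2) unfolding cong_iff_dvd_diff by (rule dvdE)
  then have \<alpha>: "fst (coords d n) = 1 + 2 ^ (s + 1) * \<alpha>" by linarith
  obtain \<beta> where "snd (coords d n) - 2 ^ s = 2 ^ (s + 1) * \<beta>"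
    using assms(3) unfolding cong_iff_dvd_diff by (rule dvdE)
  then have \<beta>: "snd (coords d n) = 2 ^ s + 2 ^ (s + 1) * \<beta>" by linarith
  have A: "fst (coords d (2 * n)) = (fst (coords d n))\<^sup>2 - d * (snd (coords d n))\<^sup>2"
    and B: "snd (coords d (2 * n)) = 2 * fst (coords d n) * snd (coords d n)"
    unfolding mult_2[of n] coords_add by (simp_all add: power2_eq_square)
  have "(2::int) ^ (s + 2) dvd d * 2 ^ (2 * s)"
    using assms(1)
  proof
    assume "d = 2 \<and> s \<ge> 1"
    then have "(2::int) ^ (s + 2) dvd 2 ^ (2 * s + 1)" by (intro le_imp_power_dvd) auto
    then show ?thesis using \<open>d = 2 \<and> s \<ge> 1\<close> by (simp add: mult.commute)
  next
    assume "4 dvd d"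
    then have "2 ^ 2 * 2 ^ s dvd d * (2::int) ^ (2 * s)" by (intro mult_dvd_mono le_imp_power_dvd) auto
    then show ?thesis by (simp add: power_add mult.commute)
  qed
  then have "2 ^ (s + 2) dvd d * 2 ^ (2 * s) * (1 + 2 * \<beta>)\<^sup>2" by (rule dvd_mult2)
  moreover have "d * (snd (coords d n))\<^sup>2 = d * 2 ^ (2 * s) * (1 + 2 * \<beta>)\<^sup>2"
    unfolding \<beta> power_even_eq by (simp add: power2_eq_square algebra_simps)
  moreover have "(fst (coords d n))\<^sup>2 - 1 = 2 ^ (s + 2) * (\<alpha> + 2 ^ s * \<alpha>\<^sup>2)"
    unfolding \<alpha> by (simp add: power2_eq_square algebra_simps)
  then have "2 ^ (s + 2) dvd (fst (coords d n))\<^sup>2 - 1" by simp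
  ultimately have "2 ^ (s + 2) dvd ((fst (coords d n))\<^sup>2 - 1) - d * (snd (coords d n))\<^sup>2" by (metis dvd_diff)
  then show "[fst (coords d (2 * n)) = 1] (mod 2 ^ (s + 2))"
    unfolding A cong_iff_dvd_diff by (simp add: algebra_simps)
  have "snd (coords d (2 * n)) - 2 ^ (s + 1) = 2 ^ (s + 2) * (\<beta> + 2 ^ s * \<alpha> + 2 ^ (s + 1) * \<alpha> * \<beta>)"
    unfolding B \<alpha> \<beta> by (simp add: algebra_simps)
  then show "[snd (coords d (2 * n)) = 2 ^ (s + 1)] (mod 2 ^ (s + 2))"
    unfolding cong_iff_dvd_diff by simp
qed

text \<open>Induction by squaring. If 4 divides d, it starts at the square 1 - d + 2 sqrt(-d). For d
  = 2 the square is -1 + 2 sqrt(-2), whose first coordinate is not 1 modulo 4, so the start is the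
  fourth power -7 - 4 sqrt(-2).\<close>

lemma coords_pow2:
  assumes "d = 2 \<and> s \<ge> 2 \<or> 4 dvd d \<and> s \<ge> 1"
  shows "[fst (coords d (2 ^ s)) = 1] (mod 2 ^ (s + 1)) \<and> [snd (coords d (2 ^ s)) = 2 ^ s] (mod 2 ^ (s + 1))"
  using assms
proof (induction s)
  case (Suc s)
  show ?case
  proof (cases "d = 2 \<and> s \<ge> 2 \<or> 4 dvd d \<and> s \<ge> 1")
    case True
    then show ?thesis using Suc.IH coords_double[of d s "2 ^ s"] by auto
  next
    case False
    then have "d = 2 \<and> s = 1 \<or> 4 dvd d \<and> s = 0" using Suc.prems by auto
    then show ?thesis
    proof
      assume "d = 2 \<and> s = 1"
      then show ?thesis by (simp add: cong_def eval_nat_numeral)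
    next
      assume "4 dvd d \<and> s = 0"
      then show ?thesis by (simp add: cong_iff_dvd_diff eval_nat_numeral)
    qed
  qed
qed auto

text \<open>Write 2^s q = 2^s + 2^(s + 1) l; the power with exponent 2^(s + 1) is 1 modulo 2^(s +
  1).\<close>

lemma coords_two_adic:
  assumes d: "d = 2 \<and> s \<ge> 2 \<or> 4 dvd d \<and> s \<ge> 1" and "odd q"
  shows "[fst (coords d (2 ^ s * q)) = 1] (mod 2 ^ (s + 1)) \<and> [snd (coords d (2 ^ s * q)) = 2 ^ s] (mod 2 ^ (s + 1))"
proof -
  have d': "d = 2 \<and> Suc s \<ge> 2 \<or> 4 dvd d \<and> Suc s \<ge> 1" using d by auto
  have "[fst (coords d (2 ^ Suc s)) = 1] (mod 2 ^ (s + 2))" "[snd (coords d (2 ^ Suc s)) = 2 ^ (s + 1)] (mod 2 ^ (s + 2))"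
    using coords_pow2[OF d'] by simp_all
  moreover have "(2::int) ^ (s + 1) dvd 2 ^ (s + 2)" by (intro le_imp_power_dvd) auto
  ultimately have Z: "[fst (coords d (2 ^ Suc s)) = 1] (mod 2 ^ (s + 1))" "[snd (coords d (2 ^ Suc s)) = 2 ^ (s + 1)] (mod 2 ^ (s + 1))"
    using cong_dvd_modulus by blast+
  then have Z2: "[snd (coords d (2 ^ Suc s)) = 0] (mod 2 ^ (s + 1))" by (simp add: cong_def)
  have *: "[fst (coords d (2 ^ s + 2 ^ Suc s * l)) = 1] (mod 2 ^ (s + 1)) \<and> [snd (coords d (2 ^ s + 2 ^ Suc s * l)) = 2 ^ s] (mod 2 ^ (s + 1))" for l
  proof (induction l)
    case 0
    then show ?case using coords_pow2[OF d] by simp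
  next
    case (Suc l)
    define n where "n = 2 ^ s + 2 ^ Suc s * l"
    have n: "2 ^ s + 2 ^ Suc s * Suc l = n + 2 ^ Suc s" by (simp add: n_def)
    have IH: "[fst (coords d n) = 1] (mod 2 ^ (s + 1))" "[snd (coords d n) = 2 ^ s] (mod 2 ^ (s + 1))"
      using Suc by (simp_all add: n_def)
    have "[fst (coords d n) * fst (coords d (2 ^ Suc s)) - d * snd (coords d n) * snd (coords d (2 ^ Suc s)) = 1 * 1 - d * 2 ^ s * 0] (mod 2 ^ (s + 1))"
      by (intro cong_diff cong_mult IH Z Z2 cong_refl)
    moreover have "[fst (coords d n) * snd (coords d (2 ^ Suc s)) + snd (coords d n) * fst (coords d (2 ^ Suc s)) = 1 * 0 + 2 ^ s * 1] (mod 2 ^ (s + 1))"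
      by (intro cong_add cong_mult IH Z Z2)
    ultimately show ?case unfolding n coords_add by simp
  qed
  obtain l where "q = 2 * l + 1" using assms(2) by (metis oddE)
  then have "2 ^ s * q = 2 ^ s + 2 ^ Suc s * l" by (simp add: algebra_simps)
  then show ?thesis using * by simp
qed

lemma ex_two_power_decomp:
  fixes n :: nat
  assumes "n > 0"
  obtains s q where "n = 2 ^ s * q" "odd q"
  using assms multiplicity_decompose'[of n 2] by (metis not_prime_unit two_is_prime_nat less_irrefl)

lemma two_power_decomp_even:
  fixes n s q :: nat
  assumes "n = 2 ^ s * q" "odd q" "even n" shows "s \<ge> 1"
  using assms by (cases s) auto

lemma two_power_decomp_4:
  fixes n s q :: nat
  assumes "n = 2 ^ s * q" "odd q" "4 dvd n" shows "s \<ge> 2"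
proof (rule ccontr)
  assume "\<not> s \<ge> 2"
  then have "s = 0 \<or> s = 1" by auto
  then show False using assms by auto
qed

text \<open>The s obtained is the 2-adic valuation of n. Adding n to the index changes the second
  coordinate by an odd multiple of 2^s, so its value cannot recur; this rigidity settles the
  exponential equations that follow.\<close>

lemma snd_coords_shift:
  assumes d: "d = 2 \<and> 4 dvd n \<or> 4 dvd d \<and> even n" and "n > 0" "odd (fst (coords d m))"
  obtains s where "s \<ge> 1" "4 dvd n \<Longrightarrow> s \<ge> 2"
    "[snd (coords d (m + n)) = snd (coords d m) + 2 ^ s] (mod 2 ^ (s + 1))"
proof -
  obtain s q where n: "n = 2 ^ s * q" "odd q" using assms(2) by (rule ex_two_power_decomp)
  have "s \<ge> 1" using two_power_decomp_even[OF n] d by auto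
  have s2: "4 dvd n \<Longrightarrow> s \<ge> 2" using two_power_decomp_4[OF n] .
  have "d = 2 \<and> s \<ge> 2 \<or> 4 dvd d \<and> s \<ge> 1" using d s2 \<open>s \<ge> 1\<close> by auto
  then have c: "[fst (coords d n) = 1] (mod 2 ^ (s + 1))" "[snd (coords d n) = 2 ^ s] (mod 2 ^ (s + 1))"
    using coords_two_adic n by metis+
  obtain k where k: "fst (coords d m) = 2 * k + 1" using assms(3) by (metis oddE)
  have "[fst (coords d m) * snd (coords d n) + snd (coords d m) * fst (coords d n) = fst (coords d m) * 2 ^ s + snd (coords d m) * 1] (mod 2 ^ (s + 1))"
    by (intro cong_add cong_mult c cong_refl)
  moreover have "[fst (coords d m) * 2 ^ s + snd (coords d m) * 1 = snd (coords d m) + 2 ^ s] (mod 2 ^ (s + 1))"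
  proof -
    have "fst (coords d m) * 2 ^ s + snd (coords d m) * 1 - (snd (coords d m) + 2 ^ s) = 2 ^ (s + 1) * k"
      unfolding k by (simp add: distrib_right)
    then show ?thesis unfolding cong_iff_dvd_diff by (metis dvd_triv_left)
  qed
  ultimately have "[snd (coords d (m + n)) = snd (coords d m) + 2 ^ s] (mod 2 ^ (s + 1))"
    unfolding coords_add by (rule cong_trans)
  then show ?thesis using that[OF \<open>s \<ge> 1\<close> s2] by blast
qed

section \<open>Powers of 3 of the form x^2 + 2 y^2\<close>

lemma coords_mult_mod_3:
  assumes "n \<ge> 1"
  shows "3 dvd fst (coords 2 n) + 2 * snd (coords 2 n)"
  using assms by (cases n) auto

lemma square_add_double_square_eq_1:
  fixes x y :: int
  assumes "x\<^sup>2 + 2 * y\<^sup>2 = 1"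
  shows "\<bar>x\<bar> = 1 \<and> y = 0"
proof -
  have "y = 0"
  proof (rule ccontr)
    assume "y \<noteq> 0"
    then have "y\<^sup>2 \<ge> 1" by (simp add: int_one_le_iff_zero_less)
    then show False using assms zero_le_power2[of x] by linarith
  qed
  then show ?thesis using assms by (auto simp: power2_eq_1_iff)
qed

text \<open>Induction, dividing by 1 + sqrt(-2) after a choice of the sign of y; the quotient has
  the coordinates (x + 2 y) / 3 and (y - x) / 3. If the quotient belonged to the conjugate power,
  its product with 1 + sqrt(-2) would contain the norm 3, against primitivity; this is where
  \<open>coords_mult_mod_3\<close> enters.\<close>

lemma norm_form_3_coords:
  fixes x y :: int
  assumes "x\<^sup>2 + 2 * y\<^sup>2 = 3 ^ n" "\<not> 3 dvd x"
  shows "\<bar>x\<bar> = \<bar>fst (coords 2 n)\<bar> \<and> \<bar>y\<bar> = \<bar>snd (coords 2 n)\<bar>"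
  using assms
proof (induction n arbitrary: x y)
  case 0
  then show ?case using square_add_double_square_eq_1[of x y] by simp
next
  case (Suc n)
  have claim: "\<bar>x\<bar> = \<bar>fst (coords 2 (Suc n))\<bar> \<and> \<bar>y\<bar> = \<bar>snd (coords 2 (Suc n))\<bar>"
    if eq: "x\<^sup>2 + 2 * y\<^sup>2 = 3 ^ Suc n" and nd: "\<not> 3 dvd x" and d: "3 dvd y - x" for x y :: int
  proof -
    obtain y' where y': "y - x = 3 * y'" using d by (rule dvdE)
    define x' where "x' = x + 2 * y'"
    have xy: "x = x' - 2 * y'" "y = x' + y'" using y' by (simp_all add: x'_def)
    have "3 * (x'\<^sup>2 + 2 * y'\<^sup>2) = 3 * 3 ^ n"
      using eq unfolding xy by (simp add: power2_eq_square algebra_simps)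
    then have eq': "x'\<^sup>2 + 2 * y'\<^sup>2 = 3 ^ n" by simp
    have nd': "\<not> 3 dvd x'"
    proof
      assume "3 dvd x'"
      show False
      proof (cases n)
        case 0
        then have "\<bar>x'\<bar> = 1" using square_add_double_square_eq_1[of x' y'] eq' by simp
        then show False using \<open>3 dvd x'\<close> by presburger
      next
        case (Suc m)
        then have "3 dvd x'\<^sup>2 + 2 * y'\<^sup>2" using eq' by simp
        moreover have "3 dvd x'\<^sup>2" using \<open>3 dvd x'\<close> by (simp add: power2_eq_square)
        ultimately have "3 dvd 2 * y'\<^sup>2" by (simp add: dvd_add_right_iff)
        then have "3 dvd y'\<^sup>2" by presburger
        then have "3 dvd y'" using prime_dvd_power[of "3::int" y' 2] by simp
        then show False using \<open>3 dvd x'\<close> nd xy(1) by simp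
      qed
    qed
    have IH: "\<bar>x'\<bar> = \<bar>fst (coords 2 n)\<bar>" "\<bar>y'\<bar> = \<bar>snd (coords 2 n)\<bar>"
      using Suc.IH[OF eq' nd'] by auto
    have "n = 0 \<or> \<not> (x' = fst (coords 2 n) \<and> y' = - snd (coords 2 n)) \<and> \<not> (x' = - fst (coords 2 n) \<and> y' = snd (coords 2 n))"
    proof (rule ccontr)
      assume *: "\<not> ?thesis"
      then have "x = fst (coords 2 n) + 2 * snd (coords 2 n) \<or> x = - (fst (coords 2 n) + 2 * snd (coords 2 n))"
        using xy(1) by auto
      moreover have "3 dvd fst (coords 2 n) + 2 * snd (coords 2 n)" using coords_mult_mod_3[of n] * by auto
      ultimately have "3 dvd x" by (metis dvd_minus_iff)
      then show False using nd by simp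
    qed
    moreover have "snd (coords 2 n) = 0" if "n = 0" using that by simp
    ultimately have "x' = fst (coords 2 n) \<and> y' = snd (coords 2 n) \<or> x' = - fst (coords 2 n) \<and> y' = - snd (coords 2 n)"
      using IH by (auto simp: abs_eq_iff)
    then show ?thesis using xy by auto
  qed
  have "3 dvd y - x \<or> 3 dvd - y - x"
  proof -
    have "3 dvd x\<^sup>2 + 2 * y\<^sup>2" using Suc.prems by simp
    have "\<not> 3 dvd y"
    proof
      assume "3 dvd y"
      then have "3 dvd 2 * y\<^sup>2" by (simp add: power2_eq_square)
      then have "3 dvd x\<^sup>2" using \<open>3 dvd x\<^sup>2 + 2 * y\<^sup>2\<close> by (simp add: dvd_add_left_iff)
      then show False using prime_dvd_power[of "3::int" x 2] Suc.prems(2) by simp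
    qed
    then show ?thesis using Suc.prems(2) by presburger
  qed
  then show ?case
    using claim[OF Suc.prems] claim[of x "- y"] Suc.prems by auto
qed

text \<open>The value 1 is impossible modulo 2^(s + 1), and -1 is impossible modulo 4, where 2^s and
  2^(s + 1) vanish.\<close>

lemma odd_two_power_shift:
  assumes "[t = 1 + 2 ^ s] (mod 2 ^ (s + 1))" "s \<ge> 2"
  shows "\<bar>t\<bar> \<noteq> (1::int)"
proof
  assume "\<bar>t\<bar> = 1"
  then consider "t = 1" | "t = - 1" by linarith
  then show False
  proof cases
    case 1
    then have "2 ^ (s + 1) dvd (2::int) ^ s" using assms(1) by (simp add: cong_iff_dvd_diff)
    then show False using zdvd_imp_le[of "2 ^ (s + 1)" "2 ^ s"] by simp
  next
    case 2
    then have "2 ^ (s + 1) dvd - (2 + (2::int) ^ s)" using assms(1) by (simp add: cong_iff_dvd_diff)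
    then have d: "2 ^ (s + 1) dvd 2 + (2::int) ^ s" by (simp only: dvd_minus_iff)
    have "(2::int) ^ 2 dvd 2 ^ (s + 1)" "(2::int) ^ 2 dvd 2 ^ s" using assms(2) by (intro le_imp_power_dvd; simp)+
    then have "(2::int) ^ 2 dvd 2" using d by (meson dvd_add_left_iff dvd_trans)
    then show False by simp
  qed
qed

text \<open>Since m + sqrt(-2) has norm 3^n, the second coordinate of (1 + sqrt(-2))^n is 1 or -1.
  It is 1 for n = 1 and n = 3, where the cube is -5 + sqrt(-2); a larger index differs from 1 or 3
  by a multiple of 4, and the 2-adic shift excludes it.\<close>

lemma square_add_2_eq_power_3:
  fixes m :: nat
  assumes "m\<^sup>2 + 2 = 3 ^ n" "odd n" "m > 1"
  shows "m = 5"
proof -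
  have eq: "(int m)\<^sup>2 + 2 * 1\<^sup>2 = 3 ^ n" using arg_cong[OF assms(1), of int] by simp
  have "\<not> 3 dvd int m"
  proof
    assume "3 dvd int m"
    then have "3 dvd (int m)\<^sup>2" by (simp add: power2_eq_square)
    moreover have "(3::int) dvd 3 ^ n" using assms(2) by (cases n) auto
    ultimately have "3 dvd (2 * 1\<^sup>2 :: int)" using eq by (metis dvd_add_right_iff)
    then show False by simp
  qed
  then have B: "\<bar>snd (coords 2 n)\<bar> = 1" using norm_form_3_coords[OF eq] by simp
  have "n mod 4 = 1 \<or> n mod 4 = 3" using assms(2) by presburger
  then obtain r k where r: "r = 1 \<or> r = 3" "n = r + 4 * k" by (metis mult_div_mod_eq add.commute)
  have "k = 0"
  proof (rule ccontr)
    assume "k \<noteq> 0"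
    have o: "odd (fst (coords 2 r))" and B1: "snd (coords 2 r) = 1" using r(1) by (auto simp: eval_nat_numeral)
    obtain s where "4 dvd 4 * k \<Longrightarrow> s \<ge> 2" "[snd (coords 2 (r + 4 * k)) = snd (coords 2 r) + 2 ^ s] (mod 2 ^ (s + 1))"
      using snd_coords_shift[of 2 "4 * k" r] o \<open>k \<noteq> 0\<close> by auto
    then show False using odd_two_power_shift[of "snd (coords 2 n)" s] B unfolding r(2) B1 by simp
  qed
  then show ?thesis
  proof (cases "r = 1")
    case True
    then show ?thesis using assms(1,3) r(2) \<open>k = 0\<close> by (simp add: power2_eq_square)
  next
    case False
    then have "m\<^sup>2 = 5\<^sup>2" using assms(1) r \<open>k = 0\<close> by simp
    then show ?thesis by (simp only: power2_eq_iff_nonneg)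
  qed
qed

subsection \<open>Gaussian integers\<close>

lemma ex_floor_sqrt: "\<exists>m::nat. m\<^sup>2 \<le> n \<and> n < (Suc m)\<^sup>2"
proof (induction n)
  case (Suc n)
  then obtain m where m: "m\<^sup>2 \<le> n" "n < (Suc m)\<^sup>2" by blast
  show ?case
  proof (cases "Suc n = (Suc m)\<^sup>2")
    case True
    then show ?thesis by (intro exI[of _ "Suc m"]) (simp add: power2_eq_square)
  next
    case False
    then show ?thesis using m by (intro exI[of _ m]) linarith
  qed
qed (intro exI[of _ 0], simp)

text \<open>Thue's pigeonhole argument.\<close>

lemma prime_dvd_sum_squares:
  fixes c :: nat and x y :: int
  assumes c: "prime c" and dvd: "int c dvd x\<^sup>2 + y\<^sup>2" and y: "\<not> int c dvd y"
  obtains r s :: int where "r\<^sup>2 + s\<^sup>2 = int c"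
proof -
  obtain m where m: "m\<^sup>2 \<le> c" "c < (Suc m)\<^sup>2" using ex_floor_sqrt by blast
  have "m\<^sup>2 \<noteq> c"
  proof
    assume "m\<^sup>2 = c"
    then have "prime (m\<^sup>2)" using c by simp
    then show False by (simp add: prime_power_iff)
  qed
  then have m1: "m\<^sup>2 < c" using m(1) by simp
  define f where "f = (\<lambda>(i, j). (int i * y + int j * x) mod int c)"
  define S where "S = {..m} \<times> {..m}"
  have "f ` S \<subseteq> {0..<int c}" using prime_gt_0_nat[OF c] by (auto simp: f_def)
  then have "card (f ` S) \<le> c" using card_mono[of "{0..<int c}" "f ` S"] by simp
  also have "c < card S" using m(2) by (simp add: S_def power2_eq_square)
  finally have "\<not> inj_on f S" by (rule pigeonhole)
  then obtain i j i' j' where ij: "(i, j) \<in> S" "(i', j') \<in> S" "(i, j) \<noteq> (i', j')" "f (i, j) = f (i', j')"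
    unfolding inj_on_def by fast
  define r s where "r = int i - int i'" and "s = int j - int j'"
  have nz: "r \<noteq> 0 \<or> s \<noteq> 0" using ij(3) by (auto simp: r_def s_def)
  have bound: "r\<^sup>2 \<le> int (m\<^sup>2)" "s\<^sup>2 \<le> int (m\<^sup>2)"
  proof -
    have "\<bar>r\<bar> \<le> int m" "\<bar>s\<bar> \<le> int m" using ij(1,2) by (auto simp: r_def s_def S_def)
    then have "\<bar>r\<bar>\<^sup>2 \<le> (int m)\<^sup>2" "\<bar>s\<bar>\<^sup>2 \<le> (int m)\<^sup>2" by (intro power_mono; simp)+
    then show "r\<^sup>2 \<le> int (m\<^sup>2)" "s\<^sup>2 \<le> int (m\<^sup>2)" by simp_all
  qed
  have "int c dvd (int i * y + int j * x) - (int i' * y + int j' * x)"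
    using ij(4) by (simp add: f_def mod_eq_dvd_iff)
  then have "int c dvd r * y + s * x" by (simp add: r_def s_def algebra_simps)
  then have "int c dvd (r * y + s * x) * (r * y - s * x)" by (rule dvd_mult2)
  moreover have "int c dvd s\<^sup>2 * (x\<^sup>2 + y\<^sup>2)" using dvd by simp
  ultimately have "int c dvd (r * y + s * x) * (r * y - s * x) + s\<^sup>2 * (x\<^sup>2 + y\<^sup>2)" by (rule dvd_add)
  also have "(r * y + s * x) * (r * y - s * x) + s\<^sup>2 * (x\<^sup>2 + y\<^sup>2) = (r\<^sup>2 + s\<^sup>2) * y\<^sup>2"
    by (simp add: power2_eq_square algebra_simps)
  finally have "int c dvd (r\<^sup>2 + s\<^sup>2) * y\<^sup>2" .
  moreover have pc: "prime (int c)" using c by simp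
  ultimately have "int c dvd r\<^sup>2 + s\<^sup>2" using y by (meson prime_dvd_mult_iff prime_dvd_power)
  then obtain k where k: "r\<^sup>2 + s\<^sup>2 = int c * k" by (rule dvdE)
  have "r\<^sup>2 + s\<^sup>2 > 0" using nz by (simp add: sum_power2_gt_zero_iff)
  then have "k > 0" using k prime_gt_0_nat[OF c] by (simp add: zero_less_mult_iff)
  moreover have "int c * k < int c * 2"
  proof -
    have "int (m\<^sup>2) < int c" using m1 by (simp only: of_nat_less_iff)
    then show ?thesis using bound k by linarith
  qed
  then have "k < 2" by (simp add: mult_less_cancel_left)
  ultimately have "k = 1" by linarith
  then show ?thesis using that k by simp
qed

definition gauss :: "int \<Rightarrow> int \<Rightarrow> complex" where
  "gauss x y = Complex (of_int x) (of_int y)"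

lemma gauss_eq_iff: "gauss x y = gauss x' y' \<longleftrightarrow> x = x' \<and> y = y'"
  by (simp add: gauss_def)

lemma gauss_mult: "gauss x y * gauss x' y' = gauss (x * x' - y * y') (x * y' + y * x')"
  by (simp add: gauss_def complex_eq_iff)

lemma gauss_units: "gauss 1 0 = 1" "gauss (- 1) 0 = - 1" "gauss 0 1 = \<i>" "gauss 0 (- 1) = - \<i>"
  by (simp_all add: gauss_def complex_eq_iff)

lemma ex_gauss_power: "\<exists>u v. gauss x y ^ n = gauss u v"
proof (induction n)
  case 0
  then show ?case by (intro exI[of _ 1] exI[of _ 0]) (simp add: gauss_def complex_eq_iff)
next
  case (Suc n)
  then obtain u v where "gauss x y ^ n = gauss u v" by blast
  then have "gauss x y ^ Suc n = gauss (x * u - y * v) (x * v + y * u)" by (simp add: gauss_mult)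
  then show ?case by blast
qed

lemma norm_gauss: "(cmod (gauss x y))\<^sup>2 = of_int (x\<^sup>2 + y\<^sup>2)"
  by (simp add: gauss_def cmod_power2)

text \<open>The unit group has order 4, so raising to an odd power permutes it; this absorbs a unit
  into a p-th power.\<close>

lemma ex_gauss_odd_power_unit:
  assumes "\<epsilon> \<in> {1, - 1, \<i>, - \<i>}" "odd p"
  obtains x y where "gauss x y ^ p = \<epsilon>"
proof -
  obtain k where k: "p = 2 * k + 1" using assms(2) by (metis oddE)
  have "\<i> ^ p = (- 1) ^ k * \<i>" "(- \<i>) ^ p = - ((- 1) ^ k * \<i>)" unfolding k by (simp_all add: power_mult)
  moreover have "(- 1 :: complex) ^ p = - 1" using assms(2) by simp
  ultimately show ?thesis
    using assms(1) that[of 1 0] that[of "- 1" 0] that[of 0 1] that[of 0 "- 1"]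
    by (cases "even k") (auto simp: gauss_units)
qed

text \<open>Descent on n: c divides (x s - y r)(x s + y r), which fixes the conjugate of r + s i to
  divide by, and a change of conjugate on the way would produce a factor c. For n = 0 primitivity
  cannot be demanded, since the units i and -i have x = 0.\<close>

lemma gauss_prime_power:
  fixes c :: nat and r s x y :: int
  assumes c: "prime c" and rs: "r\<^sup>2 + s\<^sup>2 = int c"
    and "x\<^sup>2 + y\<^sup>2 = int c ^ n" "n = 0 \<or> \<not> int c dvd x"
  shows "\<exists>\<epsilon>\<in>{1, - 1, \<i>, - \<i>}. \<exists>s'\<in>{s, - s}. gauss x y = \<epsilon> * gauss r s' ^ n"
  using assms(3,4)
proof (induction n arbitrary: x y)
  case 0
  then have eq: "x\<^sup>2 + y\<^sup>2 = 1" by simp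
  have "\<bar>x\<bar> \<le> 1 \<and> \<bar>y\<bar> \<le> 1"
  proof -
    have "x\<^sup>2 \<le> 1" "y\<^sup>2 \<le> 1" using eq zero_le_power2[of x] zero_le_power2[of y] by linarith+
    then show ?thesis by (simp add: abs_square_le_1)
  qed
  then have "x = 0 \<or> x = 1 \<or> x = - 1" "y = 0 \<or> y = 1 \<or> y = - 1" by linarith+
  then have "(x, y) \<in> {(1, 0), (- 1, 0), (0, 1), (0, - 1)}" using eq by auto
  then have "gauss x y \<in> {1, - 1, \<i>, - \<i>}" by (auto simp: gauss_units)
  then show ?case by (intro bexI[of _ "gauss x y"] bexI[of _ s]) simp_all
next
  case (Suc n)
  have pc: "prime (int c)" using c by simp
  have nd: "\<not> int c dvd x" using Suc.prems by simp
  have "(x * s - y * r) * (x * s + y * r) = x\<^sup>2 * (r\<^sup>2 + s\<^sup>2) - r\<^sup>2 * (x\<^sup>2 + y\<^sup>2)"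
    by (simp add: power2_eq_square algebra_simps)
  also have "\<dots> = int c * (x\<^sup>2 - r\<^sup>2 * int c ^ n)"
    unfolding rs Suc.prems(1) by (simp add: algebra_simps)
  finally have "int c dvd (x * s - y * r) * (x * s + y * r)" by simp
  then have "int c dvd x * s - y * r \<or> int c dvd x * s + y * r" using pc by (simp add: prime_dvd_mult_iff)
  then obtain s' where s': "s' = s \<or> s' = - s" "int c dvd y * r - x * s'"
    by (metis (no_types, opaque_lifting) dvd_minus_iff minus_diff_eq diff_minus_eq_add mult_minus_right add.commute)
  have rs': "r\<^sup>2 + s'\<^sup>2 = int c" using rs s'(1) by auto
  obtain y' where y': "y * r - x * s' = int c * y'" using s'(2) by (rule dvdE)
  have sum: "(x * r + y * s')\<^sup>2 + (y * r - x * s')\<^sup>2 = int c ^ Suc n * int c"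
  proof -
    have "(x * r + y * s')\<^sup>2 + (y * r - x * s')\<^sup>2 = (x\<^sup>2 + y\<^sup>2) * (r\<^sup>2 + s'\<^sup>2)"
      by (simp add: power2_eq_square algebra_simps)
    then show ?thesis unfolding Suc.prems(1) rs' .
  qed
  have "int c dvd (x * r + y * s')\<^sup>2"
  proof -
    have "(x * r + y * s')\<^sup>2 = int c * (int c ^ Suc n - int c * y'\<^sup>2)"
      using sum unfolding y' by (simp add: power2_eq_square algebra_simps)
    then show ?thesis by simp
  qed
  then have "int c dvd x * r + y * s'" using pc by (rule prime_dvd_power[rotated])
  then obtain x' where x': "x * r + y * s' = int c * x'" by (rule dvdE)
  have "int c ^ 2 * (x'\<^sup>2 + y'\<^sup>2) = int c ^ 2 * int c ^ n"
    using sum unfolding x' y' by (simp add: power2_eq_square algebra_simps)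
  then have eq': "x'\<^sup>2 + y'\<^sup>2 = int c ^ n" using prime_gt_0_nat[OF c] by simp
  have "int c * x = int c * (x' * r - y' * s')" "int c * y = int c * (x' * s' + y' * r)"
  proof -
    have "(x * r + y * s') * r - (y * r - x * s') * s' = x * (r\<^sup>2 + s'\<^sup>2)"
      "(x * r + y * s') * s' + (y * r - x * s') * r = y * (r\<^sup>2 + s'\<^sup>2)"
      by (simp_all add: power2_eq_square algebra_simps)
    then have "int c * x' * r - int c * y' * s' = x * int c" "int c * x' * s' + int c * y' * r = y * int c"
      unfolding x' y' rs' .
    then show "int c * x = int c * (x' * r - y' * s')" "int c * y = int c * (x' * s' + y' * r)"
      by (simp_all add: algebra_simps)
  qed
  then have xy: "x = x' * r - y' * s'" "y = x' * s' + y' * r" using prime_gt_0_nat[OF c] by simp_all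
  then have prod: "gauss x y = gauss x' y' * gauss r s'" by (simp add: gauss_mult)
  have "n = 0 \<or> \<not> int c dvd x'"
  proof (rule ccontr)
    assume *: "\<not> (n = 0 \<or> \<not> int c dvd x')"
    then have "int c dvd x'\<^sup>2 + y'\<^sup>2" unfolding eq' by (simp add: dvd_power)
    moreover have "int c dvd x'\<^sup>2" using * by (simp add: power2_eq_square)
    ultimately have "int c dvd y'\<^sup>2" by (simp add: dvd_add_right_iff)
    then have "int c dvd y'" using pc by (rule prime_dvd_power[rotated])
    then show False using * nd unfolding xy by simp
  qed
  then obtain \<epsilon> s2 where \<epsilon>: "\<epsilon> \<in> {1, - 1, \<i>, - \<i>}" "s2 = s \<or> s2 = - s" "gauss x' y' = \<epsilon> * gauss r s2 ^ n"
    using Suc.IH[OF eq'] by blast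
  show ?case
  proof (cases "s2 = s' \<or> n = 0")
    case True
    then have "gauss x y = \<epsilon> * gauss r s' ^ Suc n" using prod \<epsilon>(3) by auto
    then show ?thesis using \<epsilon>(1) s'(1) by blast
  next
    case False
    then have s2: "s2 = - s'" using \<epsilon>(2) s'(1) by auto
    obtain m where m: "n = Suc m" using False by (cases n) auto
    have "gauss r s2 * gauss r s' = of_nat c"
    proof -
      have "gauss r s2 * gauss r s' = gauss (int c) 0"
        unfolding s2 gauss_mult rs'[symmetric] by (simp add: power2_eq_square algebra_simps)
      then show ?thesis by (simp add: gauss_def complex_eq_iff)
    qed
    then have "gauss x y = of_nat c * (\<epsilon> * gauss r s2 ^ m)" using prod \<epsilon>(3) m by simp
    moreover obtain u v where "gauss r s2 ^ m = gauss u v" using ex_gauss_power by blast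
    moreover obtain a b where "\<epsilon> = gauss a b"
      using \<epsilon>(1) gauss_units by (metis insertE singletonD)
    ultimately have "gauss x y = gauss (int c) 0 * (gauss a b * gauss u v)"
      by (simp add: gauss_def complex_eq_iff)
    then have "int c dvd x" unfolding gauss_mult gauss_eq_iff by simp
    then show ?thesis using nd by simp
  qed
qed

lemma gauss_odd_power:
  "gauss u v ^ (2 * k + 1) = gauss (u * odd_part k (u\<^sup>2) (- (v\<^sup>2))) (v * odd_part k (- (v\<^sup>2)) (u\<^sup>2))"
proof -
  have g: "gauss x y = of_int x + \<i> * of_int y" for x y by (simp add: gauss_def complex_eq_iff)
  have "(of_int u + \<i> * of_int v) ^ (2 * k + 1)
      = of_int u * odd_part k ((of_int u)\<^sup>2) ((\<i> * of_int v)\<^sup>2) + \<i> * of_int v * odd_part k ((\<i> * of_int v)\<^sup>2) ((of_int u :: complex)\<^sup>2)"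
    by (rule odd_power_add)
  also have "(\<i> * of_int v)\<^sup>2 = of_int (- (v\<^sup>2))" by (simp add: power_mult_distrib)
  also have "(of_int u :: complex)\<^sup>2 = of_int (u\<^sup>2)" by simp
  finally show ?thesis unfolding g of_int_odd_part[symmetric] by (simp add: mult.assoc)
qed

section \<open>Second coordinates equal to 1 or -1\<close>

lemma coords_power:
  fixes y :: complex
  assumes "y\<^sup>2 = - of_int d"
  shows "(1 + y) ^ n = of_int (fst (coords d n)) + y * of_int (snd (coords d n))"
proof (induction n)
  case (Suc n)
  have "(1 + y) ^ Suc n = of_int (fst (coords d n)) + y\<^sup>2 * of_int (snd (coords d n)) + y * (of_int (fst (coords d n)) + of_int (snd (coords d n)))"
    unfolding power_Suc Suc by (simp add: power2_eq_square algebra_simps)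
  then show ?case unfolding assms by simp
qed simp

text \<open>Ties the recursion to the binomial expansion, so that the 2-adic facts apply to
  \<open>odd_part\<close>. With d > 0 the coordinates can be read off from real and imaginary
  parts.\<close>

lemma snd_coords_odd:
  assumes "d > 0"
  shows "snd (coords d (2 * k + 1)) = odd_part k (- d) 1"
proof -
  define y where "y = \<i> * complex_of_real (sqrt (of_int d))"
  have "y\<^sup>2 = - complex_of_real ((sqrt (of_int d))\<^sup>2)" unfolding y_def power_mult_distrib i_squared of_real_power by simp
  then have y: "y\<^sup>2 = - of_int d" using assms by simp
  have "of_int (fst (coords d (2 * k + 1))) + y * of_int (snd (coords d (2 * k + 1))) = (1 + y) ^ (2 * k + 1)"
    by (rule coords_power[OF y, symmetric])
  also have "\<dots> = 1 * odd_part k (1\<^sup>2) (y\<^sup>2) + y * odd_part k (y\<^sup>2) (1\<^sup>2)" by (rule odd_power_add)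
  also have "\<dots> = of_int (odd_part k 1 (- d)) + y * of_int (odd_part k (- d) 1)"
    unfolding y of_int_odd_part by simp
  finally have "Im (of_int (fst (coords d (2 * k + 1))) + y * of_int (snd (coords d (2 * k + 1)))) = Im (of_int (odd_part k 1 (- d)) + y * of_int (odd_part k (- d) 1))"
    by simp
  then show ?thesis using assms by (simp add: y_def)
qed

text \<open>Modulo 1 + d the number -d is 1, so each step of the recursion doubles the common
  residue of both coordinates.\<close>

lemma coords_mod_norm:
  "[fst (coords d (Suc n)) = 2 ^ n] (mod (1 + d)) \<and> [snd (coords d (Suc n)) = 2 ^ n] (mod (1 + d))"
proof (induction n)
  case 0
  then show ?case by simp
next
  case (Suc n)
  define A B where "A = fst (coords d (Suc n))" and "B = snd (coords d (Suc n))"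
  have IH: "[A = 2 ^ n] (mod (1 + d))" "[B = 2 ^ n] (mod (1 + d))" using Suc by (simp_all add: A_def B_def)
  have step: "coords d (Suc (Suc n)) = (A - d * B, A + B)" by (simp add: A_def B_def)
  have "[A + B = 2 ^ n + 2 ^ n] (mod (1 + d))" using IH by (intro cong_add)
  moreover have "[A - d * B = A + B] (mod (1 + d))"
  proof -
    have "A - d * B - (A + B) = (1 + d) * (- B)" by (simp add: algebra_simps)
    then show ?thesis unfolding cong_iff_dvd_diff by (metis dvd_triv_left)
  qed
  ultimately show ?case unfolding step by (auto intro: cong_trans)
qed

lemma power_plus_one_dvd:
  assumes "odd (k::nat)" shows "(x + 1 :: int) dvd x ^ k + 1"
proof -
  have "x - (- 1) dvd x ^ k - (- 1) ^ k" by (simp only: power_diff_sumr2 dvd_triv_left)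
  then show ?thesis using assms by simp
qed

text \<open>The surviving case is (1 + 2 i)^3 = -11 - 2 i. The shift of the index from 1 to p shows
  that p is 3 modulo 4 and the coordinate is -1. Modulo 1 + 4^k it is also 2^(p - 1), an odd power
  of 4; for even k, raising to the k-th power would contradict 4^k = -1. So k is odd, 5 divides 4^k
  + 1, and c = 5; residues modulo 8 give k = 1, and a second shift, from 3 to p, gives p =
  3.\<close>

lemma snd_coords_4_power_unit:
  fixes k p c w :: nat
  assumes p: "odd p" "p > 1" and k: "k \<ge> 1" and c: "prime c" "4 ^ k + 1 = c ^ w" "odd w"
    and B: "\<bar>snd (coords (4 ^ k) p)\<bar> = 1"
  shows "p = 3 \<and> c = 5 \<and> k = 1 \<and> w = 1"
proof -
  have d4: "(4::int) dvd 4 ^ k" using k by (simp add: dvd_power)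
  obtain s where s: "s \<ge> 1" "4 dvd p - 1 \<Longrightarrow> s \<ge> 2"
    "[snd (coords (4 ^ k) (1 + (p - 1))) = snd (coords (4 ^ k) 1) + 2 ^ s] (mod 2 ^ (s + 1))"
    using snd_coords_shift[of "4 ^ k" "p - 1" 1] d4 p by auto
  then have s3: "[snd (coords (4 ^ k) p) = 1 + 2 ^ s] (mod 2 ^ (s + 1))" using p by simp
  then have "\<not> s \<ge> 2" using odd_two_power_shift B by blast
  then have s1: "s = 1" and p4: "\<not> 4 dvd p - 1" using s by auto
  have Bm: "snd (coords (4 ^ k) p) = - 1"
  proof (rule ccontr)
    assume "snd (coords (4 ^ k) p) \<noteq> - 1"
    then have "snd (coords (4 ^ k) p) = 1" using B by linarith
    then show False using s3 s1 by (simp add: cong_def)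
  qed
  have "p mod 4 = 3" using p(1) p4 p(2) by presburger
  then obtain m where m: "p = 3 + 4 * m" by (metis mod_div_mult_eq add.commute mult.commute)
  have "[snd (coords (4 ^ k) (Suc (p - 1))) = 2 ^ (p - 1)] (mod (1 + 4 ^ k))" using coords_mod_norm by blast
  moreover have "Suc (p - 1) = p" using p(2) by simp
  moreover have "(2::int) ^ (p - 1) = 4 ^ (1 + 2 * m)"
  proof -
    have "p - 1 = 2 * (1 + 2 * m)" using m by simp
    then show ?thesis by (simp only: power_mult) simp
  qed
  ultimately have q: "[- 1 = 4 ^ (1 + 2 * m)] (mod (1 + 4 ^ k :: int))"
    using Bm by metis
  have "odd k"
  proof
    assume "even k"
    have "[(- 1) ^ k = (4 ^ (1 + 2 * m)) ^ k] (mod (1 + 4 ^ k :: int))" using q by (rule cong_pow)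
    then have 1: "[1 = (4 ^ k) ^ (1 + 2 * m)] (mod (1 + 4 ^ k :: int))" using \<open>even k\<close> by (simp add: mult.commute flip: power_mult)
    have "[(4 ^ k) = - 1] (mod (1 + 4 ^ k :: int))" by (simp add: cong_iff_dvd_diff add.commute)
    then have "[(4 ^ k) ^ (1 + 2 * m) = (- 1) ^ (1 + 2 * m)] (mod (1 + 4 ^ k :: int))" by (rule cong_pow)
    then have "[1 = - 1] (mod (1 + 4 ^ k :: int))" using 1 by (auto intro: cong_trans)
    then have "1 + 4 ^ k dvd (2::int)" by (simp add: cong_iff_dvd_diff)
    then have "1 + 4 ^ k \<le> (2::int)" by (rule zdvd_imp_le) simp
    moreover have "(4::int) ^ 1 \<le> 4 ^ k" using k by (intro power_increasing) auto
    ultimately show False by simp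
  qed
  then have "(5::int) dvd 4 ^ k + 1" using power_plus_one_dvd[of k 4] by simp
  then have "int 5 dvd int (4 ^ k + 1)" by (simp add: add.commute)
  then have "5 dvd c ^ w" unfolding int_dvd_int_iff c(2) .
  then have "5 dvd c" using prime_dvd_power[of 5 c w] by simp
  then have c5: "c = 5" using c(1) primes_dvd_imp_eq[of 5 c] by simp
  obtain v where v: "w = 2 * v + 1" using c(3) by (metis oddE)
  have "k = 1"
  proof (rule ccontr)
    assume "k \<noteq> 1"
    then have "(4::nat) ^ 2 dvd 4 ^ k" using k by (intro le_imp_power_dvd) auto
    then have "(8::nat) dvd 4 ^ k" by (rule dvd_trans[rotated]) simp
    then obtain t where "(4::nat) ^ k = 8 * t" by (rule dvdE)
    then have "(4 ^ k + 1) mod 8 = (1::nat)" by simp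
    moreover have "(5::nat) ^ w mod 8 = 5"
      using odd_power_even_mod_8[of 5 v] mod_mult_right_eq[of 5 "5 ^ (2 * v)" "8::nat"] unfolding v by simp
    ultimately show False using c(2) c5 by simp
  qed
  then have "5 ^ w = (5::nat) ^ 1" using c(2) c5 by simp
  then have w1: "w = 1" by (subst (asm) power_inject_exp) simp_all
  have "m = 0"
  proof (rule ccontr)
    assume "m \<noteq> 0"
    have c3: "coords 4 3 = (- 11, - 1)" by (simp add: eval_nat_numeral)
    obtain s where s: "[snd (coords 4 (3 + 4 * m)) = snd (coords 4 3) + 2 ^ s] (mod 2 ^ (s + 1))"
      using snd_coords_shift[of 4 "4 * m" 3] \<open>m \<noteq> 0\<close> c3 by auto
    then have "[- 1 = - 1 + 2 ^ s] (mod (2::int) ^ (s + 1))" using Bm \<open>k = 1\<close> m c3 by simp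
    then have "2 ^ (s + 1) dvd (2::int) ^ s" by (simp add: cong_iff_dvd_diff)
    then show False using zdvd_imp_le[of "2 ^ (s + 1)" "2 ^ s"] by simp
  qed
  then show ?thesis using m c5 \<open>k = 1\<close> w1 by simp
qed

text \<open>If a prime p divides z, factorization in the Gaussian integers makes 2^k + b^j i a p-th
  power (u + v i)^p. As u is even and v odd, the cofactor of u is odd, so |u| = 2^k. If b divides v,
  \<open>no_prime_step\<close> applies with s = 1. For v = 1 or v = -1 the exponent of b would be 0,
  outside its range; that case is \<open>snd_coords_4_power_unit\<close>.\<close>

lemma even_even_odd_exponent:
  fixes b c j k z :: nat
  assumes b: "prime b" "odd b" and c: "prime c" "b \<noteq> c" and jk: "j \<ge> 1" "k \<ge> 1" and z: "odd z"
    and eq: "2 ^ (2 * k) + b ^ (2 * j) = c ^ z"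
  shows "z = 1 \<or> b = 11 \<and> c = 5"
proof (rule ccontr)
  assume neg: "\<not> ?thesis"
  then obtain p where p: "prime p" "p dvd z" using prime_factor_nat by auto
  then have op: "odd p" using z by (meson dvd_trans)
  then obtain h where h: "p = 2 * h + 1" by (metis oddE)
  have h1: "h \<ge> 1" using h p(1) by (cases h) auto
  obtain w where w: "z = p * w" using p(2) by (rule dvdE)
  have ow: "odd w" using z w by simp
  have oc: "odd c"
  proof
    assume "even c"
    then have "even (c ^ z)" using z by (cases z) auto
    then show False using eq b(2) jk by (metis even_add even_power dvd_refl mult_eq_0_iff not_one_le_zero zero_neq_numeral gr0I)
  qed
  have ieq: "(2 ^ k)\<^sup>2 + (int b ^ j)\<^sup>2 = int c ^ z"
    using arg_cong[OF eq, of int] by (simp add: power_even_eq)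
  have cb: "\<not> int c dvd int b ^ j"
  proof
    assume "int c dvd int b ^ j"
    then have "int c dvd int (b ^ j)" by simp
    then have "c dvd b ^ j" unfolding int_dvd_int_iff .
    then have "c dvd b" using c(1) prime_dvd_power by blast
    then show False using c b(1) primes_dvd_imp_eq by blast
  qed
  have c2: "\<not> int c dvd 2 ^ k"
  proof
    assume "int c dvd 2 ^ k"
    then have "int c dvd int (2 ^ k)" by simp
    then have "c dvd 2 ^ k" unfolding int_dvd_int_iff .
    then have "c dvd 2" using c(1) prime_dvd_power by blast
    then show False using c(1) oc primes_dvd_imp_eq two_is_prime_nat by blast
  qed
  have "int c dvd (2 ^ k)\<^sup>2 + (int b ^ j)\<^sup>2" unfolding ieq using z by (cases z) auto
  then obtain r s where rs: "r\<^sup>2 + s\<^sup>2 = int c" using prime_dvd_sum_squares[OF c(1) _ cb] by blast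
  obtain \<epsilon> s' where \<epsilon>: "\<epsilon> \<in> {1, - 1, \<i>, - \<i>}" "gauss (2 ^ k) (int b ^ j) = \<epsilon> * gauss r s' ^ z"
    using gauss_prime_power[OF c(1) rs ieq] c2 by blast
  obtain e1 e2 where e: "gauss e1 e2 ^ p = \<epsilon>" using ex_gauss_odd_power_unit[OF \<epsilon>(1) op] by blast
  obtain u1 v1 where uv1: "gauss r s' ^ w = gauss u1 v1" using ex_gauss_power by blast
  define u v where "u = e1 * u1 - e2 * v1" and "v = e1 * v1 + e2 * u1"
  have pw: "gauss u v ^ p = gauss (2 ^ k) (int b ^ j)"
    unfolding \<epsilon>(2) e[symmetric] w u_def v_def gauss_mult[symmetric] uv1[symmetric]
    by (simp add: power_mult_distrib mult.commute flip: power_mult)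
  have nrm: "u\<^sup>2 + v\<^sup>2 = int c ^ w"
  proof -
    have "((of_int (u\<^sup>2 + v\<^sup>2))::real) ^ p = ((cmod (gauss u v))\<^sup>2) ^ p" unfolding norm_gauss ..
    also have "\<dots> = (cmod (gauss u v ^ p))\<^sup>2" by (simp add: norm_power mult.commute flip: power_mult)
    also have "\<dots> = of_int ((2 ^ k)\<^sup>2 + (int b ^ j)\<^sup>2)" unfolding pw norm_gauss ..
    also have "\<dots> = (of_int (int c ^ w)) ^ p" unfolding ieq w by (simp add: mult.commute flip: power_mult)
    finally have "(of_int (u\<^sup>2 + v\<^sup>2) :: real) = of_int (int c ^ w)"
      by (rule power_eq_imp_eq_base) (use h in \<open>auto simp: sum_power2_ge_zero\<close>)
    then show ?thesis unfolding of_int_eq_iff .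
  qed
  define F G where "F = odd_part h (u\<^sup>2) (- (v\<^sup>2))" and "G = odd_part h (- (v\<^sup>2)) (u\<^sup>2)"
  have uF: "u * F = 2 ^ k" and vG: "v * G = int b ^ j"
    using pw unfolding h gauss_odd_power gauss_eq_iff F_def G_def by simp_all
  have pp: "\<exists>i. \<bar>x\<bar> = int (q ^ i) \<and> i \<le> n" if q: "prime q" "x * y = int (q ^ n)" for x y :: int and q n :: nat
  proof -
    have "nat \<bar>x\<bar> * nat \<bar>y\<bar> = nat \<bar>int (q ^ n)\<bar>"
      unfolding q(2)[symmetric] abs_mult by (simp add: nat_mult_distrib)
    then have "nat \<bar>x\<bar> * nat \<bar>y\<bar> = q ^ n" by (simp only: abs_of_nat nat_int)
    then have "nat \<bar>x\<bar> dvd q ^ n" by (metis dvd_triv_left)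
    then obtain i where "i \<le> n" "nat \<bar>x\<bar> = q ^ i" using divides_primepow_nat[OF q(1)] by blast
    then show ?thesis by (metis nat_0_le abs_ge_zero)
  qed
  have ov: "odd v" using vG b(2) by (metis even_mult_iff even_of_nat even_power of_nat_power)
  have "odd (u\<^sup>2 + v\<^sup>2)" unfolding nrm using oc by simp
  then have eu: "even (u\<^sup>2)" using ov by simp
  have "even (F - of_nat (2 * h + 1) * (- (v\<^sup>2)) ^ h)" unfolding F_def using dvd_odd_part_diff[OF eu] .
  then have oF: "odd F" using ov by simp
  have "F * u = int (2 ^ k)" using uF by (simp add: mult.commute)
  then obtain i where i: "\<bar>F\<bar> = int (2 ^ i)" using pp[OF two_is_prime_nat] by blast
  then have "i = 0" using oF by (metis even_abs_add_iff abs_dvd_iff dvd_abs_iff even_of_nat even_power gr0I even_numeral dvd_refl)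
  then have F1: "\<bar>F\<bar> = 1" using i by simp
  then have u2: "\<bar>u\<bar> = 2 ^ k" using arg_cong[OF uF, of abs] by (simp add: abs_mult)
  have U: "u\<^sup>2 = int (2 ^ (2 * k))" using arg_cong[OF u2, of "\<lambda>t. t\<^sup>2"] by (simp add: power_even_eq)
  have "v * G = int (b ^ j)" using vG by simp
  then obtain i where i: "\<bar>v\<bar> = int (b ^ i)" "i \<le> j" using pp[OF b(1)] by blast
  have V: "v\<^sup>2 = int (b ^ (2 * i))" using arg_cong[OF i(1), of "\<lambda>t. t\<^sup>2"] by (simp add: power_even_eq)
  have N1: "2 ^ (2 * k) + b ^ (2 * i) = c ^ w"
  proof -
    have "int (2 ^ (2 * k) + b ^ (2 * i)) = int (c ^ w)" using nrm unfolding U V by simp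
    then show ?thesis unfolding of_nat_eq_iff .
  qed
  show False
  proof (cases "i = 0")
    case False
    have "int (b ^ i) * \<bar>G\<bar> = int (b ^ i) * int (b ^ (j - i))"
      using arg_cong[OF vG, of abs] i by (simp add: abs_mult flip: power_add)
    then have G: "\<bar>G\<bar> = int (b ^ (j - i))" using prime_gt_0_nat[OF b(1)] by simp
    have "\<bar>odd_part h Y (- X)\<bar> = \<bar>odd_part h (- Y) X\<bar>" for X Y :: int
      using odd_part_scale[of h "-1" "- Y" X] by (simp add: abs_mult power_abs)
    then have S: "\<bar>odd_part h (int (b ^ (2 * i))) (- int (2 ^ (2 * k)))\<bar> = int (1 ^ (2 * h) * b ^ (j - i))"
      using G unfolding G_def U V by simp
    have R: "\<bar>odd_part h (int (2 ^ (2 * k))) (- int (b ^ (2 * i)))\<bar> = int (1 ^ (2 * h) * 2 ^ 0)"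
      using F1 unfolding F_def U V by simp
    have "2 * j = 2 * i + 2 * (j - i)" using i(2) by simp
    then have "b ^ (2 * i) * b ^ (2 * (j - i)) = b ^ (2 * j)" by (metis power_add)
    then have N2: "2 ^ (2 * k) * 2 ^ (2 * 0) + b ^ (2 * i) * b ^ (2 * (j - i)) = 1\<^sup>2 * (c ^ w) ^ (2 * h + 1)"
      using eq unfolding w h by (simp add: mult.commute power_add flip: power_mult)
    show False
      by (rule no_prime_step[OF two_is_prime_nat b(1) _ _ _ h1 _ _ R S _ N2])
        (use b jk False p(1) h N1 in auto)
  next
    case True
    then have cw: "4 ^ k + 1 = c ^ w" using N1 by (simp add: power_mult)
    have "\<bar>odd_part h (- (4 ^ k)) 1\<bar> = \<bar>odd_part h (4 ^ k) (- 1 :: int)\<bar>"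
      using odd_part_scale[of h "-1" "4 ^ k" "- 1 :: int"] by (simp add: abs_mult power_abs)
    also have "\<dots> = 1" using F1 True unfolding F_def U V by (simp add: power_mult)
    finally have "\<bar>snd (coords (4 ^ k) p)\<bar> = 1" unfolding h by (subst snd_coords_odd) simp_all
    then have "p = 3" "c = 5" "k = 1" "w = 1"
      using snd_coords_4_power_unit[OF op prime_gt_1_nat[OF p(1)] jk(2) c(1) cw ow] by auto
    then have "(b ^ j)\<^sup>2 = 11\<^sup>2" using eq w by (simp add: power_even_eq)
    then have "b ^ j = 11" by (simp only: power2_eq_iff_nonneg)
    then have "b = 11" using prime_power_eq_prime[OF b(1), of 11] by simp
    then show False using neg \<open>c = 5\<close> by simp
  qed
qed

subsection \<open>Congruences modulo 65520\<close>

text \<open>\<open>65520 = 16 \<cdot> 9 \<cdot> 5 \<cdot> 7 \<cdot> 13\<close>, and 12 is a period of all power functions involved.\<close>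

lemma power_periodic:
  fixes a M :: nat
  assumes "[a ^ (k0 + 12) = a ^ k0] (mod M)"
  shows "[a ^ (k0 + i) = a ^ (k0 + i mod 12)] (mod M)"
proof -
  have step: "[a ^ (k0 + r + 12 * q) = a ^ (k0 + r)] (mod M)" for r q
  proof (induction q)
    case (Suc q)
    have "[a ^ (k0 + 12) * a ^ (r + 12 * q) = a ^ k0 * a ^ (r + 12 * q)] (mod M)"
      using assms by (rule cong_scalar_right)
    then have "[a ^ (k0 + r + 12 * Suc q) = a ^ (k0 + r + 12 * q)] (mod M)"
      by (simp add: power_add mult_ac)
    then show ?case using Suc by (rule cong_trans)
  qed simp
  have "k0 + i mod 12 + 12 * (i div 12) = k0 + i" by simp
  then show ?thesis using step[of "i mod 12" "i div 12"] by metis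
qed

text \<open>The unit groups modulo 16, 9, 5, 7 and 13 have the exponents 4, 6, 4, 6 and 12. For 5, 7
  and 13 multiples of the prime satisfy the congruence as well; for 16 and 9 the assumptions on t
  exclude them.\<close>

lemma power_13_cong:
  fixes t :: nat
  assumes "odd t" "\<not> 3 dvd t"
  shows "[t ^ 13 = t] (mod 65520)"
proof -
  have 16: "[t ^ 13 = t] (mod 16)"
  proof -
    have "t mod 16 \<in> {1, 3, 5, 7, 9, 11, 13, 15}" using assms(1) by simp presburger
    then show ?thesis unfolding cong_def power_mod[of t, symmetric] by auto
  qed
  have 9: "[t ^ 13 = t] (mod 9)"
  proof -
    have "t mod 9 \<in> {1, 2, 4, 5, 7, 8}" using assms(2) by simp presburger
    then show ?thesis unfolding cong_def power_mod[of t, symmetric] by auto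
  qed
  have 5: "[t ^ 13 = t] (mod 5)"
  proof -
    have "t mod 5 \<in> {0, 1, 2, 3, 4}" by simp presburger
    then show ?thesis unfolding cong_def power_mod[of t, symmetric] by auto
  qed
  have 7: "[t ^ 13 = t] (mod 7)"
  proof -
    have "t mod 7 \<in> {0, 1, 2, 3, 4, 5, 6}" by simp presburger
    then show ?thesis unfolding cong_def power_mod[of t, symmetric] by auto
  qed
  have 13: "[t ^ 13 = t] (mod 13)"
  proof -
    have "t mod 13 \<in> {0, 1, 2, 3, 4, 5, 6, 7, 8, 9, 10, 11, 12}" by simp presburger
    then show ?thesis unfolding cong_def power_mod[of t, symmetric] by auto
  qed
  have "coprime (16::nat) 9" "coprime (16 * 9 :: nat) 5" "coprime (16 * 9 * 5 :: nat) 7" "coprime (16 * 9 * 5 * 7 :: nat) 13"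
    by (simp_all add: coprime_iff_gcd_eq_1 gcd_non_0_nat)
  then have "[t ^ 13 = t] (mod (16 * 9 * 5 * 7 * 13))"
    using 16 9 5 7 13 by (meson coprime_cong_mult_nat)
  then show ?thesis by simp
qed

lemma residue_power_9: "(9::nat) ^ Suc i mod 65520 \<in> {9, 81, 729, 6561, 7281, 59049}"
proof (induction i)
  case (Suc i)
  have "(9::nat) ^ Suc (Suc i) mod 65520 = 9 * (9 ^ Suc i mod 65520) mod 65520"
    by (simp add: mod_mult_right_eq)
  then show ?case using Suc by auto
qed simp

text \<open>As 65520 = 2^16 - 2^4, the powers of 2 have period 12 from the exponent 4 on.\<close>

lemma residue_odd_power_2: "(2::nat) ^ (5 + 2 * i) mod 65520 \<in> {32, 128, 512, 2048, 8192, 32768}"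
proof (induction i)
  case (Suc i)
  have "(2::nat) ^ (5 + 2 * Suc i) = 4 * 2 ^ (5 + 2 * i)" by (simp add: power_add)
  then have "(2::nat) ^ (5 + 2 * Suc i) mod 65520 = 4 * (2 ^ (5 + 2 * i) mod 65520) mod 65520"
    by (simp only: mod_mult_right_eq)
  then show ?case using Suc by auto
qed simp

lemma residue_odd_power_3: "(3::nat) ^ (3 + 2 * i) mod 65520 \<in> {27, 243, 2187, 19683, 21843, 46107}"
proof (induction i)
  case (Suc i)
  have "(3::nat) ^ (3 + 2 * Suc i) = 9 * 3 ^ (3 + 2 * i)" by (simp add: power_add)
  then have "(3::nat) ^ (3 + 2 * Suc i) mod 65520 = 9 * (3 ^ (3 + 2 * i) mod 65520) mod 65520"
    by (simp only: mod_mult_right_eq)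
  then show ?case using Suc by auto
qed simp

text \<open>There are six possible residues of t, and the odd powers of each run through six values.
  Carrying t^2 along identifies the cycle, so the induction step is a finite check on 36
  pairs.\<close>

lemma residue_sum_power:
  fixes j i :: nat
  defines "t \<equiv> (2::nat) + 9 ^ Suc j"
  shows "(t ^ (2 * i + 1) mod 65520, t\<^sup>2 mod 65520) \<in> {(11, 121), (83, 6889), (731, 10201), (1331, 121), (1787, 26329), (3947, 6889), (6131,
      46201), (6563, 26329), (7283, 36409), (7307, 36409), (9707, 36409), (13931, 121), (15371,
      46201), (20411, 10201), (20483, 26329), (20987, 26329), (21923, 6889), (22811, 10201),
      (25787, 6889), (26963, 36409), (27731, 121), (27971, 46201), (29363, 36409), (30011, 121),
      (33491, 10201), (36563, 26329), (37211, 46201), (43763, 6889), (47387, 26329), (47627,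
      6889), (47651, 121), (49811, 46201), (53147, 36409), (53171, 10201), (55571, 10201),
      (59051, 46201)}"
proof (induction i)
  case 0
  define r where "r = t mod 65520"
  have "r = (2 + 9 ^ Suc j mod 65520) mod 65520" unfolding r_def t_def by (simp only: mod_add_right_eq)
  then have "r \<in> {11, 83, 731, 6563, 7283, 59051}" using residue_power_9[of j] by (elim insertE emptyE) simp_all
  then have "(r, r\<^sup>2 mod 65520) \<in> {(11, 121), (83, 6889), (731, 10201), (1331, 121), (1787, 26329), (3947, 6889), (6131,
      46201), (6563, 26329), (7283, 36409), (7307, 36409), (9707, 36409), (13931, 121), (15371,
      46201), (20411, 10201), (20483, 26329), (20987, 26329), (21923, 6889), (22811, 10201),
      (25787, 6889), (26963, 36409), (27731, 121), (27971, 46201), (29363, 36409), (30011, 121),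
      (33491, 10201), (36563, 26329), (37211, 46201), (43763, 6889), (47387, 26329), (47627,
      6889), (47651, 121), (49811, 46201), (53147, 36409), (53171, 10201), (55571, 10201),
      (59051, 46201)}"
    by (elim insertE emptyE) simp_all
  then show ?case unfolding r_def by (simp only: power_mod mult_0_right add_0 power_one_right)
next
  case (Suc i)
  define v q where "v = t ^ (2 * i + 1) mod 65520" and "q = t\<^sup>2 mod 65520"
  have "t ^ (2 * Suc i + 1) = t ^ (2 * i + 1) * t\<^sup>2" by (simp add: power2_eq_square)
  then have "t ^ (2 * Suc i + 1) mod 65520 = v * q mod 65520" unfolding v_def q_def by (simp only: mod_mult_eq)
  moreover have "(v, q) \<in> {(11, 121), (83, 6889), (731, 10201), (1331, 121), (1787, 26329), (3947, 6889), (6131,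
      46201), (6563, 26329), (7283, 36409), (7307, 36409), (9707, 36409), (13931, 121), (15371,
      46201), (20411, 10201), (20483, 26329), (20987, 26329), (21923, 6889), (22811, 10201),
      (25787, 6889), (26963, 36409), (27731, 121), (27971, 46201), (29363, 36409), (30011, 121),
      (33491, 10201), (36563, 26329), (37211, 46201), (43763, 6889), (47387, 26329), (47627,
      6889), (47651, 121), (49811, 46201), (53147, 36409), (53171, 10201), (55571, 10201),
      (59051, 46201)}" using Suc unfolding v_def q_def .
  then have "(v * q mod 65520, q) \<in> {(11, 121), (83, 6889), (731, 10201), (1331, 121), (1787, 26329), (3947, 6889), (6131,
      46201), (6563, 26329), (7283, 36409), (7307, 36409), (9707, 36409), (13931, 121), (15371,
      46201), (20411, 10201), (20483, 26329), (20987, 26329), (21923, 6889), (22811, 10201),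
      (25787, 6889), (26963, 36409), (27731, 121), (27971, 46201), (29363, 36409), (30011, 121),
      (33491, 10201), (36563, 26329), (37211, 46201), (43763, 6889), (47387, 26329), (47627,
      6889), (47651, 121), (49811, 46201), (53147, 36409), (53171, 10201), (55571, 10201),
      (59051, 46201)}"
    by (elim insertE emptyE Pair_inject) (simp_all only: prod.inject, simp_all)
  ultimately show ?case unfolding q_def by simp
qed

lemma no_congruence_65520:
  fixes j n x y :: nat
  assumes "j \<ge> 1" "odd n" "odd x" "x \<ge> 3" "odd y" "\<not> (x = 3 \<and> y = 1)"
  shows "\<not> [(2 + 9 ^ j) ^ n = 2 ^ x + 3 ^ y] (mod (65520::nat))"
proof
  assume c: "[(2 + 9 ^ j) ^ n = 2 ^ x + 3 ^ y] (mod (65520::nat))"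
  define v where "v = (2 + 9 ^ j) ^ n mod (65520::nat)"
  obtain j' where j': "j = Suc j'" using assms(1) by (cases j) auto
  obtain n' where n': "n = 2 * n' + 1" using assms(2) by (metis oddE)
  have "v \<in> {11, 83, 731, 1331, 1787, 3947, 6131, 6563, 7283, 7307, 9707, 13931, 15371, 20411, 20483,
      20987, 21923, 22811, 25787, 26963, 27731, 27971, 29363, 30011, 33491, 36563, 37211, 43763,
      47387, 47627, 47651, 49811, 53147, 53171, 55571, 59051}"
    using residue_sum_power[of j' n'] unfolding j'[symmetric] n'[symmetric] v_def[symmetric]
    by (elim insertE emptyE Pair_inject) simp_all
  moreover have "v \<in> {35, 59, 131, 155, 251, 275, 371, 515, 539, 755, 2051, 2075, 2195, 2219, 2291, 2315, 2699,
      4235, 8195, 8219, 8435, 10379, 13355, 19691, 19715, 19811, 20195, 21731, 21851, 21875,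
      21971, 22355, 23891, 27875, 30035, 32771, 32795, 33011, 34955, 46115, 46139, 46235, 46619,
      48155, 52451, 54299, 54611}"
  proof -
    \<comment> \<open>The values 2^3 and 3^1 lie before the periodic parts of the two sequences,
      hence their own cases. Taken together they give 11 = 2 + 9, the pair that is assumed
      away.\<close>
    have 2: "x = 3 \<or> 2 ^ x mod (65520::nat) \<in> {32, 128, 512, 2048, 8192, 32768}"
    proof (cases "x = 3")
      case False
      then obtain i where "x = 5 + 2 * i" using assms(3,4)
        by (intro that[of "(x - 5) div 2"]) presburger
      then show ?thesis using residue_odd_power_2 by blast
    qed simp
    have 3: "y = 1 \<or> 3 ^ y mod (65520::nat) \<in> {27, 243, 2187, 19683, 21843, 46107}"
    proof (cases "y = 1")
      case False
      then obtain i where "y = 3 + 2 * i" using assms(5)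
        by (intro that[of "(y - 3) div 2"]) presburger
      then show ?thesis using residue_odd_power_3 by blast
    qed simp
    have "v = (2 ^ x mod 65520 + 3 ^ y mod 65520) mod (65520::nat)"
      using c unfolding cong_def mod_add_eq v_def .
    then show ?thesis using 2 3 assms(6) by (elim disjE insertE emptyE) simp_all
  qed
  moreover from calculation(1) have "v \<notin> {35, 59, 131, 155, 251, 275, 371, 515, 539, 755, 2051, 2075, 2195, 2219, 2291, 2315, 2699,
      4235, 8195, 8219, 8435, 10379, 13355, 19691, 19715, 19811, 20195, 21731, 21851, 21875,
      21971, 22355, 23891, 27875, 30035, 32771, 32795, 33011, 34955, 46115, 46139, 46235, 46619,
      48155, 52451, 54299, 54611}"
    by (elim insertE emptyE) simp_all
  ultimately show False by blast
qed

subsection \<open>The theorem\<close>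

lemma power_mod_3:
  fixes n :: nat
  assumes "n mod 3 \<noteq> 0"
  shows "n ^ y mod 3 = (if even y then 1 else n mod 3)"
proof -
  have n: "n mod 3 = 1 \<or> n mod 3 = 2" using assms by linarith
  show ?thesis
  proof (induction y)
    case (Suc y)
    have "n ^ Suc y mod 3 = (n mod 3) * (n ^ y mod 3) mod 3" by (simp add: mod_mult_eq)
    then show ?case using Suc n by auto
  qed simp
qed

lemma odd_power_odd_mod_8:
  fixes m :: nat
  assumes "odd m" "odd i"
  shows "m ^ i mod 8 = m mod 8"
proof -
  obtain k where "i = 2 * k + 1" using assms(2) by (metis oddE)
  then have "m ^ i mod 8 = (m ^ (2 * k) mod 8) * m mod 8" by (simp add: mod_mult_left_eq mod_mult_right_eq mult.commute)
  then show ?thesis using odd_power_even_mod_8[OF assms(1)] by simp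
qed

lemma prime_mod_3:
  fixes p :: nat
  assumes "prime p" "p \<noteq> 3"
  shows "p mod 3 \<noteq> 0"
proof
  assume "p mod 3 = 0"
  then have "3 dvd p" by auto
  then show False using assms primes_dvd_imp_eq[of 3 p] by simp
qed

section \<open>Exponential equations involving the bases 2 and 3\<close>

lemma nine_power_eq:
  assumes "(9::nat) ^ l = 2 ^ n + 1" "l \<ge> 1"
  shows "l = 1 \<and> n = 3"
proof -
  have "n < 4"
  proof (rule ccontr)
    assume "\<not> n < 4"
    then have "(2::nat) ^ 4 dvd 2 ^ n" by (intro le_imp_power_dvd) simp
    then obtain t where "(2::nat) ^ n = 16 * t" by (auto elim!: dvdE)
    then have m16: "(9::nat) ^ l mod 16 = 1" using assms(1) by simp
    \<comment> \<open>Odd powers of 9 are 9 modulo 16. For even l the power is 1 modulo 5, which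
      would make 2^n divisible by 5.\<close>
    have "even l"
    proof (rule ccontr)
      assume "odd l"
      then obtain k where "l = 2 * k + 1" by (metis oddE)
      then have "(9::nat) ^ l = 9 * 81 ^ k" by (simp add: power_mult)
      moreover have "[9 * (81::nat) ^ k = 9 * 1 ^ k] (mod 16)"
        by (intro cong_scalar_left cong_pow) (simp add: cong_def)
      then have "(9 * 81 ^ k) mod 16 = (9::nat)" by (simp add: cong_def)
      ultimately show False using m16 by simp
    qed
    then obtain k where "l = 2 * k" by (rule evenE)
    then have "(9::nat) ^ l = 81 ^ k" by (simp add: power_mult)
    moreover have "[(81::nat) ^ k = 1 ^ k] (mod 5)" by (rule cong_pow) (simp add: cong_def)
    ultimately have "(2 ^ n + 1) mod 5 = (1::nat)" using assms(1) by (simp add: cong_def)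
    then have "5 dvd (2::nat) ^ n" by presburger
    then have "5 dvd (2::nat)" using prime_dvd_power[of 5 "2::nat" n] by simp
    then show False by simp
  qed
  then have "n = 0 \<or> n = 1 \<or> n = 2 \<or> n = 3" by linarith
  moreover have "(9::nat) ^ 1 \<le> 9 ^ l" using assms(2) by (intro power_increasing) auto
  ultimately have "n = 3" using assms(1) by auto
  then have "(9::nat) ^ l = 9 ^ 1" using assms(1) by simp
  then have "l = 1" by (subst (asm) power_inject_exp) simp_all
  then show ?thesis using \<open>n = 3\<close> by simp
qed

lemma difference_of_squares_prime_power:
  fixes p A B n :: nat
  assumes "prime p" "A\<^sup>2 = B\<^sup>2 + p ^ n" "B \<ge> 1"
  obtains u v where "A = B + p ^ u" "A + B = p ^ v" "u + v = n" "u < v"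
proof -
  have "B\<^sup>2 < A\<^sup>2" using assms(1,2) prime_gt_0_nat by simp
  then have BA: "B < A" by (rule power2_less_imp_less) simp
  obtain d where d: "A = B + d" using BA less_imp_add_positive by blast
  have "(A - B) * (A + B) = p ^ n"
    using assms(2) unfolding d by (simp add: power2_eq_square algebra_simps)
  moreover from this have "A - B dvd p ^ n" "A + B dvd p ^ n" by (metis dvd_triv_left, metis dvd_triv_right)
  then obtain u v where uv: "A - B = p ^ u" "A + B = p ^ v" using divides_primepow_nat[OF assms(1)] by meson
  ultimately have "p ^ (u + v) = p ^ n" by (simp add: power_add)
  then have "u + v = n" using prime_gt_1_nat[OF assms(1)] by simp
  moreover have "p ^ u < p ^ v" using uv assms(3) BA by linarith
  then have "u < v" using prime_gt_1_nat[OF assms(1)] by simp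
  moreover have "A = B + p ^ u" using uv(1) BA by linarith
  ultimately show ?thesis using that uv(2) by blast
qed

text \<open>In b^(2 j) = (c^m - 2^k)(c^m + 2^k) the odd prime b cannot divide both factors, so the
  smaller one is 1 and b^(2 j) = 2^(k + 1) + 1. Modulo 3 this forces b = 3, and only 16 + 9 = 25 is
  left.\<close>

lemma even_even_even_exponent:
  fixes b c j k m :: nat
  assumes b: "prime b" "odd b" and c: "prime c" and jk: "j \<ge> 1" "k \<ge> 1"
    and eq: "2 ^ (2 * k) + b ^ (2 * j) = c ^ (2 * m)"
  shows "b = 3 \<and> c = 5"
proof -
  have "(c ^ m)\<^sup>2 = (2 ^ k)\<^sup>2 + b ^ (2 * j)" using eq by (simp add: power_even_eq)
  then obtain u v where uv: "c ^ m = 2 ^ k + b ^ u" "c ^ m + 2 ^ k = b ^ v" "u + v = 2 * j" "u < v"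
    by (rule difference_of_squares_prime_power[OF b(1)]) simp_all
  have bv: "b ^ v = 2 ^ (k + 1) + b ^ u" using uv by simp
  have u0: "u = 0"
  proof (rule ccontr)
    assume "u \<noteq> 0"
    then have "b dvd b ^ u" "b dvd b ^ v" using uv(4) by (simp_all add: dvd_power)
    then have "b dvd 2 ^ (k + 1)" unfolding bv by (simp add: dvd_add_left_iff)
    then have "b dvd 2" using b(1) prime_dvd_power by blast
    then show False using b primes_dvd_imp_eq two_is_prime_nat by blast
  qed
  then have bj: "b ^ (2 * j) = 2 ^ (k + 1) + 1" using bv uv(3) by simp
  have b3: "b = 3"
  proof (rule ccontr)
    assume "b \<noteq> 3"
    then have "b ^ (2 * j) mod 3 = 1" using power_mod_3[OF prime_mod_3[OF b(1)]] by simp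
    then have "3 dvd (2::nat) ^ (k + 1)" unfolding bj by presburger
    then have "3 dvd (2::nat)" by (rule prime_dvd_power[rotated]) simp
    then show False by simp
  qed
  then have "9 ^ j = (2::nat) ^ (k + 1) + 1" using bj by (simp add: power_mult)
  then have "k + 1 = 3" using nine_power_eq jk(1) by blast
  then have "k = 2" by simp
  then have "c ^ m = 5" using uv(1) u0 by simp
  then have "c = 5" using prime_power_eq_prime[OF c, of 5] by simp
  then show ?thesis using b3 by simp
qed

text \<open>The two values come from 2 + 5^2 = 3^3 and 2^5 + 7^2 = 3^4. For even z a difference of
  squares leads to 3^m = 2^w + 1; for odd z the residue 3 modulo 8 forces x = 1 and thus a square
  plus 2.\<close>

lemma odd_even_base_3:
  fixes b j x z :: nat
  assumes b: "prime b" "odd b" and "j \<ge> 1" "odd x" and eq: "2 ^ x + b ^ (2 * j) = 3 ^ z"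
  shows "b = 5 \<or> b = 7"
proof -
  have bj: "b ^ j \<ge> b" using assms(3) prime_gt_0_nat[OF b(1)] by (simp add: self_le_power)
  then have bj3: "b ^ j \<ge> 3" using prime_ge_2_nat[OF b(1)] b(2) by (cases "b = 2") auto
  show ?thesis
  proof (cases "even z")
    case True
    then obtain m where m: "z = 2 * m" by (rule evenE)
    have "(3 ^ m)\<^sup>2 = (b ^ j)\<^sup>2 + 2 ^ x" using eq m by (simp add: power_even_eq)
    then obtain u v where uv: "3 ^ m = b ^ j + 2 ^ u" "3 ^ m + b ^ j = 2 ^ v" "u < v"
      by (rule difference_of_squares_prime_power[OF two_is_prime_nat]) (use bj3 in simp_all)
    have "odd (b ^ j)" "odd ((3::nat) ^ m)" using b(2) by simp_all
    then have "u \<noteq> 0" using uv(1) by (cases u) auto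
    have sum: "2 * 3 ^ m = 2 ^ u + (2::nat) ^ v" using uv by simp
    have "u = 1"
    proof (rule ccontr)
      assume "u \<noteq> 1"
      then have "u \<ge> 2" "v \<ge> 2" using \<open>u \<noteq> 0\<close> uv(3) by auto
      then have "(2::nat) ^ 2 dvd 2 ^ u" "(2::nat) ^ 2 dvd 2 ^ v" by (intro le_imp_power_dvd; simp)+
      then have "4 dvd 2 * (3::nat) ^ m" unfolding sum by simp
      then show False using \<open>odd ((3::nat) ^ m)\<close> by presburger
    qed
    obtain w where w: "v = Suc w" using uv(3) by (cases v) auto
    have 3: "3 ^ m = (2::nat) ^ w + 1" using sum \<open>u = 1\<close> w by simp
    then have "(2::nat) ^ w \<ge> 4" using uv(1) bj3 \<open>u = 1\<close> by simp
    have "w \<ge> 3"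
    proof (rule ccontr)
      assume "\<not> w \<ge> 3"
      then have "w = 0 \<or> w = 1 \<or> w = 2" by linarith
      then have "(3::nat) ^ m = 5" using 3 \<open>(2::nat) ^ w \<ge> 4\<close> by auto
      then show False using prime_power_eq_prime[of 3 5 m] by simp
    qed
    then have "(2::nat) ^ 3 dvd 2 ^ w" by (intro le_imp_power_dvd)
    then obtain t where "(2::nat) ^ w = 8 * t" by (auto elim!: dvdE)
    then have "(3::nat) ^ m mod 8 = 1" using 3 by simp
    then have "even m" using odd_power_odd_mod_8[of 3 m] by auto
    then obtain l where "m = 2 * l" by (rule evenE)
    then have "9 ^ l = (2::nat) ^ w + 1" using 3 by (simp add: power_mult)
    moreover have "l \<ge> 1" using \<open>m = 2 * l\<close> 3 by (cases l) auto
    ultimately have "w = 3" using nine_power_eq by blast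
    then have "b ^ j = 7" using 3 uv(1) \<open>u = 1\<close> by simp
    then show ?thesis using prime_power_eq_prime[OF b(1), of 7] by simp
  next
    case False
    have "(3::nat) ^ z mod 8 = 3" using odd_power_odd_mod_8[of 3 z] False by simp
    have "x = 1"
    proof (rule ccontr)
      assume "x \<noteq> 1"
      then have "x \<ge> 3" using assms(4) by presburger
      then have "(2::nat) ^ 3 dvd 2 ^ x" by (intro le_imp_power_dvd)
      then obtain t where "(2::nat) ^ x = 8 * t" by (auto elim!: dvdE)
      then have "(2 ^ x + b ^ (2 * j)) mod 8 = 1" using odd_power_even_mod_8[OF b(2), of j] by simp
      then show False using eq \<open>(3::nat) ^ z mod 8 = 3\<close> by simp
    qed
    then have "(b ^ j)\<^sup>2 + 2 = 3 ^ z" using eq by (simp add: power_even_eq)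
    then have "b ^ j = 5" by (rule square_add_2_eq_power_3) (use False bj3 in auto)
    then show ?thesis using prime_power_eq_prime[OF b(1), of 5] by simp
  qed
qed

text \<open>Modulo 3 one has 2^x = -b^y. Once x odd with y even is excluded by
  \<open>odd_even_base_3\<close>, the residue of b determines both parities, so the two solutions
  would share their type.\<close>

lemma two_sols_base_3:
  fixes b :: nat
  assumes b: "prime b" "odd b" "b \<noteq> 3"
    and sol1: "x1 > 0" "y1 > 0" "2 ^ x1 + b ^ y1 = 3 ^ z1"
    and sol2: "x2 > 0" "y2 > 0" "2 ^ x2 + b ^ y2 = 3 ^ z2"
    and ne: "(x1, y1, z1) \<noteq> (x2, y2, z2)"
  shows "b = 5 \<or> b = 7"
proof (rule ccontr)
  assume neg: "\<not> ?thesis"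
  have par: "odd x \<and> b mod 3 = 1 \<and> odd y \<or> even x \<and> b mod 3 = 2 \<and> odd y"
    if sol: "x > 0" "y > 0" "2 ^ x + b ^ y = 3 ^ z" for x y z
  proof -
    have "(2::nat) ^ x > 0" "b ^ y > 0" using prime_gt_0_nat[OF b(1)] by simp_all
    then have "3 ^ z \<noteq> (1::nat)" using sol(3) by linarith
    then have "z \<noteq> 0" by (cases z) auto
    then have "(3::nat) dvd 3 ^ z" by simp
    then have "(2 ^ x + b ^ y) mod 3 = 0" using sol(3) by simp
    then have "((2 ^ x) mod 3 + (b ^ y) mod 3) mod 3 = 0" by (simp add: mod_add_eq)
    moreover have "(2::nat) ^ x mod 3 = (if even x then 1 else 2)" using power_mod_3[of 2 x] by simp
    moreover have "b ^ y mod 3 = (if even y then 1 else b mod 3)" using power_mod_3[OF prime_mod_3[OF b(1,3)]] .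
    moreover have "b mod 3 = 1 \<or> b mod 3 = 2" using prime_mod_3[OF b(1,3)] by linarith
    moreover have "\<not> (odd x \<and> even y)"
    proof
      assume "odd x \<and> even y"
      moreover from this obtain j where "y = 2 * j" by (auto elim: evenE)
      ultimately show False using odd_even_base_3[OF b(1,2), of j x z] sol neg by auto
    qed
    moreover have "\<not> 3 dvd Suc (Suc 0)" by presburger
    ultimately show ?thesis by (auto split: if_splits)
  qed
  have "even x1 = even x2" "even y1 = even y2" using par[OF sol1] par[OF sol2] by auto
  moreover have "b \<noteq> 2" using b(2) by auto
  ultimately have "x1 = x2 \<and> y1 = y2 \<and> z1 = z2"
    using parity_class_unique[of 2 b 3, OF two_is_prime_nat b(1) _ _ _ b(3) _ sol1 sol2] by simp
  then show False using ne by simp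
qed

text \<open>Eliminates c: (2 + 9^j)^(z1 z2) = c^(z1^2 z2), which is c^z2 modulo 65520 because z1^2
  is 1 modulo 12. For this z1 has to be prime to 3, and it is, since 2 + 9^j is 2 modulo 9 and thus
  no cube. Comparing residues leaves only 2^3 + 3.\<close>

lemma mixed_sols_2_3:
  fixes c :: nat
  assumes c: "odd c" "\<not> 3 dvd c" and "j \<ge> 1" "odd z1" "2 + 9 ^ j = c ^ z1"
    and "odd x" "x \<ge> 3" "odd y" "odd z2" "2 ^ x + 3 ^ y = c ^ z2"
  shows "x = 3 \<and> y = 1"
proof (rule ccontr)
  assume neg: "\<not> ?thesis"
  have "\<not> 3 dvd z1"
  proof
    assume "3 dvd z1"
    then obtain m where m: "z1 = 3 * m" by (rule dvdE)
    have "(c ^ 3) mod 9 \<in> {1, 8}"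
    proof -
      have "c mod 9 \<in> {1, 2, 4, 5, 7, 8}" using c(2) by simp presburger
      then show ?thesis unfolding power_mod[of c, symmetric] by auto
    qed
    moreover have "(c ^ 3) ^ n mod 9 \<in> {1, 8}" if "(c ^ 3) mod 9 \<in> {1, 8}" for n
    proof (induction n)
      case (Suc n)
      have "(c ^ 3) ^ Suc n mod 9 = ((c ^ 3) mod 9) * ((c ^ 3) ^ n mod 9) mod 9" by (simp only: power_Suc mod_mult_eq)
      then show ?case using Suc that by auto
    qed simp
    ultimately have "c ^ z1 mod 9 \<in> {1, 8}" unfolding m power_mult by blast
    moreover have "(2 + 9 ^ j) mod 9 = (2::nat)"
    proof -
      obtain i where "j = Suc i" using assms(3) by (cases j) auto
      then show ?thesis by (simp only: power_Suc mod_mult_self2) simp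
    qed
    ultimately show False using assms(5) by simp
  qed
  then obtain q where q: "z1 * z1 = 1 + 12 * q"
  proof -
    have "z1 mod 12 \<in> {1, 5, 7, 11}" using \<open>\<not> 3 dvd z1\<close> assms(4) by simp presburger
    moreover have "z1 * z1 mod 12 = (z1 mod 12) * (z1 mod 12) mod 12" by (simp only: mod_mult_eq)
    ultimately have "z1 * z1 mod 12 = 1" by auto
    then have "z1 * z1 = 1 + 12 * (z1 * z1 div 12)" by (metis mult_div_mod_eq add.commute)
    then show thesis by (rule that)
  qed
  have "[c ^ (1 + 12) = c ^ 1] (mod 65520)" using power_13_cong[OF c] by simp
  then have "[c ^ (1 + 12 * q) = c ^ (1 + 12 * q mod 12)] (mod 65520)" by (rule power_periodic)
  then have "[c ^ (z1 * z1) = c] (mod 65520)" unfolding q by simp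
  then have "[(c ^ (z1 * z1)) ^ z2 = c ^ z2] (mod 65520)" by (rule cong_pow)
  moreover have "(c ^ (z1 * z1)) ^ z2 = (2 + 9 ^ j) ^ (z1 * z2)"
    unfolding assms(5) by (simp flip: power_mult add: mult.assoc)
  ultimately have "[(2 + 9 ^ j) ^ (z1 * z2) = 2 ^ x + 3 ^ y] (mod (65520::nat))" using assms(10) by metis
  then show False using no_congruence_65520[OF assms(3) _ assms(6,7,8), of "z1 * z2"] assms(4,9) neg by simp
qed

lemma power_2_mod_8:
  assumes "odd x"
  shows "x = 1 \<or> x \<ge> 3 \<and> (2::nat) ^ x mod 8 = 0"
proof (cases "x = 1")
  case False
  then have "x \<ge> 3" using assms by presburger
  moreover from this have "(2::nat) ^ 3 dvd 2 ^ x" by (intro le_imp_power_dvd)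
  ultimately show ?thesis by simp
qed simp

text \<open>The residues of c modulo 3 and 8 determine the parities, with even z for even x ruled
  out through 16 + 9 = 25. The one ambiguity is c = 2 modulo 3 and c = 3 modulo 8, which admits both
  x = 1 with y even and x at least 3 with y odd; this pair is handled by
  \<open>mixed_sols_2_3\<close>.\<close>

lemma two_sols_2_3:
  fixes c :: nat
  assumes c: "prime c" "c \<noteq> 2" "c \<noteq> 3"
    and sol1: "x1 > 0" "y1 > 0" "2 ^ x1 + 3 ^ y1 = c ^ z1"
    and sol2: "x2 > 0" "y2 > 0" "2 ^ x2 + 3 ^ y2 = c ^ z2"
    and ne: "(x1, y1, z1) \<noteq> (x2, y2, z2)"
  shows "c = 5 \<or> c = 11"
proof (rule ccontr)
  assume neg: "\<not> ?thesis"
  have oc: "odd c" using c primes_dvd_imp_eq[of 2 c] by auto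
  have c3: "c mod 3 = 1 \<or> c mod 3 = 2" using prime_mod_3[OF c(1,3)] by linarith
  have nc3: "\<not> 3 dvd c" using prime_mod_3[OF c(1,3)] by (simp add: dvd_eq_mod_eq_0)
  have c8: "c ^ z mod 8 = (if even z then 1 else c mod 8)" for z
    using odd_power_odd_mod_8[OF oc, of z] odd_power_even_mod_8[OF oc] by (auto elim!: evenE)
  have t8: "(3::nat) ^ y mod 8 = (if even y then 1 else 3)" for y
    using odd_power_odd_mod_8[of 3 y] odd_power_even_mod_8[of 3] by (auto elim!: evenE)
  have x4: "(2::nat) ^ x mod 4 = 0" if "even x" "x > 0" for x
  proof -
    have "x \<ge> 2" using that by presburger
    then have "(2::nat) ^ 2 dvd 2 ^ x" by (rule le_imp_power_dvd)
    then show ?thesis by simp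
  qed
  have par: "c mod 3 = 1 \<and> even x \<and> (even y \<longleftrightarrow> c mod 4 = 1) \<or>
      c mod 3 = 2 \<and> odd x \<and> odd z \<and> (even y \<longrightarrow> c mod 8 = (if x = 1 then 3 else 1)) \<and> (odd y \<longrightarrow> c mod 8 = (if x = 1 then 5 else 3))"
    if sol: "x > 0" "y > 0" "2 ^ x + 3 ^ y = c ^ z" for x y z
  proof -
    have "(2 ^ x + 3 ^ y) mod 3 = (2::nat) ^ x mod 3"
      using sol(2) by (metis dvd_power mod_add_right_eq add_0_right mod_0_imp_dvd dvd_imp_mod_0)
    also have "\<dots> = (if even x then 1 else 2)" using power_mod_3[of 2 x] by simp
    finally have m3: "c ^ z mod 3 = (if even x then 1 else 2)" unfolding sol(3) .
    have cz: "c ^ z mod 3 = (if even z then 1 else c mod 3)" using power_mod_3[OF prime_mod_3[OF c(1,3)]] .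
    have ev: "odd z \<and> (even y \<longleftrightarrow> c mod 4 = 1)" if "even x"
    proof -
      have "(2 ^ x + 3 ^ y) mod 4 = (3::nat) ^ y mod 4"
        using x4[OF that sol(1)] by (metis add_0 mod_add_left_eq)
      also have "\<dots> = (3 ^ y mod 8) mod 4" by (simp add: mod_mod_cancel)
      also have "\<dots> = (if even y then 1 else 3)" unfolding t8 by simp
      finally have y4: "c ^ z mod 4 = (if even y then 1 else 3)" unfolding sol(3) .
      have "c ^ z mod 4 = (c ^ z mod 8) mod 4" by (simp add: mod_mod_cancel)
      also have "\<dots> = (if even z then 1 else c mod 8 mod 4)" unfolding c8 by simp
      also have "c mod 8 mod 4 = c mod 4" by (simp add: mod_mod_cancel)
      finally have z4: "c ^ z mod 4 = (if even z then 1 else c mod 4)" .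
      have "odd z"
      proof
        assume "even z"
        then have "even y" using y4 z4 by (cases "even y") simp_all
        obtain k where k: "x = 2 * k" using \<open>even x\<close> by (rule evenE)
        obtain j where j: "y = 2 * j" using \<open>even y\<close> by (rule evenE)
        obtain m where m: "z = 2 * m" using \<open>even z\<close> by (rule evenE)
        show False
          using even_even_even_exponent[of 3 c j k m] c(1) sol neg unfolding k j m by simp
      qed
      then show ?thesis using y4 z4 by auto
    qed
    have od: "c mod 8 = (if even y then (if x = 1 then 3 else 1) else (if x = 1 then 5 else 3))" if "odd x" "odd z"
    proof -
      have "(2 ^ x + 3 ^ y) mod 8 = ((2::nat) ^ x mod 8 + 3 ^ y mod 8) mod 8" by (simp add: mod_add_eq)
      also have "\<dots> = (if even y then (if x = 1 then 3 else 1) else (if x = 1 then 5 else 3))"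
        unfolding t8 using power_2_mod_8[OF that(1)] by auto
      finally show ?thesis unfolding sol(3) c8 using that(2) by simp
    qed
    show ?thesis using c3 m3 cz ev od by (auto split: if_splits)
  qed
  have uniq: "even x1 = even x2 \<Longrightarrow> even y1 = even y2 \<Longrightarrow> False"
    using parity_class_unique[of 2 3 c, OF two_is_prime_nat _ c(1) _ _ _ _ sol1 sol2] c ne by auto
  have key: False if s1: "x > 0" "2 ^ x + 3 ^ y = c ^ z" "odd z" "even y" "y > 0" "x = 1"
    and s2: "odd x'" "x' \<ge> 3" "odd y'" "odd z'" "2 ^ x' + 3 ^ y' = c ^ z'" for x y z x' y' z'
  proof -
    obtain j where j: "y = 2 * j" using \<open>even y\<close> by (rule evenE)
    have "2 + 9 ^ j = c ^ z" using s1 j by (simp add: power_mult)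
    moreover have "j \<ge> 1" using s1(5) j by simp
    ultimately have "x' = 3 \<and> y' = 1" using mixed_sols_2_3[OF oc nc3 _ s1(3) _ s2] by blast
    then have "c ^ z' = 11" using s2(5) by simp
    then have "c = 11" using prime_power_eq_prime[OF c(1), of 11] by simp
    then show False using neg by simp
  qed
  consider "c mod 3 = 1" | "c mod 3 = 2" using c3 by blast
  then show False
  proof cases
    case 1
    then show False using par[OF sol1] par[OF sol2] uniq by auto
  next
    case 2
    then have p1: "odd x1" "odd z1" "even y1 \<longrightarrow> c mod 8 = (if x1 = 1 then 3 else 1)" "odd y1 \<longrightarrow> c mod 8 = (if x1 = 1 then 5 else 3)"
      and p2: "odd x2" "odd z2" "even y2 \<longrightarrow> c mod 8 = (if x2 = 1 then 3 else 1)" "odd y2 \<longrightarrow> c mod 8 = (if x2 = 1 then 5 else 3)"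
      using par[OF sol1] par[OF sol2] by auto
    have "even y1 \<noteq> even y2" using uniq p1(1) p2(1) by auto
    then consider "even y1" "odd y2" | "odd y1" "even y2" by blast
    then show False
    proof cases
      case 1
      then have "x1 = 1" "x2 \<noteq> 1" using p1(3) p2(4) by (auto split: if_splits)
      then show False using key[OF sol1(1,3) p1(2) 1(1) sol1(2) _ p2(1) _ 1(2) p2(2) sol2(3)] power_2_mod_8[OF p2(1)] by auto
    next
      case 2
      then have "x2 = 1" "x1 \<noteq> 1" using p1(4) p2(3) by (auto split: if_splits)
      then show False using key[OF sol2(1,3) p2(2) 2(2) sol2(2) _ p1(1) _ 2(1) p1(2) sol1(3)] power_2_mod_8[OF p1(1)] by auto
    qed
  qed
qed

section \<open>The case a = 2 with b and c different from 3\<close>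

lemma sols_2_mod_3:
  fixes b c :: nat
  assumes "prime b" "b \<noteq> 3" "prime c" "c \<noteq> 3" "(x, y, z) \<in> sols 2 b c"
  shows "((if even x then 1 else 2) + (if even y then 1 else b mod 3)) mod 3 = (if even z then 1 else c mod 3)"
proof -
  have b3: "b mod 3 \<noteq> 0" and c3: "c mod 3 \<noteq> 0" using prime_mod_3 assms by auto
  have eq: "2 ^ x + b ^ y = c ^ z" using assms(5) by (simp add: sols_def)
  have two: "(2::nat) ^ x mod 3 = (if even x then 1 else 2)" using power_mod_3[of 2 x] by simp
  have "(2 ^ x + b ^ y) mod 3 = ((2::nat) ^ x mod 3 + b ^ y mod 3) mod 3" by (simp only: mod_add_eq)
  then show ?thesis unfolding eq two power_mod_3[OF b3] power_mod_3[OF c3] by (rule sym)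
qed

text \<open>Two nonzero residues modulo 3 have a nonzero sum only if they are equal, so 2^x = b^y
  modulo 3. For even y both are 1 and x is even; for odd y the residue r of b dictates the parity of
  x.\<close>

lemma parity_of_mod_3_eq:
  fixes r t :: nat
  assumes "r = 1 \<or> r = 2" "t = 1 \<or> t = 2"
    and "((if P then 1 else 2) + (if Q then 1 else r)) mod 3 = (if S then 1 else t)"
  shows "P \<and> Q \<or> \<not> Q \<and> (P \<longleftrightarrow> r = 1)"
  using assms by (cases P; cases Q; cases S; simp only: if_True if_False simp_thms; presburger)

lemma sols_2_parity:
  fixes b c :: nat
  assumes "prime b" "b \<noteq> 3" "prime c" "c \<noteq> 3" "(x, y, z) \<in> sols 2 b c"
  shows "even x \<and> even y \<or> odd y \<and> (even x \<longleftrightarrow> b mod 3 = 1)"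
proof -
  have "b mod 3 = 1 \<or> b mod 3 = 2" "c mod 3 = 1 \<or> c mod 3 = 2"
    using prime_mod_3[OF assms(1,2)] prime_mod_3[OF assms(3,4)] by linarith+
  then show ?thesis using sols_2_mod_3[OF assms] by (rule parity_of_mod_3_eq)
qed

lemma sols_2_unique:
  fixes b c :: nat
  assumes "prime b" "prime c" "b \<noteq> 2" "c \<noteq> 2" "b \<noteq> c"
    and "(x, y, z) \<in> sols 2 b c" "(x', y', z') \<in> sols 2 b c" "even x = even x'" "even y = even y'"
  shows "(x, y, z) = (x', y', z')"
  using parity_class_unique[of 2 b c x y z x' y' z'] assms by (simp add: sols_def)

lemma two_sols_2_generic:
  fixes b c :: nat
  assumes b: "prime b" "b \<noteq> 2" "b \<noteq> 3" and c: "prime c" "c \<noteq> 2" "c \<noteq> 3" "b \<noteq> c"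
    and sol1: "(x1, y1, z1) \<in> sols 2 b c" and sol2: "(x2, y2, z2) \<in> sols 2 b c"
    and ne: "(x1, y1, z1) \<noteq> (x2, y2, z2)" and ee: "even x1" "even y1"
  shows "c mod 12 = 5 \<and> z1 = 1 \<and> odd y2 \<and> sols 2 b c = {(x1, y1, z1), (x2, y2, z2)}"
proof -
  have ob: "odd b" using b primes_dvd_imp_eq[of 2 b] by auto
  have solD: "x > 0" "y > 0" "z > 0" "2 ^ x + b ^ y = c ^ z" if "(x, y, z) \<in> sols 2 b c" for x y z
    using that by (auto simp: sols_def)
  note mod3 = sols_2_mod_3[OF b(1,3) c(1,3)] and par = sols_2_parity[OF b(1,3) c(1,3)]
    and uniq = sols_2_unique[OF b(1) c(1) b(2) c(2,4)]
  have oy2: "odd y2" using par[OF sol2] uniq[OF sol1 sol2] ee ne by auto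
  have "sols 2 b c \<subseteq> {(x1, y1, z1), (x2, y2, z2)}"
  proof
    fix s assume "s \<in> sols 2 b c"
    obtain x y z where s: "s = (x, y, z)" by (cases s)
    then have xyz: "(x, y, z) \<in> sols 2 b c" using \<open>s \<in> sols 2 b c\<close> by simp
    show "s \<in> {(x1, y1, z1), (x2, y2, z2)}"
    proof (cases "even y")
      case True
      then have "even x" using par[OF xyz] by auto
      then show ?thesis using uniq[OF xyz sol1] True ee s by auto
    next
      case False
      then have "even x = even x2" using par[OF xyz] par[OF sol2] oy2 by auto
      then show ?thesis using uniq[OF xyz sol2] False oy2 s by auto
    qed
  qed
  then have sols: "sols 2 b c = {(x1, y1, z1), (x2, y2, z2)}" using sol1 sol2 by auto
  obtain k where k: "x1 = 2 * k" using ee(1) by (rule evenE)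
  obtain j where j: "y1 = 2 * j" using ee(2) by (rule evenE)
  have kj: "k \<ge> 1" "j \<ge> 1" using solD(1,2)[OF sol1] k j by auto
  have eq: "2 ^ (2 * k) + b ^ (2 * j) = c ^ z1" using solD(4)[OF sol1] unfolding k j .
  have oz: "odd z1"
  proof
    assume "even z1"
    then obtain m where "z1 = 2 * m" by (rule evenE)
    then show False using even_even_even_exponent[OF b(1) ob c(1) kj(2,1), of m] eq b(3) by simp
  qed
  have z1: "z1 = 1"
  proof (rule ccontr)
    assume "z1 \<noteq> 1"
    \<comment> \<open>What remains is 2^2 + 11^2 = 5^3. A second solution for (2, 11, 5) would have
      x and y odd and, modulo 3, z even; then 5^z is 1 modulo 8, but 2^x + 11^y is 5 or 3.\<close>
    then have bc: "b = 11" "c = 5" using even_even_odd_exponent[OF b(1) ob c(1,4) kj(2,1) oz eq] by auto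
    have ox: "odd x2" using par[OF sol2] oy2 bc by auto
    have "even z2" using mod3[OF sol2] ox oy2 bc by (cases "even z2") simp_all
    then obtain m where "z2 = 2 * m" by (rule evenE)
    then have "c ^ z2 mod 8 = 1" using odd_power_even_mod_8[of 5 m] bc by simp
    moreover have "c ^ z2 mod 8 = (2 ^ x2 mod 8 + b ^ y2 mod 8) mod 8"
      unfolding solD(4)[OF sol2, symmetric] by (simp add: mod_add_eq)
    moreover have "b ^ y2 mod 8 = 3" using odd_power_odd_mod_8[of 11 y2] oy2 bc by simp
    ultimately show False using power_2_mod_8[OF ox] by auto
  qed
  have "c mod 4 = 1"
  proof -
    have "(2::nat) ^ 2 dvd 2 ^ (2 * k)" using kj by (intro le_imp_power_dvd) simp
    then obtain t where t: "(2::nat) ^ (2 * k) = 4 * t" by (auto elim!: dvdE)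
    have "b ^ (2 * j) mod 4 = (b ^ (2 * j) mod 8) mod 4" by (simp add: mod_mod_cancel)
    then have "b ^ (2 * j) mod 4 = 1" using odd_power_even_mod_8[OF ob, of j] by simp
    then have "(4 * t + b ^ (2 * j)) mod 4 = 1" by simp
    moreover have "4 * t + b ^ (2 * j) = c" using eq z1 t by simp
    ultimately show ?thesis by simp
  qed
  moreover have "c mod 3 = 2" using mod3[OF sol1] ee oz by simp
  ultimately have "c mod 12 = 5" by presburger
  then show ?thesis using z1 oy2 sols by blast
qed

theorem theorem1p4:
  fixes a b c :: nat
  assumes "prime a" "prime b" "prime c"
    and "a \<noteq> b" "a \<noteq> c" "b \<noteq> c" "a < b"
    and "N a b c > 1"
    and "(a, b, c) \<notin> {(2,3,5), (2,3,11), (2,5,3), (2,7,3), (3,5,2), (3,13,2)}"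
  shows "c mod 12 = 5 \<and>
    (\<exists>x1 y1 z1 x2 y2 z2.
       sols a b c = {(x1, y1, z1), (x2, y2, z2)} \<and> (x1, y1, z1) \<noteq> (x2, y2, z2) \<and>
       even x1 \<and> even y1 \<and> z1 = 1 \<and> odd y2)"
proof -
  \<comment> \<open>Two distinct solutions can be picked without knowing finiteness, as a set with
    at most one element has cardinality at most 1. That there is no third one comes from
    \<open>two_sols_2_generic\<close>.\<close>
  have "\<exists>s s'. s \<in> sols a b c \<and> s' \<in> sols a b c \<and> s \<noteq> s'"
  proof (rule ccontr)
    assume "\<not> ?thesis"
    then have "sols a b c = {} \<or> (\<exists>s. sols a b c = {s})" by blast
    then have "card (sols a b c) \<le> 1" by auto
    then show False using assms(8) by (simp add: N_def)
  qed
  then obtain x1 y1 z1 x2 y2 z2 where sol1: "(x1, y1, z1) \<in> sols a b c" and sol2: "(x2, y2, z2) \<in> sols a b c"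
    and ne: "(x1, y1, z1) \<noteq> (x2, y2, z2)" by (metis prod_cases3)
  have s1: "x1 > 0" "y1 > 0" "a ^ x1 + b ^ y1 = c ^ z1" and s2: "x2 > 0" "y2 > 0" "a ^ x2 + b ^ y2 = c ^ z2"
    and z1: "z1 > 0"
    using sol1 sol2 by (auto simp: sols_def)
  have b2: "b \<noteq> 2" using assms(7) prime_ge_2_nat[OF assms(1)] by linarith
  then have ob: "odd b" using assms(2) primes_dvd_imp_eq[of 2 b] by auto
  have "c \<noteq> 2"
  proof
    assume "c = 2"
    then show False using prime_sum_power_of_two[OF assms(1,2,7) _ b2, of x1 y1 z1 x2 y2 z2] s1 s2 ne assms(5,9) by auto
  qed
  then have oc: "odd c" using assms(3) primes_dvd_imp_eq[of 2 c] by auto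
  have "even (a ^ x1)" using s1 ob oc z1 by (metis even_add even_power)
  then have "even a" by simp
  then have a: "a = 2" using assms(1) primes_dvd_imp_eq[of 2 a] by auto
  have b3: "b \<noteq> 3"
    using two_sols_2_3[OF assms(3) \<open>c \<noteq> 2\<close>, of x1 y1 z1 x2 y2 z2] s1 s2 ne assms(6,9) a by auto
  have c3: "c \<noteq> 3"
    using two_sols_base_3[OF assms(2) ob b3, of x1 y1 z1 x2 y2 z2] s1 s2 ne assms(9) a by auto
  note generic = two_sols_2_generic[OF assms(2) b2 b3 assms(3) \<open>c \<noteq> 2\<close> c3 assms(6)]
  have sol: "(x1, y1, z1) \<in> sols 2 b c" "(x2, y2, z2) \<in> sols 2 b c" using sol1 sol2 a by simp_all
  show ?thesis
  proof (cases "even x1 \<and> even y1")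
    case True
    then show ?thesis using generic[OF sol ne] ne unfolding a by blast
  next
    case False
    \<comment> \<open>Besides (even, even) only one type is possible, and two distinct solutions
      cannot share it.\<close>
    have "even x2 \<and> even y2"
    proof (rule ccontr)
      assume "\<not> (even x2 \<and> even y2)"
      then have "even x1 = even x2" "even y1 = even y2"
        using False sols_2_parity[OF assms(2) b3 assms(3) c3] sol by blast+
      then show False using sols_2_unique[OF assms(2,3) b2 \<open>c \<noteq> 2\<close> assms(6)] sol ne by blast
    qed
    then show ?thesis using generic[OF sol(2,1) ne[symmetric]] ne unfolding a by blast
  qed
qed

end
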